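(* Let $k_2\in\mathbb{N}$ and let $\gamma$ be real with $\gamma\ge k_2$. Fix $u_2\in\mathbb{C}\setminus\{0\}$ and put $z_2=u_2/\sqrt{N}$. Then as $N\to\infty$, $$\mathbb{E}\big(|\det G_N|^{2\gamma}|\det(G_N-z_2)|^{2k_2}\big)=e^{k_2|u_2|^2-(\gamma+k_2)N+\frac{\gamma^2+k_2^2}{2}\log N}\,e^{-2k_2\gamma\log|z_2|}\,\frac{(2\pi)^{(\gamma+k_2)/2}}{G(1+k_2)G(1+\gamma)}\,\mathbb{P}\big(\lambda^{(\mathrm{LUE}_{k_2,\gamma})}_{\max}<|u_2|^2\big)\,(1+o(1)).$$ (This is the expansion of Theorem 1.4 with $z=0$, $u_1=0$, $k_1=\gamma$.)
   Context: $G_N=N^{-1/2}G$ where $G$ is an $N\times N$ matrix of i.i.d. standard complex Gaussian entries (density $\pi^{-1}e^{-|w|^2}$). $G(\cdot)$ is the Barnes $G$-function. For real $p\ge k$ with $k\in\mathbb{N}$, $\mathrm{LUE}_{k,p}$ denotes the random $k$-point configuration on $[0,\infty)$ with density proportional to $\prod_{j=1}^k t_j^{p-k}e^{-t_j}\prod_{i<j}(t_j-t_i)^2$, and $\lambda^{(\mathrm{LUE}_{k,p})}_{\max}$ its largest point. *)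

theory Defs
  imports "HOL-Probability.Probability"
begin

definition cgauss :: "complex measure" where
  "cgauss = density lborel (\<lambda>w. ennreal (exp (- (cmod w)\<^sup>2) / pi))"

definition ginibre :: "nat \<Rightarrow> (nat \<times> nat \<Rightarrow> complex) measure" where
  "ginibre N = PiM ({..<N} \<times> {..<N}) (\<lambda>_. cgauss)"

definition mdet :: "nat \<Rightarrow> (nat \<times> nat \<Rightarrow> complex) \<Rightarrow> complex" where
  "mdet N A = (\<Sum>p | p permutes {..<N}. of_int (sign p) * (\<Prod>i<N. A (i, p i)))"

definition ginibre_shift :: "nat \<Rightarrow> complex \<Rightarrow> (nat \<times> nat \<Rightarrow> complex) \<Rightarrow> (nat \<times> nat \<Rightarrow> complex)" where
  "ginibre_shift N z G = (\<lambda>(i,j). G (i,j) / complex_of_real (sqrt (real N)) - (if i = j then z else 0))"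

(* Barnes G-function on reals (Weierstrass product form):
  G(1+z) = (2 pi)^{z/2} exp(-(z + z^2 (1+gamma_E))/2) prod_{k>=1} (1+z/k)^k exp(-z + z^2/(2k)). *)
definition barnes_G :: "real \<Rightarrow> real" where
  "barnes_G x = (let z = x - 1 in
     (2 * pi) powr (z / 2) * exp (- (z + z\<^sup>2 * (1 + euler_mascheroni)) / 2) *
     (\<Prod>n. (1 + z / real (Suc n)) ^ Suc n * exp (- z + z\<^sup>2 / (2 * real (Suc n)))))"

definition lue_weight :: "nat \<Rightarrow> real \<Rightarrow> (nat \<Rightarrow> real) \<Rightarrow> real" where
  "lue_weight k p t = (\<Prod>j<k. t j powr (p - real k) * exp (- t j)) *
      (\<Prod>j<k. \<Prod>i<j. (t j - t i)\<^sup>2)"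

definition lue_max_prob :: "nat \<Rightarrow> real \<Rightarrow> real \<Rightarrow> real" where
  "lue_max_prob k p x =
     (\<integral>t. indicator {t. \<forall>j<k. 0 < t j \<and> t j < x} t * lue_weight k p t \<partial>(PiM {..<k} (\<lambda>_. lborel)))
   / (\<integral>t. indicator {t. \<forall>j<k. 0 < t j} t * lue_weight k p t \<partial>(PiM {..<k} (\<lambda>_. lborel)))"

end

theory Submission
  imports Defs "Jordan_Normal_Form.Char_Poly" "HOL-Complex_Analysis.Complex_Analysis" "HOL-Real_Asymp.Real_Asymp"
begin

text \<open>Let \<open>f\<close> be a functional of matrices that is multiplicative over eigenvalues. Conditionally on all entries
  but one corner entry \<open>a\<close>, the eigenvalues are the preimages of \<open>a\<close> under a rational function, so the area
  formula turns the integral over \<open>a\<close> into an integral over one eigenvalue, each matrix being counted once per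
  eigenvalue. A unitary change of variables sending the corresponding eigenvector to a coordinate vector then
  splits off that eigenvalue; no Schur decomposition is needed. That almost every matrix is
  counted exactly \<open>N\<close> times follows by comparing total masses for \<open>f = 1\<close>. Iterating gives the Coulomb gas
  integral with the squared Vandermonde determinant.

  For \<open>|det G|\<close> and \<open>|det (G - u)|\<close> raised to the powers \<open>2 \<gamma>\<close> and \<open>2 k\<close>, Andreief's identity yields a Gram determinant of size \<open>N\<close>,
  and Jacobi's identity for complementary minors of inverse matrices reduces it to a \<open>k \<times> k\<close> determinant whose entries
  converge as \<open>N\<close> tends to infinity. Row operations by monic polynomials identify the limit with the Hankel determinant
  of incomplete Gamma moments, which by Andreief again is the distribution function of the largest point of the
  Laguerre ensemble. The prefactor is a product of Gamma functions, compared with the Barnes product.\<close>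

section \<open>Area formula for holomorphic maps\<close>

text \<open>The derivative of the corner entry as a function of an eigenvalue \<open>l\<close> is a
  quotient: the characteristic polynomial at \<open>l\<close> of the compressed matrix over that of
  the untouched block. The denominator cancels the Jacobian of exchanging the last column for the
  eigenvector. The numerator is again multiplicative over eigenvalues and is absorbed into
  \<open>f\<close>; this closure is why a whole class of functionals is treated, and iterated it
  yields the squared Vandermonde determinant. The comparison of masses avoids any discussion of
  multiple eigenvalues: the fibres need only be bounded by the degree, since both masses for
  \<open>f = 1\<close> are explicit.

  In the moment, |z - u|^(2k) is absorbed by powers of z - u, so the Gram matrix is a block of a
  larger one whose weight is rotation invariant and whose inverse is given by the binomial theorem.
  The hypothesis \<gamma> \<ge> k keeps the exponent of the Laguerre weight nonnegative and allows
  the same functional to be tested against falling factorials shifted by \<gamma>, for which every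
  entry is an incomplete Gamma integral.\<close>

definition complex_of_vec2 :: "(real, 2) Finite_Cartesian_Product.vec \<Rightarrow> complex" where
  "complex_of_vec2 x = Complex (vec_nth x 1) (vec_nth x 2)"

definition vec2_of_complex :: "complex \<Rightarrow> (real, 2) Finite_Cartesian_Product.vec" where
  "vec2_of_complex z = vec_lambda (\<lambda>i. if i = 1 then Re z else Im z)"

lemma vec2_of_complex_nth [simp]:
  "vec_nth (vec2_of_complex z) 1 = Re z" "vec_nth (vec2_of_complex z) 2 = Im z"
  by (auto simp: vec2_of_complex_def)

lemma complex_of_vec2_inverse [simp]: "vec2_of_complex (complex_of_vec2 x) = x"
  by (auto simp: complex_of_vec2_def Finite_Cartesian_Product.vec_eq_iff forall_2)

lemma vec2_of_complex_inverse [simp]: "complex_of_vec2 (vec2_of_complex z) = z"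
  by (auto simp: complex_of_vec2_def)

lemma complex_of_vec2_vimage: "complex_of_vec2 -` X = vec2_of_complex ` X"
  by (auto simp: image_iff) (metis complex_of_vec2_inverse)+

lemma bounded_linear_complex_of_vec2: "bounded_linear complex_of_vec2"
  by (intro linear_conv_bounded_linear[THEN iffD1] linearI)
     (auto simp: complex_of_vec2_def complex_eq_iff)

lemma bounded_linear_vec2_of_complex: "bounded_linear vec2_of_complex"
  by (intro linear_conv_bounded_linear[THEN iffD1] linearI)
     (auto simp: Finite_Cartesian_Product.vec_eq_iff forall_2)

lemma measurable_complex_of_vec2 [measurable]: "complex_of_vec2 \<in> borel_measurable borel"
  using bounded_linear_complex_of_vec2 linear_continuous_on borel_measurable_continuous_onI by blast

text \<open>The change of variables theorem with a Jacobian determinant lives on real vectors; this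
  transport of Lebesgue measure lets its conclusion be read in the complex plane.\<close>

lemma lborel_complex_of_vec2: "distr lborel borel complex_of_vec2 = lborel"
proof (rule lborel_eqI[symmetric])
  fix l u :: complex
  assume le: "\<And>b. b \<in> Basis \<Longrightarrow> inner l b \<le> inner u b"
  have le': "Re l \<le> Re u" "Im l \<le> Im u"
    using le[of 1] le[of \<i>] by (auto simp: Basis_complex_def)
  have vim: "complex_of_vec2 -` box l u = box (vec2_of_complex l) (vec2_of_complex u)"
    by (auto simp: box_def complex_of_vec2_def Basis_complex_def Basis_vec_def inner_axis forall_2)
  have B: "(Basis :: (real, 2) Finite_Cartesian_Product.vec set) = {axis 1 1, axis 2 1}"
    "axis 1 1 \<noteq> (axis 2 1 :: (real, 2) Finite_Cartesian_Product.vec)"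
    by (auto simp: Basis_vec_def UNIV_2 axis_eq_axis)
  have "emeasure (distr lborel borel complex_of_vec2) (box l u) = emeasure lborel (box (vec2_of_complex l) (vec2_of_complex u))"
    by (subst emeasure_distr) (auto simp: vim)
  also have "\<dots> = ennreal (prod (inner (vec2_of_complex u - vec2_of_complex l)) Basis)"
    using le' by (subst emeasure_lborel_box) (auto simp: B inner_axis)
  also have "prod (inner (vec2_of_complex u - vec2_of_complex l)) Basis = prod (inner (u - l)) Basis"
    by (auto simp: B inner_axis Basis_complex_def)
  finally show "emeasure (distr lborel borel complex_of_vec2) (box l u) = ennreal (prod (inner (u - l)) Basis)" .
qed simp

text \<open>Multiplication by a complex number \<open>J x\<close> is a rotation with dilation of the
  plane, so the real Jacobian determinant is |J x|^2. Finiteness of the integral supplies the real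
  value \<open>m\<close> that the real theorem works with.\<close>

lemma emeasure_holomorphic_image:
  fixes A J :: "complex \<Rightarrow> complex"
  assumes der: "\<And>x. x \<in> E \<Longrightarrow> (A has_field_derivative J x) (at x)"
    and inj: "inj_on A E" and E: "E \<in> sets borel" and J [measurable]: "J \<in> borel_measurable borel"
    and AE: "A ` E \<in> sets borel"
    and fin: "(\<integral>\<^sup>+x. indicator E x * ennreal ((cmod (J x))\<^sup>2) \<partial>lborel) < \<infinity>"
  shows "emeasure lborel (A ` E) = (\<integral>\<^sup>+x. indicator E x * ennreal ((cmod (J x))\<^sup>2) \<partial>lborel)"
proof -
  note [measurable] = E
  let ?T = complex_of_vec2 and ?V = vec2_of_complex
  define F where "F = (\<lambda>x. ?V (A (?T x)))"
  define F' where "F' = (\<lambda>x h. ?V (J (?T x) * ?T h))"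
  define S where "S = ?T -` E"
  have S [measurable]: "S \<in> sets borel" unfolding S_def using measurable_sets_borel[OF measurable_complex_of_vec2 E] by simp
  have derF: "(F has_derivative F' x) (at x within S)" if "x \<in> S" for x
  proof -
    have "(A has_derivative (*) (J (?T x))) (at (?T x))"
      using der[of "?T x"] that by (simp add: S_def has_field_derivative_def)
    moreover have "(?T has_derivative ?T) (at x)"
      by (rule bounded_linear_imp_has_derivative[OF bounded_linear_complex_of_vec2])
    ultimately have "((\<lambda>x. A (?T x)) has_derivative (\<lambda>h. J (?T x) * ?T h)) (at x)"
      using has_derivative_compose by fastforce
    from bounded_linear.has_derivative[OF bounded_linear_vec2_of_complex this]
    show ?thesis unfolding F_def F'_def by (rule has_derivative_at_withinI)
  qed
  have injF: "inj_on F S"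
    using inj unfolding F_def S_def inj_on_def
    by (metis complex_of_vec2_inverse vec2_of_complex_inverse vimageE)
  have detF: "\<bar>Determinants.det (matrix (F' x))\<bar> = (cmod (J (?T x)))\<^sup>2" for x
  proof -
    have "?T (axis 1 1) = 1" "?T (axis 2 1) = \<i>"
      by (auto simp: complex_of_vec2_def axis_def complex_eq_iff)
    thus ?thesis
      by (simp add: Determinants.det_2 matrix_def F'_def cmod_power2) (simp add: power2_eq_square)
  qed
  define m where "m = enn2real (\<integral>\<^sup>+x. indicator E x * ennreal ((cmod (J x))\<^sup>2) \<partial>lborel)"
  have m: "(\<integral>\<^sup>+x. indicator E x * ennreal ((cmod (J x))\<^sup>2) \<partial>lborel) = ennreal m"
    unfolding m_def using fin by simp
  have "(\<integral>\<^sup>+x. ennreal (indicator S x * (cmod (J (?T x)))\<^sup>2) \<partial>lborel)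
      = (\<integral>\<^sup>+x. indicator E (?T x) * ennreal ((cmod (J (?T x)))\<^sup>2) \<partial>lborel)"
    by (intro nn_integral_cong) (auto simp: S_def indicator_def)
  also have "\<dots> = (\<integral>\<^sup>+x. indicator E x * ennreal ((cmod (J x))\<^sup>2) \<partial>distr lborel borel ?T)"
    by (subst nn_integral_distr) auto
  also have "\<dots> = ennreal m" unfolding lborel_complex_of_vec2 m ..
  finally have "((\<lambda>x. indicator S x * (cmod (J (?T x)))\<^sup>2) has_integral m) UNIV"
    by (intro nn_integral_has_integral) (auto simp: m_def)
  hence "((\<lambda>x. if x \<in> S then (cmod (J (?T x)))\<^sup>2 else 0) has_integral m) UNIV"
    by (rule has_integral_eq[rotated]) (auto simp: indicator_def)
  hence hi: "((\<lambda>x. \<bar>Determinants.det (matrix (F' x))\<bar>) has_integral m) S"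
    unfolding detF by (simp add: has_integral_restrict_UNIV)
  have "F ` S \<in> lmeasurable \<and> measure lebesgue (F ` S) = m"
    using has_measure_differentiable_image[OF _ derF injF, of m] hi S by auto
  hence "emeasure lebesgue (F ` S) = ennreal m"
    by (metis emeasure_eq_measure2)
  moreover have FS: "F ` S = ?T -` (A ` E)"
    unfolding complex_of_vec2_vimage F_def S_def image_image by auto
  moreover have "?T -` (A ` E) \<in> sets borel"
    using measurable_sets_borel[OF measurable_complex_of_vec2 AE] by simp
  ultimately have "emeasure lborel (?T -` (A ` E)) = ennreal m"
    by (simp add: emeasure_completion)
  moreover have "emeasure lborel (A ` E) = emeasure lborel (?T -` (A ` E))"
    by (subst lborel_complex_of_vec2[symmetric]) (subst emeasure_distr, auto simp: AE)
  ultimately show ?thesis using m by simp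
qed

text \<open>Both sides integrate \<open>g\<close> against a measure: the image under
  \<open>A\<close> of the density |J|^2 on \<open>E\<close>, and Lebesgue measure restricted to the
  image of \<open>E\<close>. It is therefore enough to compare the two measures on Borel
  sets.\<close>

lemma nn_integral_holomorphic_inj:
  fixes A J :: "complex \<Rightarrow> complex"
  assumes B: "open B" and der: "\<And>x. x \<in> B \<Longrightarrow> (A has_field_derivative J x) (at x)"
    and inj: "inj_on A B" and E: "E \<in> sets borel" "E \<subseteq> B"
    and J [measurable]: "J \<in> borel_measurable borel" and A [measurable]: "A \<in> borel_measurable borel"
    and fin: "(\<integral>\<^sup>+x. indicator E x * ennreal ((cmod (J x))\<^sup>2) \<partial>lborel) < \<infinity>"
    and g [measurable]: "g \<in> borel_measurable borel"
  shows "A ` E \<in> sets borel"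
    and "(\<integral>\<^sup>+x. indicator E x * (g (A x) * ennreal ((cmod (J x))\<^sup>2)) \<partial>lborel) = (\<integral>\<^sup>+a. g a * indicator (A ` E) a \<partial>lborel)"
proof -
  note [measurable] = E(1)
  have hol: "A holomorphic_on B"
    using der B by (auto simp: holomorphic_on_def field_differentiable_def intro: has_field_derivative_at_within)
  \<comment> \<open>The inverse of \<open>A\<close> is holomorphic on the open image of
    \<open>B\<close>, so images of Borel sets are preimages under a continuous function and hence
    Borel.\<close>
  have im: "A ` X \<in> sets borel" if X: "X \<in> sets borel" "X \<subseteq> B" for X
  proof -
    obtain h where h: "h holomorphic_on (A ` B)" "\<And>z. z \<in> B \<Longrightarrow> h (A z) = z"
      using holomorphic_has_inverse[OF hol B inj] by metis
    have "open (A ` B)" by (rule open_mapping_thm3[OF hol B inj])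
    hence AB: "A ` B \<in> sets borel" by simp
    have "(\<lambda>x. indicator (A ` B) x *\<^sub>R h x) \<in> borel_measurable borel"
      using holomorphic_on_imp_continuous_on[OF h(1)] by (rule borel_measurable_continuous_on_indicator[OF AB])
    from measurable_sets_borel[OF this X(1)]
    have "(\<lambda>x. indicator (A ` B) x *\<^sub>R h x) -` X \<inter> A ` B \<in> sets borel" using AB by simp
    also have "(\<lambda>x. indicator (A ` B) x *\<^sub>R h x) -` X \<inter> A ` B = h -` X \<inter> (A ` B)" by auto
    finally have "h -` X \<inter> (A ` B) \<in> sets borel" .
    moreover have "h -` X \<inter> (A ` B) = A ` X" using h(2) X(2) by auto
    ultimately show ?thesis by simp
  qed
  show AE [measurable]: "A ` E \<in> sets borel" by (rule im[OF E])
  define M where "M = distr (density lborel (\<lambda>x. indicator E x * ennreal ((cmod (J x))\<^sup>2))) borel A"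
  have "M = density lborel (indicator (A ` E))"
  proof (rule measure_eqI)
    fix X assume "X \<in> sets M"
    hence X [measurable]: "X \<in> sets borel" by (simp add: M_def)
    let ?E = "E \<inter> (A -` X)"
    have E' [measurable]: "?E \<in> sets borel" using measurable_sets_borel[OF A X] by auto
    have "emeasure M X = (\<integral>\<^sup>+x. indicator E x * ennreal ((cmod (J x))\<^sup>2) * indicator (A -` X) x \<partial>lborel)"
      unfolding M_def using measurable_sets_borel[OF A X]
      by (subst emeasure_distr) (auto simp: emeasure_density)
    also have "\<dots> = (\<integral>\<^sup>+x. indicator ?E x * ennreal ((cmod (J x))\<^sup>2) \<partial>lborel)"
      by (intro nn_integral_cong) (auto simp: indicator_def)
    also have "\<dots> = emeasure lborel (A ` ?E)"
    proof (rule emeasure_holomorphic_image[symmetric])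
      show "inj_on A ?E" using inj E(2) by (auto intro: inj_on_subset)
      show "A ` ?E \<in> sets borel" using E by (intro im) auto
      have "(\<integral>\<^sup>+x. indicator ?E x * ennreal ((cmod (J x))\<^sup>2) \<partial>lborel)
          \<le> (\<integral>\<^sup>+x. indicator E x * ennreal ((cmod (J x))\<^sup>2) \<partial>lborel)"
        by (intro nn_integral_mono) (auto simp: indicator_def)
      thus "(\<integral>\<^sup>+x. indicator ?E x * ennreal ((cmod (J x))\<^sup>2) \<partial>lborel) < \<infinity>" using fin by order
    qed (use der E in auto)
    also have "A ` ?E = A ` E \<inter> X" by auto
    also have "emeasure lborel (A ` E \<inter> X) = emeasure (density lborel (indicator (A ` E))) X"
      by (subst emeasure_density) (auto simp: indicator_inter_arith[symmetric] AE)
    finally show "emeasure M X = emeasure (density lborel (indicator (A ` E))) X" .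
  qed (simp add: M_def)
  hence "(\<integral>\<^sup>+a. g a \<partial>M) = (\<integral>\<^sup>+a. g a \<partial>density lborel (indicator (A ` E)))" by simp
  thus "(\<integral>\<^sup>+x. indicator E x * (g (A x) * ennreal ((cmod (J x))\<^sup>2)) \<partial>lborel) = (\<integral>\<^sup>+a. g a * indicator (A ` E) a \<partial>lborel)"
    unfolding M_def by (subst (asm) nn_integral_distr, simp, simp)
      (subst (asm) nn_integral_density, simp, simp, subst (asm) nn_integral_density, simp, simp, simp add: mult_ac)
qed

text \<open>Critical points contribute nothing to the left side, and the rest of \<Omega> is cut
  into countably many Borel pieces on which \<open>A\<close> is injective; \<open>cnt a\<close>
  counts the noncritical preimages of \<open>a\<close>, but only its bound by \<open>N\<close> is
  exported. It is chosen before \<open>g\<close>, which later allows one count to serve every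
  functional.\<close>

theorem holomorphic_area_formula:
  fixes A J :: "complex \<Rightarrow> complex"
  assumes \<Omega>: "open \<Omega>" and der: "\<And>x. x \<in> \<Omega> \<Longrightarrow> (A has_field_derivative J x) (at x)"
    and J [measurable]: "J \<in> borel_measurable borel" and A [measurable]: "A \<in> borel_measurable borel"
    and fib: "\<And>a. finite {x \<in> \<Omega>. A x = a}" "\<And>a. card {x \<in> \<Omega>. A x = a} \<le> N"
  obtains cnt :: "complex \<Rightarrow> ennreal" where "cnt \<in> borel_measurable borel" "\<And>a. cnt a \<le> of_nat N"
    "\<And>g. g \<in> borel_measurable borel \<Longrightarrow>
      (\<integral>\<^sup>+x. indicator \<Omega> x * (g (A x) * ennreal ((cmod (J x))\<^sup>2)) \<partial>lborel) = (\<integral>\<^sup>+a. g a * cnt a \<partial>lborel)"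
proof -
  have hol: "A holomorphic_on \<Omega>"
    using der \<Omega> by (auto simp: holomorphic_on_def field_differentiable_def intro: has_field_derivative_at_within)
  have contJ: "continuous_on \<Omega> J"
    using holomorphic_on_imp_continuous_on[OF holomorphic_deriv[OF hol \<Omega>]] der
    by (subst continuous_on_cong[OF refl, of _ _ "deriv A"]) (auto dest!: DERIV_imp_deriv[OF der])
  define U where "U = {x \<in> \<Omega>. J x \<noteq> 0}"
  have nice: "\<exists>r>0. ball x r \<subseteq> U \<and> inj_on A (ball x r) \<and> (\<forall>y\<in>ball x r. cmod (J y) \<le> cmod (J x) + 1)" if x: "x \<in> U" for x
  proof -
    have "isCont J x" using contJ \<Omega> x by (auto simp: U_def continuous_on_eq_continuous_at)
    hence "eventually (\<lambda>y. dist (J y) (J x) < min 1 (cmod (J x))) (at x)"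
      using x unfolding isCont_def U_def by (intro tendstoD) auto
    then obtain r1 where r1: "r1 > 0" "\<And>y. y \<noteq> x \<Longrightarrow> dist y x < r1 \<Longrightarrow> dist (J y) (J x) < min 1 (cmod (J x))"
      unfolding eventually_at by blast
    obtain r2 where r2: "r2 > 0" "ball x r2 \<subseteq> \<Omega>" "inj_on A (ball x r2)"
      using has_complex_derivative_locally_injective[OF hol _ \<Omega>, of x] x DERIV_imp_deriv[OF der, of x]
      by (auto simp: U_def)
    have *: "J y \<noteq> 0 \<and> cmod (J y) \<le> cmod (J x) + 1" if "y \<in> ball x (min r1 r2)" for y
    proof (cases "y = x")
      case True thus ?thesis using x by (auto simp: U_def)
    next
      case False
      hence d: "dist (J y) (J x) < min 1 (cmod (J x))" using r1(2)[of y] that by (auto simp: dist_commute)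
      have "cmod (J y) \<le> cmod (J x) + dist (J y) (J x)"
        unfolding dist_norm by (metis norm_triangle_sub)
      moreover have "J y \<noteq> 0" using d by (auto simp: dist_norm)
      ultimately show ?thesis using d by auto
    qed
    show ?thesis
      using r1(1) r2 * by (intro exI[of _ "min r1 r2"]) (auto simp: U_def inj_on_def)
  qed
  \<comment> \<open>Boundedness of the sets and of \<open>J\<close> on them is included so that
    every piece satisfies the finiteness hypothesis of the injective case.\<close>
  define \<F> where "\<F> = {B. open B \<and> B \<subseteq> U \<and> inj_on A B \<and> bounded B \<and> (\<exists>K. \<forall>y\<in>B. cmod (J y) \<le> K)}"
  have \<F>op: "\<And>S. S \<in> \<F> \<Longrightarrow> open S" by (auto simp: \<F>_def)
  have \<F>U: "\<Union>\<F> = U"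
  proof
    show "U \<subseteq> \<Union>\<F>"
    proof
      fix x assume "x \<in> U"
      then obtain r where "r > 0" "ball x r \<subseteq> U" "inj_on A (ball x r)" "\<forall>y\<in>ball x r. cmod (J y) \<le> cmod (J x) + 1"
        using nice by blast
      hence "ball x r \<in> \<F>" "x \<in> ball x r" by (auto simp: \<F>_def)
      thus "x \<in> \<Union>\<F>" by blast
    qed
  qed (auto simp: \<F>_def)
  obtain \<F>' where \<F>': "\<F>' \<subseteq> \<F>" "countable \<F>'" "\<Union>\<F>' = U"
    using Lindelof[OF \<F>op] \<F>U by metis
  define B where "B = from_nat_into (insert {} \<F>')"
  have rB: "range B = insert {} \<F>'"
    unfolding B_def using \<F>'(2) by (intro range_from_nat_into) auto
  have B\<F>: "B i \<in> \<F>" for i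
    using rB \<F>'(1) by (auto simp: \<F>_def dest!: equalityD1 subsetD[of _ _ "B i"])
  have BU: "(\<Union>i. B i) = U" using rB \<F>'(3) by auto
  define E where "E = disjointed B"
  have EB: "E i \<subseteq> B i" for i unfolding E_def by (rule disjointed_subset)
  have Edis: "disjoint_family E" unfolding E_def by (rule disjoint_family_disjointed)
  have EU: "(\<Union>i. E i) = U" unfolding E_def by (simp add: UN_disjointed_eq BU)
  have E [measurable]: "E i \<in> sets borel" for i
    using B\<F> \<F>op sets.range_disjointed_sets[of B borel] unfolding E_def by (auto simp: image_subset_iff)
  have fin: "(\<integral>\<^sup>+x. indicator (E i) x * ennreal ((cmod (J x))\<^sup>2) \<partial>lborel) < \<infinity>" for i
  proof -
    obtain K where K: "\<forall>y\<in>B i. cmod (J y) \<le> K" using B\<F>[of i] by (auto simp: \<F>_def)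
    have "(\<integral>\<^sup>+x. indicator (E i) x * ennreal ((cmod (J x))\<^sup>2) \<partial>lborel) \<le> (\<integral>\<^sup>+x. ennreal (K\<^sup>2) * indicator (B i) x \<partial>lborel)"
      using K EB[of i] by (intro nn_integral_mono) (auto simp: indicator_def intro!: ennreal_leI power_mono)
    also have "\<dots> = ennreal (K\<^sup>2) * emeasure lborel (B i)"
      using \<F>op[OF B\<F>[of i]] by (subst nn_integral_cmult_indicator) auto
    also have "\<dots> < \<infinity>"
      using emeasure_bounded_finite[of "B i"] B\<F>[of i] by (auto simp: \<F>_def ennreal_mult_less_top)
    finally show ?thesis .
  qed
  have piece: "A ` E i \<in> sets borel"
    "g \<in> borel_measurable borel \<Longrightarrow> (\<integral>\<^sup>+x. indicator (E i) x * (g (A x) * ennreal ((cmod (J x))\<^sup>2)) \<partial>lborel) = (\<integral>\<^sup>+a. g a * indicator (A ` E i) a \<partial>lborel)"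
    for i g
  proof -
    have Bi: "open (B i)" "inj_on A (B i)" and der': "\<And>x. x \<in> B i \<Longrightarrow> (A has_field_derivative J x) (at x)"
      using B\<F>[of i] der by (auto simp: \<F>_def U_def)
    note * = nn_integral_holomorphic_inj[OF Bi(1) der' Bi(2) E EB J A fin]
    show "A ` E i \<in> sets borel" by (rule *(1)[of "\<lambda>_. 0"]) auto
    show "g \<in> borel_measurable borel \<Longrightarrow> (\<integral>\<^sup>+x. indicator (E i) x * (g (A x) * ennreal ((cmod (J x))\<^sup>2)) \<partial>lborel) = (\<integral>\<^sup>+a. g a * indicator (A ` E i) a \<partial>lborel)"
      by (rule *(2))
  qed
  note [measurable] = piece(1)
  define cnt where "cnt = (\<lambda>a. \<Sum>i. indicator (A ` E i) a :: ennreal)"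
  have "cnt \<in> borel_measurable borel" unfolding cnt_def by measurable
  moreover have "cnt a \<le> of_nat N" for a
    unfolding cnt_def
  proof (rule suminf_le_const)
    fix n
    define I where "I = {i. i < n \<and> a \<in> A ` E i}"
    \<comment> \<open>The pieces are disjoint, so choosing a preimage of \<open>a\<close> in each
      piece that has one is injective; this bounds every partial sum by the size of the
      fibre.\<close>
    define p where "p i = (SOME x. x \<in> E i \<and> A x = a)" for i
    have p: "p i \<in> E i \<and> A (p i) = a" if "i \<in> I" for i
      unfolding p_def by (rule someI_ex) (use that in \<open>auto simp: I_def\<close>)
    have "inj_on p I"
      using Edis p unfolding inj_on_def disjoint_family_on_def by (metis UNIV_I disjoint_iff)
    moreover have "p ` I \<subseteq> {x \<in> \<Omega>. A x = a}" using p EU by (auto simp: U_def)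
    ultimately have "card I \<le> N" using fib[of a] by (metis card_inj_on_le le_trans)
    moreover have "(\<Sum>i<n. indicator (A ` E i) a :: ennreal) = of_nat (card I)"
    proof -
      have "(\<Sum>i<n. indicator (A ` E i) a :: ennreal) = (\<Sum>i\<in>I. 1)"
        unfolding I_def by (rule sum.mono_neutral_cong_right) (auto simp: indicator_def)
      thus ?thesis by simp
    qed
    ultimately show "(\<Sum>i<n. indicator (A ` E i) a :: ennreal) \<le> of_nat N" by (simp add: of_nat_mono)
  qed auto
  moreover have "(\<integral>\<^sup>+x. indicator \<Omega> x * (g (A x) * ennreal ((cmod (J x))\<^sup>2)) \<partial>lborel) = (\<integral>\<^sup>+a. g a * cnt a \<partial>lborel)"
    if g [measurable]: "g \<in> borel_measurable borel" for g
  proof -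
    have "(\<integral>\<^sup>+x. indicator \<Omega> x * (g (A x) * ennreal ((cmod (J x))\<^sup>2)) \<partial>lborel)
        = (\<integral>\<^sup>+x. (\<Sum>i. indicator (E i) x * (g (A x) * ennreal ((cmod (J x))\<^sup>2))) \<partial>lborel)"
    proof (intro nn_integral_cong)
      fix x
      have "(\<Sum>i. indicator (E i) x * (g (A x) * ennreal ((cmod (J x))\<^sup>2)))
          = indicator U x * (g (A x) * ennreal ((cmod (J x))\<^sup>2))"
        using suminf_indicator[OF Edis, of x] by (simp add: EU)
      thus "indicator \<Omega> x * (g (A x) * ennreal ((cmod (J x))\<^sup>2)) = (\<Sum>i. indicator (E i) x * (g (A x) * ennreal ((cmod (J x))\<^sup>2)))"
        by (auto simp: U_def indicator_def)
    qed
    also have "\<dots> = (\<Sum>i. \<integral>\<^sup>+x. indicator (E i) x * (g (A x) * ennreal ((cmod (J x))\<^sup>2)) \<partial>lborel)"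
      by (rule nn_integral_suminf) measurable
    also have "\<dots> = (\<Sum>i. \<integral>\<^sup>+a. g a * indicator (A ` E i) a \<partial>lborel)"
      using piece(2)[OF g] by simp
    also have "\<dots> = (\<integral>\<^sup>+a. (\<Sum>i. g a * indicator (A ` E i) a) \<partial>lborel)"
      by (rule nn_integral_suminf[symmetric]) measurable
    finally show ?thesis unfolding cnt_def by simp
  qed
  ultimately show ?thesis by (rule that)
qed

section \<open>Determinants\<close>

lemma det_monic_coeffs:
  fixes p :: "nat \<Rightarrow> 'a :: idom poly"
  assumes "\<And>j. j < n \<Longrightarrow> degree (p j) = j" "\<And>j. j < n \<Longrightarrow> lead_coeff (p j) = 1"
  shows "Determinant.det (mat n n (\<lambda>(i,j). coeff (p j) i)) = 1"
proof -
  let ?C = "mat n n (\<lambda>(i,j). coeff (p j) i)"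
  have "upper_triangular ?C" using assms by (auto simp: upper_triangular_def intro!: coeff_eq_0)
  hence "Determinant.det ?C = prod_list (diag_mat ?C)" by (rule det_upper_triangular[where n = n]) simp
  also have "diag_mat ?C = map (\<lambda>i. 1) [0..<n]"
    using assms by (auto simp: diag_mat_def)
  finally show ?thesis by (simp add: map_replicate_const)
qed

text \<open>Passing from monomials to monic polynomials multiplies by a unitriangular matrix of
  coefficients.\<close>

lemma det_bilinear_monic:
  fixes p q :: "nat \<Rightarrow> 'a :: idom poly" and B :: "nat \<Rightarrow> nat \<Rightarrow> 'a"
  assumes p: "\<And>j. j < n \<Longrightarrow> degree (p j) = j" "\<And>j. j < n \<Longrightarrow> lead_coeff (p j) = 1"
  shows "Determinant.det (mat n n (\<lambda>(i,j). \<Sum>m<n. B i m * coeff (p j) m)) = Determinant.det (mat n n (\<lambda>(i,j). B i j))"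
proof -
  have eq: "mat n n (\<lambda>(i,j). \<Sum>m<n. B i m * coeff (p j) m) = mat n n (\<lambda>(i,j). B i j) * mat n n (\<lambda>(i,j). coeff (p j) i)"
    by (rule eq_matI) (auto simp: scalar_prod_def atLeast0LessThan)
  show ?thesis using det_monic_coeffs[where p = p and n = n, OF p] unfolding eq by (simp add: det_mult[where n = n])
qed

lemma poly_eq_sum_lessThan:
  "degree p < n \<Longrightarrow> poly p x = (\<Sum>m<n. x ^ m * coeff p m)" for p :: "'a :: comm_semiring_1 poly"
  by (subst poly_altdef, rule sum.mono_neutral_cong_left) (auto simp: coeff_eq_0 mult.commute)

text \<open>All monic families give the same determinant, so it may be evaluated on the Newton
  polynomials with nodes \<open>x i\<close>, for which the matrix is lower triangular.\<close>

lemma det_vandermonde_monic: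
  fixes p :: "nat \<Rightarrow> 'a :: idom poly"
  assumes p: "\<And>j. j < n \<Longrightarrow> degree (p j) = j" "\<And>j. j < n \<Longrightarrow> lead_coeff (p j) = 1"
  shows "Determinant.det (mat n n (\<lambda>(i,j). poly (p j) (x i))) = (\<Prod>j<n. \<Prod>i<j. x j - x i)"
proof -
  have *: "Determinant.det (mat n n (\<lambda>(i,j). poly (r j) (x i))) = Determinant.det (mat n n (\<lambda>(i,j). x i ^ j))"
    if r: "\<And>j. j < n \<Longrightarrow> degree (r j) = j" "\<And>j. j < n \<Longrightarrow> lead_coeff (r j) = 1" for r :: "nat \<Rightarrow> 'a poly"
  proof -
    have "mat n n (\<lambda>(i,j). poly (r j) (x i)) = mat n n (\<lambda>(i,j). \<Sum>m<n. x i ^ m * coeff (r j) m)"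
      using r by (intro eq_matI) (auto intro!: poly_eq_sum_lessThan)
    thus ?thesis using det_bilinear_monic[where p = r and n = n, OF r, where B = "\<lambda>i m. x i ^ m"] by simp
  qed
  define q where "q j = (\<Prod>i<j. [:- x i, 1:])" for j
  have q: "degree (q j) = j" "lead_coeff (q j) = 1" for j
  proof -
    show d: "degree (q j) = j" unfolding q_def by (subst degree_prod_eq_sum_degree) auto
    show "lead_coeff (q j) = 1" unfolding q_def by (subst lead_coeff_prod) auto
  qed
  let ?M = "mat n n (\<lambda>(i,j). poly (q j) (x i))"
  have "Determinant.det ?M = prod_list (diag_mat ?M)"
    by (rule det_lower_triangular[where n = n]) (auto simp: q_def poly_prod)
  also have "\<dots> = (\<Prod>j<n. poly (q j) (x j))"
    by (simp add: diag_mat_def prod.list_conv_set_nth atLeast0LessThan prod_list_diag_prod)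
  also have "\<dots> = (\<Prod>j<n. \<Prod>i<j. x j - x i)" by (simp add: q_def poly_prod)
  finally show ?thesis using *[of p, OF p] *[of q] q by simp
qed

text \<open>The unitriangular change of basis is applied to columns and, after transposition, to
  rows. The two families may be chosen independently of each other; this freedom later replaces one
  kind of falling factorial by another and turns the result into a Hankel determinant.\<close>

lemma det_gram_monic:
  fixes p q :: "nat \<Rightarrow> 'a :: idom poly" and L :: "'a poly \<Rightarrow> 'a"
  assumes L: "\<And>a b. L (a + b) = L a + L b" "\<And>c a. L (Polynomial.smult c a) = c * L a"
    and p: "\<And>j. j < n \<Longrightarrow> degree (p j) = j" "\<And>j. j < n \<Longrightarrow> lead_coeff (p j) = 1"
    and q: "\<And>j. j < n \<Longrightarrow> degree (q j) = j" "\<And>j. j < n \<Longrightarrow> lead_coeff (q j) = 1"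
  shows "Determinant.det (mat n n (\<lambda>(i,j). L (p i * q j))) = Determinant.det (mat n n (\<lambda>(i,j). L (monom 1 (i + j))))"
proof -
  have L0: "L 0 = 0" using L(2)[of 0 0] by simp
  have Lsum: "L (\<Sum>m\<in>A. f m) = (\<Sum>m\<in>A. L (f m))" for A :: "nat set" and f
    by (induction A rule: infinite_finite_induct) (auto simp: L L0)
  have expand: "r = (\<Sum>m<n. Polynomial.smult (coeff r m) (monom 1 m))" if "degree r < n" for r :: "'a poly"
    by (rule poly_eqI) (use that in \<open>auto simp: coeff_sum if_distrib[of "(*) _"] sum.delta cong: if_cong intro!: coeff_eq_0\<close>)
  have L_expand: "L (a * r) = (\<Sum>m<n. L (a * monom 1 m) * coeff r m)" if "degree r < n" for a r
    by (subst expand[OF that]) (simp add: sum_distrib_left Lsum L mult.commute)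
  have "Determinant.det (mat n n (\<lambda>(i,j). L (p i * q j))) = Determinant.det (mat n n (\<lambda>(i,j). \<Sum>m<n. L (p i * monom 1 m) * coeff (q j) m))"
    using q by (intro arg_cong[where f = Determinant.det] eq_matI) (auto intro!: L_expand)
  also have "\<dots> = Determinant.det (mat n n (\<lambda>(i,j). L (p i * monom 1 j)))"
    by (rule det_bilinear_monic[OF q])
  also have "\<dots> = Determinant.det (transpose_mat (mat n n (\<lambda>(i,j). L (p i * monom 1 j))))"
    by (rule det_transpose[symmetric, where n = n]) simp
  also have "transpose_mat (mat n n (\<lambda>(i,j). L (p i * monom 1 j))) = mat n n (\<lambda>(i,j). \<Sum>m<n. L (monom 1 i * monom 1 m) * coeff (p j) m)"
  proof (rule eq_matI, goal_cases)
    case (1 i j)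
    hence "L (monom 1 i * p j) = (\<Sum>m<n. L (monom 1 i * monom 1 m) * coeff (p j) m)"
      using p by (intro L_expand) auto
    thus ?case using 1 by (simp add: mult.commute[of "p j"])
  qed auto
  also have "Determinant.det \<dots> = Determinant.det (mat n n (\<lambda>(i,j). L (monom 1 i * monom 1 j)))"
    by (rule det_bilinear_monic[OF p])
  finally show ?thesis by (simp add: mult_monom)
qed

text \<open>Complete the first block column of \<open>B\<close> by an identity block. Multiplying by
  \<open>A\<close> gives a block upper triangular matrix with an identity block and the lower right
  block of \<open>A\<close> on the diagonal; now compare determinants.\<close>

lemma jacobi_complementary_minor:
  fixes A B :: "'a :: field mat"
  assumes A: "A \<in> carrier_mat (k + m) (k + m)" and B: "B \<in> carrier_mat (k + m) (k + m)"
    and AB: "A * B = 1\<^sub>m (k + m)"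
  shows "Determinant.det (mat m m (\<lambda>(i,j). A $$ (k + i, k + j))) = Determinant.det A * Determinant.det (mat k k (\<lambda>(i,j). B $$ (i,j)))"
proof -
  let ?A1 = "mat k k (\<lambda>(i,j). A $$ (i,j))" and ?A2 = "mat k m (\<lambda>(i,j). A $$ (i,k + j))"
    and ?A3 = "mat m k (\<lambda>(i,j). A $$ (k + i,j))" and ?A4 = "mat m m (\<lambda>(i,j). A $$ (k + i, k + j))"
  let ?B1 = "mat k k (\<lambda>(i,j). B $$ (i,j))" and ?B2 = "mat k m (\<lambda>(i,j). B $$ (i,k + j))"
    and ?B3 = "mat m k (\<lambda>(i,j). B $$ (k + i,j))" and ?B4 = "mat m m (\<lambda>(i,j). B $$ (k + i, k + j))"
  have A': "A = four_block_mat ?A1 ?A2 ?A3 ?A4" using A by (intro eq_matI) auto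
  have B': "B = four_block_mat ?B1 ?B2 ?B3 ?B4" using B by (intro eq_matI) auto
  have m: "four_block_mat ?A1 ?A2 ?A3 ?A4 * four_block_mat ?B1 ?B2 ?B3 ?B4 =
     four_block_mat (?A1 * ?B1 + ?A2 * ?B3) (?A1 * ?B2 + ?A2 * ?B4) (?A3 * ?B1 + ?A4 * ?B3) (?A3 * ?B2 + ?A4 * ?B4)"
    by (rule mult_four_block_mat[where ?nr1.0 = k and ?n1.0 = k and ?n2.0 = m and ?nr2.0 = m and ?nc1.0 = k and ?nc2.0 = m]) auto
  have one: "four_block_mat (?A1 * ?B1 + ?A2 * ?B3) (?A1 * ?B2 + ?A2 * ?B4) (?A3 * ?B1 + ?A4 * ?B3) (?A3 * ?B2 + ?A4 * ?B4) = 1\<^sub>m (k + m)"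
    using AB A' B' m by simp
  have e1: "?A1 * ?B1 + ?A2 * ?B3 = 1\<^sub>m k"
  proof (rule eq_matI)
    fix i j assume "i < dim_row (1\<^sub>m k)" "j < dim_col (1\<^sub>m k)"
    thus "(?A1 * ?B1 + ?A2 * ?B3) $$ (i,j) = 1\<^sub>m k $$ (i,j)"
      using arg_cong[OF one, of "\<lambda>M. M $$ (i,j)"] by (simp add: one_mat_def)
  qed auto
  have e3: "?A3 * ?B1 + ?A4 * ?B3 = 0\<^sub>m m k"
  proof (rule eq_matI)
    fix i j assume "i < dim_row (0\<^sub>m m k)" "j < dim_col (0\<^sub>m m k)"
    thus "(?A3 * ?B1 + ?A4 * ?B3) $$ (i,j) = 0\<^sub>m m k $$ (i,j)"
      using arg_cong[OF one, of "\<lambda>M. M $$ (k + i,j)"] by (simp add: one_mat_def)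
  qed auto
  have "A * four_block_mat ?B1 (0\<^sub>m k m) ?B3 (1\<^sub>m m) =
     four_block_mat (?A1 * ?B1 + ?A2 * ?B3) (?A1 * 0\<^sub>m k m + ?A2 * 1\<^sub>m m) (?A3 * ?B1 + ?A4 * ?B3) (?A3 * 0\<^sub>m k m + ?A4 * 1\<^sub>m m)"
    by (subst A', rule mult_four_block_mat[where ?nr1.0 = k and ?n1.0 = k and ?n2.0 = m and ?nr2.0 = m and ?nc1.0 = k and ?nc2.0 = m]) auto
  also have "\<dots> = four_block_mat (1\<^sub>m k) ?A2 (0\<^sub>m m k) ?A4"
    unfolding e1 e3 by (intro cong_four_block_mat) auto
  finally have "Determinant.det (A * four_block_mat ?B1 (0\<^sub>m k m) ?B3 (1\<^sub>m m)) = Determinant.det (four_block_mat (1\<^sub>m k) ?A2 (0\<^sub>m m k) ?A4)" by simp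
  moreover have "Determinant.det (A * four_block_mat ?B1 (0\<^sub>m k m) ?B3 (1\<^sub>m m)) = Determinant.det A * (Determinant.det ?B1 * Determinant.det (1\<^sub>m m :: 'a mat))"
    by (subst det_mult[OF A], force) (subst det_four_block_mat_upper_right_zero[where n = k and m = m], auto)
  moreover have "Determinant.det (four_block_mat (1\<^sub>m k) ?A2 (0\<^sub>m m k) ?A4) = Determinant.det (1\<^sub>m k :: 'a mat) * Determinant.det ?A4"
    by (rule det_four_block_mat_lower_left_zero[where n = k and m = m]) auto
  ultimately show ?thesis by simp
qed

lemma det_mat_def: "Determinant.det (mat n n f) = (\<Sum>p | p permutes {..<n}. of_int (sign p) * (\<Prod>i<n. f (i, p i)))"
proof -
  have "p i < n" if "p permutes {..<n}" "i < n" for p i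
    using permutes_in_image[OF that(1), of i] that(2) by simp
  thus ?thesis by (subst det_def') (auto simp: atLeast0LessThan intro!: sum.cong prod.cong)
qed

text \<open>After expansion over pairs of permutations every term is a product of one-variable
  integrals. For a fixed first permutation the sum over the second is the target determinant with
  permuted rows, and the two signs cancel; this happens n! times.\<close>

lemma (in sigma_finite_measure) andreief:
  fixes \<phi> \<psi> :: "nat \<Rightarrow> 'a \<Rightarrow> 'b :: {real_normed_field, banach, second_countable_topology}"
  assumes int: "\<And>i j. i < n \<Longrightarrow> j < n \<Longrightarrow> integrable M (\<lambda>x. \<phi> i x * \<psi> j x)"
  defines "F \<equiv> \<lambda>x. Determinant.det (mat n n (\<lambda>(i,j). \<phi> j (x i))) * Determinant.det (mat n n (\<lambda>(i,j). \<psi> j (x i)))"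
  shows "integrable (PiM {..<n} (\<lambda>_. M)) F"
    and "(\<integral>x. F x \<partial>PiM {..<n} (\<lambda>_. M)) = fact n * Determinant.det (mat n n (\<lambda>(i,j). \<integral>x. \<phi> i x * \<psi> j x \<partial>M))"
proof -
  interpret product_sigma_finite "\<lambda>_. M" by standard
  let ?P = "{p. p permutes {..<n}}"
  have F: "F = (\<lambda>x. \<Sum>p\<in>?P. \<Sum>q\<in>?P. of_int (sign p) * of_int (sign q) * (\<Prod>i<n. \<phi> (p i) (x i) * \<psi> (q i) (x i)))"
    unfolding F_def det_mat_def by (simp add: sum_product prod.distrib mult_ac)
  have lt: "p i < n" if "p \<in> ?P" "i < n" for p i
    using permutes_in_image[of p "{..<n}" i] that by auto
  have i1: "integrable (PiM {..<n} (\<lambda>_. M)) (\<lambda>x. \<Prod>i<n. \<phi> (p i) (x i) * \<psi> (q i) (x i))" if "p \<in> ?P" "q \<in> ?P" for p q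
    using that lt int by (intro product_integrable_prod) auto
  have e1: "(\<integral>x. (\<Prod>i<n. \<phi> (p i) (x i) * \<psi> (q i) (x i)) \<partial>PiM {..<n} (\<lambda>_. M)) = (\<Prod>i<n. \<integral>x. \<phi> (p i) x * \<psi> (q i) x \<partial>M)" if "p \<in> ?P" "q \<in> ?P" for p q
    using that lt int by (intro product_integral_prod) auto
  show "integrable (PiM {..<n} (\<lambda>_. M)) F"
    unfolding F by (intro Bochner_Integration.integrable_sum integrable_mult_right i1)
  define A where "A = mat n n (\<lambda>(i,j). \<integral>x. \<phi> i x * \<psi> j x \<partial>M)"
  have "(\<integral>x. F x \<partial>PiM {..<n} (\<lambda>_. M)) = (\<Sum>p\<in>?P. \<Sum>q\<in>?P. of_int (sign p) * of_int (sign q) * (\<Prod>i<n. \<integral>x. \<phi> (p i) x * \<psi> (q i) x \<partial>M))"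
    unfolding F
    by (subst Bochner_Integration.integral_sum, intro Bochner_Integration.integrable_sum integrable_mult_right i1, assumption+,
        rule sum.cong[OF refl], subst Bochner_Integration.integral_sum, intro integrable_mult_right i1, assumption+)
       (simp add: e1)
  also have "\<dots> = (\<Sum>p\<in>?P. Determinant.det A)"
  proof (rule sum.cong[OF refl])
    fix p assume p: "p \<in> ?P"
    have "(\<Sum>q\<in>?P. of_int (sign p) * of_int (sign q) * (\<Prod>i<n. \<integral>x. \<phi> (p i) x * \<psi> (q i) x \<partial>M))
        = of_int (sign p) * Determinant.det (mat n n (\<lambda>(i,j). A $$ (p i, j)))"
      unfolding det_mat_def sum_distrib_left
      by (intro sum.cong refl) (use lt p in \<open>auto simp: A_def mult.assoc intro!: prod.cong\<close>)
    also have "\<dots> = of_int (sign p) * (of_int (sign p) * Determinant.det A)"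
      using p by (subst det_permute_rows[where n = n]) (auto simp: A_def atLeast0LessThan)
    also have "\<dots> = Determinant.det A" by (auto simp: sign_def)
    finally show "(\<Sum>q\<in>?P. of_int (sign p) * of_int (sign q) * (\<Prod>i<n. \<integral>x. \<phi> (p i) x * \<psi> (q i) x \<partial>M)) = Determinant.det A" .
  qed
  also have "\<dots> = fact n * Determinant.det A" by (simp add: card_permutations)
  finally show "(\<integral>x. F x \<partial>PiM {..<n} (\<lambda>_. M)) = fact n * Determinant.det (mat n n (\<lambda>(i,j). \<integral>x. \<phi> i x * \<psi> j x \<partial>M))"
    unfolding A_def .
qed

section \<open>Integration over the complex plane\<close>

text \<open>A complex factor rotates boxes, so the preimage of a box is measured by the area formula
  for the linear map z / c and not by side lengths.\<close>

lemma lborel_eq_density_cmult: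
  fixes c :: complex assumes c: "c \<noteq> 0"
  shows "lborel = density (distr lborel borel (\<lambda>z. c * z)) (\<lambda>_. ennreal ((cmod c)\<^sup>2))"
proof (rule lborel_eqI)
  fix l u :: complex
  assume le: "\<And>b. b \<in> Basis \<Longrightarrow> inner l b \<le> inner u b"
  have im: "(\<lambda>z. c * z) -` box l u = (\<lambda>z. z / c) ` box l u"
    using c by (auto simp: image_iff field_simps intro!: bexI[of _ "c * _"])
  have meas: "(\<lambda>z. c * z) -` box l u \<in> sets borel"
    using measurable_sets_borel[of "\<lambda>z. c * z" borel "box l u"] by simp
  have fin: "emeasure lborel (box l u) < \<infinity>" by (rule emeasure_lborel_box_finite)
  have "emeasure lborel ((\<lambda>z. z / c) ` box l u) = (\<integral>\<^sup>+x. indicator (box l u) x * ennreal ((cmod (1 / c))\<^sup>2) \<partial>lborel)"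
  proof (rule emeasure_holomorphic_image)
    show "\<And>x. ((\<lambda>z. z / c) has_field_derivative 1 / c) (at x)"
      by (auto intro!: derivative_eq_intros simp: c)
    show "inj_on (\<lambda>z. z / c) (box l u)" using c by (auto simp: inj_on_def)
    show "(\<integral>\<^sup>+x. indicator (box l u) x * ennreal ((cmod (1 / c))\<^sup>2) \<partial>lborel) < \<infinity>"
      using fin by (subst mult.commute, subst nn_integral_cmult_indicator) (auto simp: ennreal_mult_less_top)
  qed (use meas im in auto)
  also have "\<dots> = ennreal ((cmod (1 / c))\<^sup>2) * emeasure lborel (box l u)"
    by (subst mult.commute, subst nn_integral_cmult_indicator) auto
  finally have *: "emeasure lborel ((\<lambda>z. c * z) -` box l u) = ennreal ((cmod (1 / c))\<^sup>2) * emeasure lborel (box l u)"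
    unfolding im .
  have "emeasure (density (distr lborel borel ((*) c)) (\<lambda>_. ennreal ((cmod c)\<^sup>2))) (box l u)
      = ennreal ((cmod c)\<^sup>2) * (ennreal ((cmod (1 / c))\<^sup>2) * emeasure lborel (box l u))"
    using * by (simp add: emeasure_density_const emeasure_distr)
  also have "\<dots> = emeasure lborel (box l u)"
    using c by (simp add: mult.assoc[symmetric] ennreal_mult[symmetric] norm_divide power_divide)
  also have "\<dots> = ennreal (prod (inner (u - l)) Basis)"
    using le by (subst emeasure_lborel_box) auto
  finally show "emeasure (density (distr lborel borel ((*) c)) (\<lambda>_. ennreal ((cmod c)\<^sup>2))) (box l u) = ennreal (prod (inner (u - l)) Basis)" .
qed simp

lemma nn_integral_complex_cmult:
  fixes c :: complex assumes c: "c \<noteq> 0" and f [measurable]: "f \<in> borel_measurable borel"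
  shows "(\<integral>\<^sup>+z. f z \<partial>lborel) = ennreal ((cmod c)\<^sup>2) * (\<integral>\<^sup>+z. f (c * z) \<partial>lborel)"
  by (subst lborel_eq_density_cmult[OF c])
     (simp add: nn_integral_density nn_integral_distr nn_integral_cmult)

lemma nn_integral_complex_translate:
  fixes c :: complex assumes f [measurable]: "f \<in> borel_measurable borel"
  shows "(\<integral>\<^sup>+z. f (c + z) \<partial>lborel) = (\<integral>\<^sup>+z. f z \<partial>lborel)"
  by (subst (2) lborel_distr_plus[of c, symmetric]) (simp add: nn_integral_distr)

text \<open>The disc of squared radius \<open>t\<close> has area pi t, so the squared modulus has
  constant density pi on the half-line. This is the only use of polar coordinates.\<close>

lemma distr_lborel_cmod_square:
  "distr lborel borel (\<lambda>z::complex. (cmod z)\<^sup>2) = density lborel (\<lambda>t. ennreal pi * indicator {0..} t)"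
proof (rule measure_eqI_generator_eq[where \<Omega> = UNIV and E = "range atMost" and A = "\<lambda>n. {..real n}"])
  show "Int_stable (range (atMost :: real \<Rightarrow> real set))"
    by (auto simp: Int_stable_def)
  show "(\<Union>n. {..real n}) = UNIV" by (auto simp: real_arch_simple)
  have e: "emeasure (distr lborel borel (\<lambda>z::complex. (cmod z)\<^sup>2)) {..t} = ennreal (pi * max 0 t)" for t
  proof -
    have "emeasure (distr lborel borel (\<lambda>z::complex. (cmod z)\<^sup>2)) {..t} = emeasure lborel ((\<lambda>z::complex. (cmod z)\<^sup>2) -` {..t})"
      by (subst emeasure_distr) auto
    also have "\<dots> = ennreal (pi * max 0 t)"
    proof (cases "t \<ge> 0")
      case True
      have "(\<lambda>z::complex. (cmod z)\<^sup>2) -` {..t} = cball 0 (sqrt t)"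
        using True by (auto simp: real_le_rsqrt sqrt_ge_absD dest: real_le_rsqrt)
      also have "emeasure lborel \<dots> = ennreal (pi * t)"
        using True by (subst emeasure_cball) (auto simp: unit_ball_vol_2 )
      finally show ?thesis using True by simp
    next
      case False
      hence "(\<lambda>z::complex. (cmod z)\<^sup>2) -` {..t} = {}" by (auto simp: not_le) (meson not_le order.trans zero_le_power2)
      thus ?thesis using False by simp
    qed
    finally show ?thesis .
  qed
  show "emeasure (distr lborel borel (\<lambda>z::complex. (cmod z)\<^sup>2)) {..real i} \<noteq> \<infinity>" for i
    by (simp add: e)
  fix X :: "real set" assume "X \<in> range atMost"
  then obtain t where X: "X = {..t}" by auto
  have "emeasure (density lborel (\<lambda>t. ennreal pi * indicator {0..} t)) {..t} = (\<integral>\<^sup>+x. ennreal pi * indicator {0..t} x \<partial>lborel)"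
    by (subst emeasure_density) (auto intro!: nn_integral_cong simp: indicator_def)
  also have "\<dots> = ennreal (pi * max 0 t)"
    by (subst nn_integral_cmult_indicator) (auto simp: ennreal_mult max_def emeasure_lborel_Icc_eq)
  finally show "emeasure (distr lborel borel (\<lambda>z::complex. (cmod z)\<^sup>2)) X = emeasure (density lborel (\<lambda>t. ennreal pi * indicator {0..} t)) X"
    unfolding X e ..
qed (auto simp: borel_eq_atMost intro!: sigma_sets.Basic)

lemma nn_integral_radial:
  assumes [measurable]: "f \<in> borel_measurable borel"
  shows "(\<integral>\<^sup>+z. f ((cmod z)\<^sup>2) \<partial>lborel) = ennreal pi * (\<integral>\<^sup>+t. f t * indicator {0..} t \<partial>lborel)"
proof -
  have "(\<integral>\<^sup>+z. f ((cmod z)\<^sup>2) \<partial>lborel) = (\<integral>\<^sup>+t. f t \<partial>distr lborel borel (\<lambda>z::complex. (cmod z)\<^sup>2))"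
    by (subst nn_integral_distr) auto
  also have "\<dots> = ennreal pi * (\<integral>\<^sup>+t. f t * indicator {0..} t \<partial>lborel)"
    unfolding distr_lborel_cmod_square
    by (subst nn_integral_density, simp, simp, subst nn_integral_cmult[symmetric]) (auto simp: mult_ac)
  finally show ?thesis .
qed

lemma nn_integral_Gamma:
  assumes a: "a > 0"
  shows "(\<integral>\<^sup>+t. ennreal (t powr (a - 1) * exp (-t)) * indicator {0..} t \<partial>lborel) = ennreal (Gamma a)"
proof -
  have "(\<integral>\<^sup>+t. ennreal (indicator {0..} t * (t powr (a - 1) / exp t)) \<partial>lborel) = ennreal (Gamma a)"
    by (rule nn_integral_has_integral_lebesgue[OF _ Gamma_integral_real[OF a]]) auto
  also have "(\<integral>\<^sup>+t. ennreal (indicator {0..} t * (t powr (a - 1) / exp t)) \<partial>lborel)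
      = (\<integral>\<^sup>+t. ennreal (t powr (a - 1) * exp (-t)) * indicator {0..} t \<partial>lborel)"
    by (intro nn_integral_cong) (auto simp: indicator_def exp_minus divide_inverse)
  finally show ?thesis .
qed

lemma nn_integral_cmod_powr_gauss:
  assumes s: "s \<ge> 0"
  shows "(\<integral>\<^sup>+z. ennreal (cmod z powr (2 * s) * exp (- (cmod z)\<^sup>2)) \<partial>lborel) = ennreal (pi * Gamma (s + 1))"
proof -
  have "(\<integral>\<^sup>+z. ennreal (cmod z powr (2 * s) * exp (- (cmod z)\<^sup>2)) \<partial>lborel)
     = (\<integral>\<^sup>+z. ennreal (((cmod z)\<^sup>2) powr s * exp (- ((cmod z)\<^sup>2))) \<partial>lborel)"
  proof (intro nn_integral_cong arg_cong[where f = ennreal] arg_cong2[where f = "(*)"] refl)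
    fix z :: complex
    have "((cmod z)\<^sup>2) powr s = (cmod z powr 2) powr s" by (cases "z = 0") (auto simp: powr_numeral)
    also have "\<dots> = cmod z powr (2 * s)" by (rule powr_powr)
    finally show "cmod z powr (2 * s) = ((cmod z)\<^sup>2) powr s" ..
  qed
  also have "\<dots> = ennreal pi * (\<integral>\<^sup>+t. ennreal (t powr s * exp (- t)) * indicator {0..} t \<partial>lborel)"
    by (rule nn_integral_radial) simp
  also have "\<dots> = ennreal pi * ennreal (Gamma (s + 1))"
    using nn_integral_Gamma[of "s + 1"] s by simp
  also have "\<dots> = ennreal (pi * Gamma (s + 1))"
    by (simp add: ennreal_mult')
  finally show ?thesis .
qed

section \<open>Gamma products and the Barnes function\<close>

text \<open>A discrete de l'Hospital rule against 1/n: the hypothesis compares the increments of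
  \<open>x\<close> with those of L/n, and because both sequences tend to zero the comparison may be
  summed up to infinity.\<close>

lemma LIMSEQ_scaled_of_difference:
  fixes x :: "nat \<Rightarrow> real"
  assumes x: "x \<longlonglongrightarrow> 0"
    and d: "(\<lambda>n. (x n - x (Suc n)) * (real n * real (Suc n))) \<longlonglongrightarrow> L"
  shows "(\<lambda>n. real n * x n) \<longlonglongrightarrow> L"
proof (rule LIMSEQ_I)
  fix e :: real assume e: "e > 0"
  obtain n0 where n0: "\<And>n. n \<ge> n0 \<Longrightarrow> \<bar>(x n - x (Suc n)) * (real n * real (Suc n)) - L\<bar> < e / 2"
    using LIMSEQ_D[OF d, of "e / 2"] e by auto
  have lim: "(\<lambda>n. x n - c / real n) \<longlonglongrightarrow> 0" for c
  proof -
    have "(\<lambda>n. c / real n) \<longlonglongrightarrow> 0" by (rule lim_const_over_n)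
    from tendsto_diff[OF x this] show ?thesis by simp
  qed
  have incr: "(L - e/2) / real n - (L - e/2) / real (Suc n) \<le> x n - x (Suc n) \<and>
              x n - x (Suc n) \<le> (L + e/2) / real n - (L + e/2) / real (Suc n)" if "n \<ge> Suc n0" for n
  proof -
    have n: "real n > 0" using that by simp
    have "a / real n - a / real (Suc n) = a / (real n * real (Suc n))" for a
      using n by (simp add: divide_simps) (simp add: algebra_simps)
    moreover have "\<bar>(x n - x (Suc n)) * (real n * real (Suc n)) - L\<bar> < e / 2" using n0 that by simp
    moreover have "real n * real (Suc n) > 0" using n by simp
    ultimately show ?thesis
      by (simp only: pos_divide_le_eq pos_le_divide_eq) linarith
  qed
  have upper: "x n - (L + e/2) / real n \<le> 0" if n: "n \<ge> Suc n0" for n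
  proof (rule LIMSEQ_le_const[OF lim[of "L + e/2"]])
    have "x n - (L + e/2) / real n \<le> x m - (L + e/2) / real m" if "m \<ge> n" for m
      using that
    proof (induction m rule: dec_induct)
      case (step m)
      thus ?case using \<open>n \<ge> Suc n0\<close> incr[of m] by linarith
    qed simp
    thus "\<exists>N. \<forall>m\<ge>N. x n - (L + e/2) / real n \<le> x m - (L + e/2) / real m" by blast
  qed
  have lower: "0 \<le> x n - (L - e/2) / real n" if n: "n \<ge> Suc n0" for n
  proof (rule LIMSEQ_le_const2[OF lim[of "L - e/2"]])
    have "x m - (L - e/2) / real m \<le> x n - (L - e/2) / real n" if "m \<ge> n" for m
      using that
    proof (induction m rule: dec_induct)
      case (step m)
      thus ?case using \<open>n \<ge> Suc n0\<close> incr[of m] by linarith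
    qed simp
    thus "\<exists>N. \<forall>m\<ge>N. x m - (L - e/2) / real m \<le> x n - (L - e/2) / real n" by blast
  qed
  show "\<exists>no. \<forall>n\<ge>no. norm (real n * x n - L) < e"
  proof (intro exI allI impI)
    fix n assume n: "n \<ge> Suc n0"
    have "real n > 0" using n by simp
    thus "norm (real n * x n - L) < e"
      using upper[OF n] lower[OF n] e by (auto simp: field_simps abs_less_iff)
  qed
qed

text \<open>A perturbation of n^z whose successive quotients 1 + z/(n+1) are the bases of the powers
  in the Barnes product.\<close>

definition gamma_ratio :: "real \<Rightarrow> nat \<Rightarrow> real" where
  "gamma_ratio z n = Gamma (z + real n + 1) / fact n"

lemma gamma_ratio_pos: "z > -1 \<Longrightarrow> gamma_ratio z n > 0"
  by (auto simp: gamma_ratio_def intro!: divide_pos_pos Gamma_real_pos)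

lemma gamma_ratio_Suc:
  assumes "z > -1"
  shows "gamma_ratio z (Suc n) = (1 + z / real (Suc n)) * gamma_ratio z n"
proof -
  have "z + real n + 1 > 0" using assms by (simp add: add.commute add_strict_increasing2)
  thus ?thesis
    using Gamma_plus1[of "z + real n + 1"]
    by (auto simp: gamma_ratio_def field_simps nonpos_Ints_def)
qed

lemma gamma_ratio_asymp:
  assumes z: "z > -1"
  shows "(\<lambda>n. gamma_ratio z n / real n powr z) \<longlonglongrightarrow> 1"
proof -
  have pos: "Gamma (z + 1) > 0" using z by (intro Gamma_real_pos) simp
  have "(\<lambda>n. Gamma_series' (z + 1) n) \<longlonglongrightarrow> Gamma (z + 1)"
    using Gamma_series'_LIMSEQ[of "z + 1"] by simp
  hence "(\<lambda>n. Gamma (z + 1) / Gamma_series' (z + 1) n) \<longlonglongrightarrow> Gamma (z + 1) / Gamma (z + 1)"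
    using pos by (intro tendsto_intros) auto
  hence "(\<lambda>n. Gamma (z + 1) / Gamma_series' (z + 1) n) \<longlonglongrightarrow> 1" using pos by simp
  moreover have "eventually (\<lambda>n. Gamma (z + 1) / Gamma_series' (z + 1) n = gamma_ratio z n / real n powr z) sequentially"
    using eventually_gt_at_top[of 0]
  proof eventually_elim
    case (elim n)
    have "Gamma (z + 1 + real n) = pochhammer (z + 1) n * Gamma (z + 1)"
      using less_imp_neq[OF pos] z by (subst pochhammer_Gamma) (auto simp: nonpos_Ints_def)
    moreover have "fact n = fact (n - 1) * real n" using elim by (metis fact_num_eq_if mult.commute not_gr_zero)
    ultimately show ?case using elim z
      by (simp add: Gamma_series'_def gamma_ratio_def powr_def[symmetric] field_simps powr_add flip: powr_def)
         (auto simp: powr_def exp_add field_simps)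
  qed
  ultimately show ?thesis by (rule Lim_transform_eventually)
qed

text \<open>The leading order n^z is not enough: the product of the first \<open>N\<close> ratios
  contains the N-th power of the last one, so the logarithmic error is needed to order 1/N.\<close>

lemma gamma_ratio_ln_asymp:
  assumes z: "z > -1"
  shows "(\<lambda>n. real n * (ln (gamma_ratio z n) - z * ln (real n))) \<longlonglongrightarrow> (z + z\<^sup>2) / 2"
proof (rule LIMSEQ_scaled_of_difference)
  have "(\<lambda>n. ln (gamma_ratio z n / real n powr z)) \<longlonglongrightarrow> ln 1"
    by (rule tendsto_ln[OF gamma_ratio_asymp[OF z]]) simp
  moreover have "eventually (\<lambda>n. ln (gamma_ratio z n / real n powr z) = ln (gamma_ratio z n) - z * ln (real n)) sequentially"
    using eventually_gt_at_top[of 0]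
  proof eventually_elim
    case (elim n)
    thus ?case using gamma_ratio_pos[OF z, of n] by (subst ln_div) (auto simp: ln_powr)
  qed
  ultimately show "(\<lambda>n. ln (gamma_ratio z n) - z * ln (real n)) \<longlonglongrightarrow> 0"
    using Lim_transform_eventually by fastforce
next
  have "(\<lambda>n. (z * ln (1 + 1 / real n) - ln (1 + z / (real n + 1))) * (real n * (real n + 1))) \<longlonglongrightarrow> (z + z\<^sup>2) / 2"
    by (real_asymp simp: field_simps power2_eq_square)
  moreover have "eventually (\<lambda>n. (z * ln (1 + 1 / real n) - ln (1 + z / (real n + 1))) * (real n * (real n + 1)) =
     (ln (gamma_ratio z n) - z * ln (real n) - (ln (gamma_ratio z (Suc n)) - z * ln (real (Suc n)))) * (real n * real (Suc n))) sequentially"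
    using eventually_gt_at_top[of 0]
  proof eventually_elim
    case (elim n)
    have "1 + z / real (Suc n) > 0" using z by (simp add: field_simps)
    hence e1: "ln (gamma_ratio z (Suc n)) = ln (1 + z / real (Suc n)) + ln (gamma_ratio z n)"
      using gamma_ratio_pos[OF z, of n] unfolding gamma_ratio_Suc[OF z] by (subst ln_mult) auto
    have e2: "ln (1 + 1 / real n) = ln (real (Suc n)) - ln (real n)"
      using ln_div[of "real (Suc n)" "real n"] elim by (simp add: add_divide_distrib add.commute)
    show ?case unfolding e1 e2 by (simp add: algebra_simps)
  qed
  ultimately show "(\<lambda>n. (ln (gamma_ratio z n) - z * ln (real n) - (ln (gamma_ratio z (Suc n)) - z * ln (real (Suc n)))) * (real n * real (Suc n))) \<longlonglongrightarrow> (z + z\<^sup>2) / 2"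
    by (rule Lim_transform_eventually)
qed

section \<open>Weierstrass factors of the Barnes function and products of Gamma ratios\<close>

definition barnes_ln_term :: "real \<Rightarrow> nat \<Rightarrow> real" where
  "barnes_ln_term z n = real (Suc n) * ln (1 + z / real (Suc n)) - z + z\<^sup>2 / (2 * real (Suc n))"

text \<open>The terms -z and z^2/(2(n+1)) remove the first two orders of the logarithm; what remains
  is z^3/(3 n^2) to leading order.\<close>

lemma summable_barnes_ln_term: "summable (barnes_ln_term z)"
proof (rule summable_comparison_test_bigo)
  show "summable (\<lambda>n. norm (1 / real n ^ 2))"
    using inverse_power_summable[of 2, where ?'a = real] by (simp add: field_simps)
  show "barnes_ln_term z \<in> O(\<lambda>n. 1 / real n ^ 2)"
  proof (rule bigoI_tendsto)
    have "(\<lambda>n. ((real n + 1) * ln (1 + z / (real n + 1)) - z + z\<^sup>2 / (2 * (real n + 1))) / (1 / real n ^ 2)) \<longlonglongrightarrow> z ^ 3 / 3"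
      by (real_asymp simp: field_simps power2_eq_square power3_eq_cube)
    thus "(\<lambda>n. barnes_ln_term z n / (1 / real n ^ 2)) \<longlonglongrightarrow> z ^ 3 / 3"
      by (simp add: barnes_ln_term_def add.commute)
    show "eventually (\<lambda>n. 1 / real n ^ 2 \<noteq> 0) sequentially"
      using eventually_gt_at_top[of 0] by eventually_elim auto
  qed
qed

lemma barnes_G_eq:
  assumes z: "z > -1"
  shows "barnes_G (1 + z) = (2 * pi) powr (z / 2) * exp (- (z + z\<^sup>2 * (1 + euler_mascheroni)) / 2 + (\<Sum>n. barnes_ln_term z n))"
proof -
  have "(1 + z / real (Suc n)) ^ Suc n * exp (- z + z\<^sup>2 / (2 * real (Suc n))) = exp (barnes_ln_term z n)" for n
  proof -
    have "1 + z / real (Suc n) > 0" using z by (simp add: field_simps)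
    hence "(1 + z / real (Suc n)) ^ Suc n = exp (real (Suc n) * ln (1 + z / real (Suc n)))"
      by (simp add: exp_of_nat_mult del: power_Suc of_nat_Suc)
    thus ?thesis by (simp add: barnes_ln_term_def exp_add[symmetric] del: power_Suc of_nat_Suc)
  qed
  thus ?thesis
    unfolding barnes_G_def Let_def
    by (simp add: prodinf_exp[OF summable_barnes_ln_term] exp_add del: power_Suc of_nat_Suc)
qed

text \<open>Abel summation: the sum of the logarithms is N times the last one minus the sum of (n+1)
  ln(1 + z/(n+1)), and each such summand is a Barnes term plus z - z^2/(2(n+1)). The identity is
  exact, so all asymptotics sit in the last ratio, a harmonic number and a convergent
  series.\<close>

lemma prod_gamma_ratio:
  assumes z: "z > -1"
  shows "(\<Prod>i<N. gamma_ratio z i) = exp (real N * ln (gamma_ratio z N) - (\<Sum>n<N. barnes_ln_term z n) - z * real N + z\<^sup>2 / 2 * harm N)"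
proof (induction N)
  case (Suc N)
  have p: "1 + z / real (Suc N) > 0" using z by (simp add: field_simps)
  define L where "L = ln (1 + z / (1 + real N))"
  have L: "ln (gamma_ratio z (Suc N)) = L + ln (gamma_ratio z N)"
    using p gamma_ratio_pos[OF z, of N] unfolding L_def gamma_ratio_Suc[OF z] by (subst ln_mult) auto
  have "(\<Prod>i<Suc N. gamma_ratio z i) = exp (real N * ln (gamma_ratio z N) - (\<Sum>n<N. barnes_ln_term z n) - z * real N + z\<^sup>2 / 2 * harm N) * exp (ln (gamma_ratio z N))"
    using Suc.IH gamma_ratio_pos[OF z, of N] by simp
  also have "\<dots> = exp (real (Suc N) * ln (gamma_ratio z (Suc N)) - (\<Sum>n<Suc N. barnes_ln_term z n) - z * real (Suc N) + z\<^sup>2 / 2 * harm (Suc N))"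
    unfolding exp_add[symmetric] L
    by (rule arg_cong[where f = exp])
       (simp add: barnes_ln_term_def L_def[symmetric] harm_Suc algebra_simps inverse_eq_divide add_divide_distrib)
  finally show ?case .
qed (simp add: harm_def)

text \<open>The constants left over, (z + z^2)/2 from the last ratio and z^2/2 times Euler's
  constant from the harmonic number, are those in the exponential prefactor of
  \<open>barnes_G\<close>.\<close>

lemma prod_gamma_ratio_asymp:
  assumes z: "z > -1"
  shows "(\<lambda>N. (\<Prod>i<N. gamma_ratio z i) /
     ((2 * pi) powr (z / 2) * exp (- z * real N + z * real N * ln (real N) + z\<^sup>2 / 2 * ln (real N)) / barnes_G (1 + z))) \<longlonglongrightarrow> 1"
proof -
  let ?S = "\<Sum>n. barnes_ln_term z n"
  have "(\<lambda>N. real N * (ln (gamma_ratio z N) - z * ln (real N)) - (z + z\<^sup>2) / 2 + (?S - (\<Sum>n<N. barnes_ln_term z n))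
           + z\<^sup>2 / 2 * (harm N - ln (real N) - euler_mascheroni))
         \<longlonglongrightarrow> (z + z\<^sup>2) / 2 - (z + z\<^sup>2) / 2 + (?S - ?S) + z\<^sup>2 / 2 * (euler_mascheroni - euler_mascheroni)"
    by (intro tendsto_intros gamma_ratio_ln_asymp[OF z] summable_LIMSEQ summable_barnes_ln_term euler_mascheroni_LIMSEQ)
  hence "(\<lambda>N. exp (real N * (ln (gamma_ratio z N) - z * ln (real N)) - (z + z\<^sup>2) / 2 + (?S - (\<Sum>n<N. barnes_ln_term z n))
           + z\<^sup>2 / 2 * (harm N - ln (real N) - euler_mascheroni))) \<longlonglongrightarrow> exp 0"
    by (intro tendsto_exp) simp
  also have "(\<lambda>N. exp (real N * (ln (gamma_ratio z N) - z * ln (real N)) - (z + z\<^sup>2) / 2 + (?S - (\<Sum>n<N. barnes_ln_term z n))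
           + z\<^sup>2 / 2 * (harm N - ln (real N) - euler_mascheroni))) =
    (\<lambda>N. (\<Prod>i<N. gamma_ratio z i) /
     ((2 * pi) powr (z / 2) * exp (- z * real N + z * real N * ln (real N) + z\<^sup>2 / 2 * ln (real N)) / barnes_G (1 + z)))"
  proof
    fix N
    show "exp (real N * (ln (gamma_ratio z N) - z * ln (real N)) - (z + z\<^sup>2) / 2 + (?S - (\<Sum>n<N. barnes_ln_term z n))
           + z\<^sup>2 / 2 * (harm N - ln (real N) - euler_mascheroni)) =
      (\<Prod>i<N. gamma_ratio z i) /
     ((2 * pi) powr (z / 2) * exp (- z * real N + z * real N * ln (real N) + z\<^sup>2 / 2 * ln (real N)) / barnes_G (1 + z))"
      unfolding prod_gamma_ratio[OF z] barnes_G_eq[OF z]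
      by (simp add: exp_diff[symmetric] exp_add[symmetric] divide_simps)
         (simp add: exp_diff[symmetric] exp_add[symmetric] algebra_simps add_divide_distrib diff_divide_distrib)
  qed
  finally show ?thesis by simp
qed

text \<open>Exchanges the roles of \<open>N\<close> and \<open>k\<close>: a product of only
  \<open>k\<close> quotients of factorials becomes a product over \<open>N\<close>, to which the
  Barnes asymptotics with z = k apply.\<close>

lemma prod_gamma_ratio_nat:
  "(\<Prod>i<N. gamma_ratio (real k) i) = (\<Prod>l<k. fact (N + l) / fact l)"
proof (induction k)
  case 0
  have "Gamma (real i + 1) = fact i" for i by (metis Gamma_fact add.commute)
  thus ?case by (simp add: gamma_ratio_def)
next
  case (Suc k)
  have "gamma_ratio (real (Suc k)) i = gamma_ratio (real k) i * real (k + i + 1)" for i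
  proof -
    have "Gamma (real k + real i + 1) = fact (k + i)" "Gamma (real (Suc k) + real i + 1) = fact (Suc k + i)"
      by (metis Gamma_fact add.commute of_nat_add)+
    thus ?thesis by (simp add: gamma_ratio_def)
  qed
  moreover have "(\<Prod>i<N. real (k + i + 1)) = fact (N + k) / fact k"
    by (induction N) (simp_all add: algebra_simps add_divide_distrib)
  ultimately show ?case using Suc.IH by (simp add: prod.distrib)
qed

text \<open>Two Barnes asymptotics are multiplied, with parameters \<gamma> and \<open>k\<close>;
  the second appears after writing each extra Gamma factor as a ratio times (N+l)!. The
  \<open>k\<close> ratios contribute N^(k \<gamma>), and N^(N(\<gamma>+k)) cancels against the
  scaling of the matrix.\<close>

lemma prod_Gamma_asymp:
  fixes \<gamma> :: real
  assumes \<gamma>: "\<gamma> > -1"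
  shows "(\<lambda>N. ((\<Prod>j<N. Gamma (\<gamma> + real j + 1) / fact j) * (\<Prod>l<k. Gamma (\<gamma> + real (N + l) + 1)) / (\<Prod>l<k. fact l)
             * real N powr (- (real N * (\<gamma> + real k)))) /
     (exp (- (\<gamma> + real k) * real N + (\<gamma>\<^sup>2 + (real k)\<^sup>2) / 2 * ln (real N)) * real N powr (real k * \<gamma>)
       * ((2 * pi) powr ((\<gamma> + real k) / 2) / (barnes_G (1 + real k) * barnes_G (1 + \<gamma>))))) \<longlonglongrightarrow> 1"
proof -
  let ?t = "\<lambda>z N. (2 * pi) powr (z / 2) * exp (- z * real N + z * real N * ln (real N) + z\<^sup>2 / 2 * ln (real N)) / barnes_G (1 + z)"
  have shift: "(\<lambda>N. gamma_ratio \<gamma> (N + l) / real N powr \<gamma>) \<longlonglongrightarrow> 1" for l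
  proof -
    have "(\<lambda>N. gamma_ratio \<gamma> (N + l) / real (N + l) powr \<gamma> * ((real N + real l) / real N) powr \<gamma>) \<longlonglongrightarrow> 1 * 1 powr \<gamma>"
      by (intro tendsto_intros LIMSEQ_ignore_initial_segment[OF gamma_ratio_asymp[OF \<gamma>]]) (real_asymp, simp)
    moreover have "eventually (\<lambda>N. gamma_ratio \<gamma> (N + l) / real (N + l) powr \<gamma> * ((real N + real l) / real N) powr \<gamma> = gamma_ratio \<gamma> (N + l) / real N powr \<gamma>) sequentially"
      using eventually_gt_at_top[of 0] by eventually_elim (auto simp: powr_divide field_simps)
    ultimately show ?thesis using Lim_transform_eventually by fastforce
  qed
  have "(\<lambda>N. (\<Prod>i<N. gamma_ratio \<gamma> i) / ?t \<gamma> N * ((\<Prod>i<N. gamma_ratio (real k) i) / ?t (real k) N) * (\<Prod>l<k. gamma_ratio \<gamma> (N + l) / real N powr \<gamma>))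
     \<longlonglongrightarrow> 1 * 1 * (\<Prod>l<k. 1)"
    by (intro tendsto_mult tendsto_prod shift prod_gamma_ratio_asymp \<gamma>) auto
  moreover have "eventually (\<lambda>N. (\<Prod>i<N. gamma_ratio \<gamma> i) / ?t \<gamma> N * ((\<Prod>i<N. gamma_ratio (real k) i) / ?t (real k) N) * (\<Prod>l<k. gamma_ratio \<gamma> (N + l) / real N powr \<gamma>)
    = ((\<Prod>j<N. Gamma (\<gamma> + real j + 1) / fact j) * (\<Prod>l<k. Gamma (\<gamma> + real (N + l) + 1)) / (\<Prod>l<k. fact l)
             * real N powr (- (real N * (\<gamma> + real k)))) /
     (exp (- (\<gamma> + real k) * real N + (\<gamma>\<^sup>2 + (real k)\<^sup>2) / 2 * ln (real N)) * real N powr (real k * \<gamma>)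
       * ((2 * pi) powr ((\<gamma> + real k) / 2) / (barnes_G (1 + real k) * barnes_G (1 + \<gamma>))))) sequentially"
    using eventually_gt_at_top[of 0]
  proof eventually_elim
    case (elim N)
    have a: "(\<Prod>l<k. gamma_ratio \<gamma> (N + l)) * (\<Prod>i<N. gamma_ratio (real k) i) = (\<Prod>l<k. Gamma (\<gamma> + real (N + l) + 1)) / (\<Prod>l<k. fact l)"
      unfolding prod_gamma_ratio_nat by (simp add: gamma_ratio_def prod_dividef)
    have b: "?t \<gamma> N * ?t (real k) N = exp (- (\<gamma> + real k) * real N + (\<gamma>\<^sup>2 + (real k)\<^sup>2) / 2 * ln (real N))
       * ((2 * pi) powr ((\<gamma> + real k) / 2) / (barnes_G (1 + real k) * barnes_G (1 + \<gamma>))) * real N powr (real N * (\<gamma> + real k))"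
      using elim by (simp add: powr_add add_divide_distrib exp_add[symmetric] powr_def[of "real N"] mult_ac)
         (simp add: exp_add[symmetric] algebra_simps)
    have c: "(\<Prod>l<k. gamma_ratio \<gamma> (N + l) / real N powr \<gamma>) = (\<Prod>l<k. gamma_ratio \<gamma> (N + l)) / real N powr (real k * \<gamma>)"
      using elim by (simp add: prod_dividef powr_powr[symmetric] powr_realpow mult.commute[of "real k"])
    have field_rearrange: "A * (B / C) / (X * Y * Z) / W = A * B / C * inverse Z / (X * W * Y)" for A B C X Y Z W :: real
      by (simp add: divide_inverse mult_ac)
    have d: "(\<Prod>i<N. gamma_ratio \<gamma> i) = (\<Prod>j<N. Gamma (\<gamma> + real j + 1) / fact j)"
      by (simp add: gamma_ratio_def)
    have "(\<Prod>i<N. gamma_ratio \<gamma> i) / ?t \<gamma> N * ((\<Prod>i<N. gamma_ratio (real k) i) / ?t (real k) N) * (\<Prod>l<k. gamma_ratio \<gamma> (N + l) / real N powr \<gamma>)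
      = (\<Prod>i<N. gamma_ratio \<gamma> i) * ((\<Prod>l<k. gamma_ratio \<gamma> (N + l)) * (\<Prod>i<N. gamma_ratio (real k) i)) / (?t \<gamma> N * ?t (real k) N) / real N powr (real k * \<gamma>)"
      unfolding c by simp
    also have "\<dots> = ((\<Prod>j<N. Gamma (\<gamma> + real j + 1) / fact j) * (\<Prod>l<k. Gamma (\<gamma> + real (N + l) + 1)) / (\<Prod>l<k. fact l)
             * real N powr (- (real N * (\<gamma> + real k)))) /
     (exp (- (\<gamma> + real k) * real N + (\<gamma>\<^sup>2 + (real k)\<^sup>2) / 2 * ln (real N)) * real N powr (real k * \<gamma>)
       * ((2 * pi) powr ((\<gamma> + real k) / 2) / (barnes_G (1 + real k) * barnes_G (1 + \<gamma>))))"
      unfolding a b d powr_minus by (rule field_rearrange)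
    finally show ?case .
  qed
  ultimately show ?thesis using Lim_transform_eventually by fastforce
qed

section \<open>Linear changes of complex variables\<close>

abbreviation cvec :: "'i set \<Rightarrow> ('i \<Rightarrow> complex) measure" where
  "cvec I \<equiv> PiM I (\<lambda>_. lborel)"

interpretation clborel: product_sigma_finite "\<lambda>_. lborel :: complex measure" by standard

lemma nn_integral_cvec_insert:
  assumes "finite I" "i \<notin> I" "f \<in> borel_measurable (cvec (insert i I))"
  shows "(\<integral>\<^sup>+x. f x \<partial>cvec (insert i I)) = (\<integral>\<^sup>+x. (\<integral>\<^sup>+v. f (x(i := v)) \<partial>lborel) \<partial>cvec I)"
  by (rule clborel.product_nn_integral_insert[OF assms])

lemma nn_integral_cvec_translate:
  assumes "finite I" "f \<in> borel_measurable (cvec I)"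
  shows "(\<integral>\<^sup>+x. f (\<lambda>i\<in>I. c i + x i) \<partial>cvec I) = (\<integral>\<^sup>+x. f x \<partial>cvec I)"
  using assms
proof (induction I arbitrary: f rule: finite_induct)
  case empty
  thus ?case by (auto simp: PiM_empty nn_integral_count_space_finite restrict_def)
next
  case (insert i I)
  note [measurable] = insert.prems
  have m1 [measurable]: "(\<lambda>x. \<lambda>j\<in>insert i I. c j + x j) \<in> cvec (insert i I) \<rightarrow>\<^sub>M cvec (insert i I)" by measurable
  have m2: "(\<lambda>(x, v). x(i := v)) \<in> cvec I \<Otimes>\<^sub>M lborel \<rightarrow>\<^sub>M cvec (insert i I)"
    by (rule measurable_add_dim)
  have m4 [measurable]: "(\<lambda>(x, v). f (x(i := v))) \<in> borel_measurable (cvec I \<Otimes>\<^sub>M lborel)"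
    using measurable_compose[OF m2 insert.prems] by (simp add: case_prod_beta')
  have m5: "(\<lambda>v. f (x(i := v))) \<in> borel_measurable borel" if "x \<in> space (cvec I)" for x
    using measurable_compose[OF measurable_Pair1'[OF that, of lborel] m4] by simp
  have "(\<integral>\<^sup>+x. f (\<lambda>j\<in>insert i I. c j + x j) \<partial>cvec (insert i I))
      = (\<integral>\<^sup>+x. (\<integral>\<^sup>+v. f (\<lambda>j\<in>insert i I. c j + (x(i := v)) j) \<partial>lborel) \<partial>cvec I)"
    by (rule nn_integral_cvec_insert[OF insert.hyps]) measurable
  also have "\<dots> = (\<integral>\<^sup>+x. (\<integral>\<^sup>+v. f ((\<lambda>j\<in>I. c j + x j)(i := c i + v)) \<partial>lborel) \<partial>cvec I)"
    using insert.hyps by (intro nn_integral_cong arg_cong[where f = f]) (auto simp: fun_eq_iff restrict_def)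
  also have "\<dots> = (\<integral>\<^sup>+x. (\<integral>\<^sup>+v. f ((\<lambda>j\<in>I. c j + x j)(i := v)) \<partial>lborel) \<partial>cvec I)"
    by (intro nn_integral_cong nn_integral_complex_translate m5) (auto simp: space_PiM)
  also have "\<dots> = (\<integral>\<^sup>+x. (\<integral>\<^sup>+v. f (x(i := v)) \<partial>lborel) \<partial>cvec I)"
    by (rule insert.IH[of "\<lambda>x. (\<integral>\<^sup>+v. f (x(i := v)) \<partial>lborel)"]) measurable
  also have "\<dots> = (\<integral>\<^sup>+x. f x \<partial>cvec (insert i I))"
    by (rule nn_integral_cvec_insert[OF insert.hyps insert.prems, symmetric])
  finally show ?case .
qed

lemma nn_integral_cvec_reindex:
  assumes \<pi>: "bij_betw \<pi> I J" and J: "finite J" and f: "f \<in> borel_measurable (cvec I)"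
  shows "(\<integral>\<^sup>+x. f (\<lambda>i\<in>I. x (\<pi> i)) \<partial>cvec J) = (\<integral>\<^sup>+x. f x \<partial>cvec I)"
proof -
  have I: "finite I" using \<pi> J bij_betw_finite by blast
  have inj: "inj_on \<pi> I" and img: "\<pi> ` I = J" using \<pi> by (auto simp: bij_betw_def)
  have meas: "(\<lambda>x. \<lambda>i\<in>I. x (\<pi> i)) \<in> cvec J \<rightarrow>\<^sub>M cvec I"
    using img by (intro measurable_restrict measurable_component_singleton) auto
  have "distr (cvec J) (cvec I) (\<lambda>x. \<lambda>i\<in>I. x (\<pi> i)) = cvec I"
  proof (rule clborel.PiM_eqI[OF I])
    fix A :: "'a \<Rightarrow> complex set" assume A: "\<And>i. i \<in> I \<Longrightarrow> A i \<in> sets lborel"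
    define B where "B j = A (the_inv_into I \<pi> j)" for j
    have B: "B (\<pi> i) = A i" if "i \<in> I" for i using that inj by (simp add: B_def the_inv_into_f_f)
    have Bm: "B j \<in> sets lborel" if "j \<in> J" for j using that A B img by (metis imageE)
    have "(\<lambda>x. \<lambda>i\<in>I. x (\<pi> i)) -` (Pi\<^sub>E I A) \<inter> space (cvec J) = Pi\<^sub>E J B"
      using B img by (auto simp: PiE_iff space_PiM)
    hence "emeasure (distr (cvec J) (cvec I) (\<lambda>x. \<lambda>i\<in>I. x (\<pi> i))) (Pi\<^sub>E I A) = emeasure (cvec J) (Pi\<^sub>E J B)"
      using A I by (subst emeasure_distr[OF meas]) (auto intro!: sets_PiM_I_finite)
    also have "\<dots> = (\<Prod>j\<in>J. emeasure lborel (B j))"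
      using Bm J by (intro clborel.emeasure_PiM) auto
    also have "\<dots> = (\<Prod>i\<in>I. emeasure lborel (A i))"
      unfolding img[symmetric] using inj B by (subst prod.reindex) auto
    finally show "emeasure (distr (cvec J) (cvec I) (\<lambda>x. \<lambda>i\<in>I. x (\<pi> i))) (Pi\<^sub>E I A) = (\<Prod>i\<in>I. emeasure lborel (A i))" .
  qed simp
  hence "(\<integral>\<^sup>+x. f x \<partial>cvec I) = (\<integral>\<^sup>+x. f x \<partial>distr (cvec J) (cvec I) (\<lambda>x. \<lambda>i\<in>I. x (\<pi> i)))" by simp
  also have "\<dots> = (\<integral>\<^sup>+x. f (\<lambda>i\<in>I. x (\<pi> i)) \<partial>cvec J)"
    using meas f by (intro nn_integral_distr) auto
  finally show ?thesis ..
qed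

section \<open>Complex linear maps and the squared modulus of their determinants\<close>

definition mat_apply :: "nat \<Rightarrow> complex mat \<Rightarrow> (nat \<Rightarrow> complex) \<Rightarrow> nat \<Rightarrow> complex" where
  "mat_apply n A x = (\<lambda>i\<in>{..<n}. \<Sum>j<n. A $$ (i,j) * x j)"

lemma measurable_mat_apply [measurable]: "mat_apply n A \<in> cvec {..<n} \<rightarrow>\<^sub>M cvec {..<n}"
  unfolding mat_apply_def by measurable

lemma nn_integral_cvec_Suc:
  assumes [measurable]: "f \<in> borel_measurable (cvec {..<Suc n})"
  shows "(\<integral>\<^sup>+x. f x \<partial>cvec {..<Suc n}) = (\<integral>\<^sup>+x. (\<integral>\<^sup>+v. f (x(n := v)) \<partial>lborel) \<partial>cvec {..<n})"
    and "(\<integral>\<^sup>+x. f x \<partial>cvec {..<Suc n}) = (\<integral>\<^sup>+v. (\<integral>\<^sup>+x. f (x(n := v)) \<partial>cvec {..<n}) \<partial>lborel)"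
    and "(\<lambda>(x, v). f (x(n := v))) \<in> borel_measurable (cvec {..<n} \<Otimes>\<^sub>M lborel)"
    and "(\<lambda>x. f (x(n := v))) \<in> borel_measurable (cvec {..<n})"
    and "y \<in> space (cvec {..<n}) \<Longrightarrow> (\<lambda>v. f (y(n := v))) \<in> borel_measurable borel"
proof -
  interpret F: sigma_finite_measure "cvec {..<n}" by (rule clborel.sigma_finite) simp
  interpret P: pair_sigma_finite "cvec {..<n}" "lborel :: complex measure" by standard
  have m2: "(\<lambda>(x, v). x(n := v)) \<in> cvec {..<n} \<Otimes>\<^sub>M lborel \<rightarrow>\<^sub>M cvec {..<Suc n}"
    using measurable_add_dim[of n "{..<n}" "\<lambda>_. lborel"] by (simp add: lessThan_Suc)
  show m4: "(\<lambda>(x, v). f (x(n := v))) \<in> borel_measurable (cvec {..<n} \<Otimes>\<^sub>M lborel)"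
    using measurable_compose[OF m2 assms] by (simp add: case_prod_beta')
  show "(\<lambda>x. f (x(n := v))) \<in> borel_measurable (cvec {..<n})"
    using measurable_compose[OF measurable_Pair2'[of v lborel] m4] by simp
  show "y \<in> space (cvec {..<n}) \<Longrightarrow> (\<lambda>v. f (y(n := v))) \<in> borel_measurable borel"
    using measurable_compose[OF measurable_Pair1'[of y _ lborel] m4] by simp
  show 1: "(\<integral>\<^sup>+x. f x \<partial>cvec {..<Suc n}) = (\<integral>\<^sup>+x. (\<integral>\<^sup>+v. f (x(n := v)) \<partial>lborel) \<partial>cvec {..<n})"
    using nn_integral_cvec_insert[of "{..<n}" n f] assms unfolding lessThan_Suc by simp
  show "(\<integral>\<^sup>+x. f x \<partial>cvec {..<Suc n}) = (\<integral>\<^sup>+v. (\<integral>\<^sup>+x. f (x(n := v)) \<partial>cvec {..<n}) \<partial>lborel)"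
    unfolding 1 using P.Fubini'[of "\<lambda>x v. f (x(n := v))"] m4 by simp
qed

lemma det_corner_pivot:
  assumes A: "A \<in> carrier_mat (Suc n) (Suc n)" and a: "A $$ (n,n) \<noteq> (0::complex)"
  shows "Determinant.det A = A $$ (n,n) * Determinant.det (mat n n (\<lambda>(i,j). A $$ (i,j) - A $$ (i,n) * A $$ (n,j) / A $$ (n,n)))"
proof -
  let ?S = "mat n n (\<lambda>(i,j). A $$ (i,j) - A $$ (i,n) * A $$ (n,j) / A $$ (n,n))"
  let ?c = "mat n 1 (\<lambda>(i,j). A $$ (i,n))" and ?b = "mat 1 n (\<lambda>(i,j). A $$ (n,j) / A $$ (n,n))"
    and ?a = "mat 1 1 (\<lambda>(i,j). A $$ (n,n))"
  have "A = four_block_mat ?S ?c (0\<^sub>m 1 n) ?a * four_block_mat (1\<^sub>m n) (0\<^sub>m n 1) ?b (1\<^sub>m 1)"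
  proof (subst mult_four_block_mat[where ?nr1.0 = n and ?n1.0 = n and ?n2.0 = 1 and ?nr2.0 = 1 and ?nc1.0 = n and ?nc2.0 = 1])
    show "A = four_block_mat (?S * 1\<^sub>m n + ?c * ?b) (?S * 0\<^sub>m n 1 + ?c * 1\<^sub>m 1) (0\<^sub>m 1 n * 1\<^sub>m n + ?a * ?b) (0\<^sub>m 1 n * 0\<^sub>m n 1 + ?a * 1\<^sub>m 1)"
      using A a by (intro eq_matI) (auto simp: scalar_prod_def less_Suc_eq)
  qed auto
  hence "Determinant.det A = Determinant.det (four_block_mat ?S ?c (0\<^sub>m 1 n) ?a) * Determinant.det (four_block_mat (1\<^sub>m n) (0\<^sub>m n 1) ?b (1\<^sub>m 1))"
    by (metis (no_types, lifting) det_mult four_block_carrier_mat mat_carrier one_carrier_mat)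
  also have "Determinant.det (four_block_mat ?S ?c (0\<^sub>m 1 n) ?a) = Determinant.det ?S * Determinant.det ?a"
    by (rule det_four_block_mat_lower_left_zero[where n = n and m = 1]) auto
  also have "Determinant.det ?a = A $$ (n,n)" by (subst det_single) auto
  also have "Determinant.det (four_block_mat (1\<^sub>m n) (0\<^sub>m n 1) ?b (1\<^sub>m 1)) = (1 :: complex)"
    by (subst det_four_block_mat_upper_right_zero[where n = n and m = 1]) auto
  finally show ?thesis by simp
qed

text \<open>The last output \<open>w\<close> replaces the last input, with factor |a|^2. For fixed
  \<open>w\<close> the remaining outputs are a translate of the Schur complement \<open>S\<close>
  applied to the remaining inputs, where the induction hypothesis takes over; finally det A = a det
  S.\<close>

lemma nn_integral_mat_apply_pivot:
  assumes IH: "\<And>A f. A \<in> carrier_mat n n \<Longrightarrow> Determinant.det A \<noteq> 0 \<Longrightarrow> f \<in> borel_measurable (cvec {..<n}) \<Longrightarrow>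
      (\<integral>\<^sup>+x. f x \<partial>cvec {..<n}) = ennreal ((cmod (Determinant.det A))\<^sup>2) * (\<integral>\<^sup>+x. f (mat_apply n A x) \<partial>cvec {..<n})"
    and A: "A \<in> carrier_mat (Suc n) (Suc n)" and det: "Determinant.det A \<noteq> 0" and a: "A $$ (n,n) \<noteq> (0::complex)"
    and f [measurable]: "f \<in> borel_measurable (cvec {..<Suc n})"
  shows "(\<integral>\<^sup>+x. f x \<partial>cvec {..<Suc n}) = ennreal ((cmod (Determinant.det A))\<^sup>2) * (\<integral>\<^sup>+x. f (mat_apply (Suc n) A x) \<partial>cvec {..<Suc n})"
proof -
  interpret F: sigma_finite_measure "cvec {..<n}" by (rule clborel.sigma_finite) simp
  interpret P: pair_sigma_finite "cvec {..<n}" "lborel :: complex measure" by standard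
  define a where "a = A $$ (n,n)"
  define S where "S = mat n n (\<lambda>(i,j). A $$ (i,j) - A $$ (i,n) * A $$ (n,j) / A $$ (n,n))"
  have detA: "Determinant.det A = a * Determinant.det S"
    unfolding a_def S_def by (rule det_corner_pivot[OF A assms(4)])
  hence detS: "Determinant.det S \<noteq> 0" and a0: "a \<noteq> 0" using det by auto
  define b where "b x = (\<Sum>j<n. A $$ (n,j) * x j)" for x :: "nat \<Rightarrow> complex"
  define sh where "sh x w = (\<lambda>i\<in>{..<n}. A $$ (i,n) / a * w + x i)" for x :: "nat \<Rightarrow> complex" and w
  note mf = nn_integral_cvec_Suc(3)[OF f]
  have b_meas [measurable]: "b \<in> borel_measurable (cvec {..<n})" unfolding b_def by measurable
  have sh_meas: "(\<lambda>(x, w). sh x w) \<in> cvec {..<n} \<Otimes>\<^sub>M lborel \<rightarrow>\<^sub>M cvec {..<n}"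
    unfolding sh_def by measurable
  have g_meas [measurable]: "(\<lambda>(x, w). f ((sh (mat_apply n S x) w)(n := w))) \<in> borel_measurable (cvec {..<n} \<Otimes>\<^sub>M lborel)"
  proof -
    have "(\<lambda>p. mat_apply n S (fst p)) \<in> cvec {..<n} \<Otimes>\<^sub>M (lborel :: complex measure) \<rightarrow>\<^sub>M cvec {..<n}"
      by (rule measurable_compose[OF measurable_fst measurable_mat_apply])
    from measurable_compose[OF measurable_Pair[OF this measurable_snd] sh_meas]
    have "(\<lambda>p. sh (mat_apply n S (fst p)) (snd p)) \<in> cvec {..<n} \<Otimes>\<^sub>M lborel \<rightarrow>\<^sub>M cvec {..<n}" by simp
    from measurable_Pair[OF this measurable_snd]
    have "(\<lambda>p. (sh (mat_apply n S (fst p)) (snd p), snd p)) \<in> cvec {..<n} \<Otimes>\<^sub>M lborel \<rightarrow>\<^sub>M cvec {..<n} \<Otimes>\<^sub>M (lborel :: complex measure)" .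
    from measurable_compose[OF this mf] show ?thesis by (simp add: case_prod_beta')
  qed
  have eq: "mat_apply (Suc n) A (x(n := v)) = (sh (mat_apply n S x) (b x + a * v))(n := b x + a * v)" if "x \<in> space (cvec {..<n})" for x v
  proof
    fix i
    show "mat_apply (Suc n) A (x(n := v)) i = ((sh (mat_apply n S x) (b x + a * v))(n := b x + a * v)) i"
    proof (cases "i < n")
      case True
      have "(\<Sum>j<n. S $$ (i,j) * x j) = (\<Sum>j<n. A $$ (i,j) * x j) - A $$ (i,n) / a * b x"
        using True by (simp add: S_def b_def a_def sum_distrib_left sum_subtractf[symmetric] algebra_simps)
      thus ?thesis using True a0 by (simp add: mat_apply_def sh_def algebra_simps add_divide_distrib)
    qed (auto simp: mat_apply_def sh_def b_def a_def)
  qed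
  have "(\<integral>\<^sup>+x. f (mat_apply (Suc n) A x) \<partial>cvec {..<Suc n}) = (\<integral>\<^sup>+x. (\<integral>\<^sup>+v. f (mat_apply (Suc n) A (x(n := v))) \<partial>lborel) \<partial>cvec {..<n})"
    by (rule nn_integral_cvec_Suc(1)) measurable
  also have "\<dots> = (\<integral>\<^sup>+x. (\<integral>\<^sup>+v. f ((sh (mat_apply n S x) (b x + a * v))(n := b x + a * v)) \<partial>lborel) \<partial>cvec {..<n})"
    by (intro nn_integral_cong) (simp add: eq)
  also have "ennreal ((cmod a)\<^sup>2) * \<dots> = (\<integral>\<^sup>+x. (\<integral>\<^sup>+w. f ((sh (mat_apply n S x) w)(n := w)) \<partial>lborel) \<partial>cvec {..<n})"
  proof (subst nn_integral_cmult[symmetric])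
    show "(\<lambda>x. \<integral>\<^sup>+v. f ((sh (mat_apply n S x) (b x + a * v))(n := b x + a * v)) \<partial>lborel) \<in> borel_measurable (cvec {..<n})"
    proof -
      have "(\<lambda>p. (fst p, b (fst p) + a * snd p)) \<in> cvec {..<n} \<Otimes>\<^sub>M lborel \<rightarrow>\<^sub>M cvec {..<n} \<Otimes>\<^sub>M (lborel :: complex measure)"
        by measurable
      from measurable_compose[OF this g_meas] show ?thesis
        by (intro lborel.borel_measurable_nn_integral) (simp add: case_prod_beta')
    qed
    show "(\<integral>\<^sup>+x. ennreal ((cmod a)\<^sup>2) * (\<integral>\<^sup>+v. f ((sh (mat_apply n S x) (b x + a * v))(n := b x + a * v)) \<partial>lborel) \<partial>cvec {..<n})
        = (\<integral>\<^sup>+x. (\<integral>\<^sup>+w. f ((sh (mat_apply n S x) w)(n := w)) \<partial>lborel) \<partial>cvec {..<n})"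
    proof (rule nn_integral_cong)
      fix x assume x: "x \<in> space (cvec {..<n})"
      let ?g = "\<lambda>w. f ((sh (mat_apply n S x) w)(n := w))"
      have [measurable]: "?g \<in> borel_measurable borel"
        using measurable_compose[OF measurable_Pair1'[OF x, of lborel] g_meas] by simp
      have "(\<integral>\<^sup>+w. ?g w \<partial>lborel) = (\<integral>\<^sup>+w. ?g (b x + w) \<partial>lborel)"
        by (rule nn_integral_complex_translate[symmetric]) measurable
      also have "\<dots> = ennreal ((cmod a)\<^sup>2) * (\<integral>\<^sup>+v. ?g (b x + a * v) \<partial>lborel)"
        by (rule nn_integral_complex_cmult[OF a0]) measurable
      finally show "ennreal ((cmod a)\<^sup>2) * (\<integral>\<^sup>+v. ?g (b x + a * v) \<partial>lborel) = (\<integral>\<^sup>+w. ?g w \<partial>lborel)" ..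
    qed
  qed
  also have "\<dots> = (\<integral>\<^sup>+w. (\<integral>\<^sup>+x. f ((sh (mat_apply n S x) w)(n := w)) \<partial>cvec {..<n}) \<partial>lborel)"
    by (rule P.Fubini'[symmetric]) measurable
  also have "ennreal ((cmod (Determinant.det S))\<^sup>2) * \<dots> = (\<integral>\<^sup>+w. (\<integral>\<^sup>+x. f (x(n := w)) \<partial>cvec {..<n}) \<partial>lborel)"
  proof (subst nn_integral_cmult[symmetric])
    show "(\<lambda>w. \<integral>\<^sup>+x. f ((sh (mat_apply n S x) w)(n := w)) \<partial>cvec {..<n}) \<in> borel_measurable lborel"
      by measurable
    show "(\<integral>\<^sup>+w. ennreal ((cmod (Determinant.det S))\<^sup>2) * (\<integral>\<^sup>+x. f ((sh (mat_apply n S x) w)(n := w)) \<partial>cvec {..<n}) \<partial>lborel)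
        = (\<integral>\<^sup>+w. (\<integral>\<^sup>+x. f (x(n := w)) \<partial>cvec {..<n}) \<partial>lborel)"
    proof (rule nn_integral_cong)
      fix w :: complex
      have m1: "(\<lambda>x. f (x(n := w))) \<in> borel_measurable (cvec {..<n})" by (rule nn_integral_cvec_Suc(4)[OF f])
      have m2: "(\<lambda>x. sh x w) \<in> cvec {..<n} \<rightarrow>\<^sub>M cvec {..<n}" unfolding sh_def by measurable
      have "(\<integral>\<^sup>+x. f (x(n := w)) \<partial>cvec {..<n}) = (\<integral>\<^sup>+x. f ((sh x w)(n := w)) \<partial>cvec {..<n})"
        unfolding sh_def by (rule nn_integral_cvec_translate[symmetric, OF _ m1]) simp
      also have "\<dots> = ennreal ((cmod (Determinant.det S))\<^sup>2) * (\<integral>\<^sup>+x. f ((sh (mat_apply n S x) w)(n := w)) \<partial>cvec {..<n})"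
        using measurable_compose[OF m2 m1] by (intro IH[OF _ detS]) (auto simp: S_def)
      finally show "ennreal ((cmod (Determinant.det S))\<^sup>2) * (\<integral>\<^sup>+x. f ((sh (mat_apply n S x) w)(n := w)) \<partial>cvec {..<n}) = (\<integral>\<^sup>+x. f (x(n := w)) \<partial>cvec {..<n})" ..
    qed
  qed
  also have "\<dots> = (\<integral>\<^sup>+x. f x \<partial>cvec {..<Suc n})" by (rule nn_integral_cvec_Suc(2)[OF f, symmetric])
  finally show ?thesis
    by (simp add: detA norm_mult power_mult_distrib ennreal_mult mult_ac)
qed

lemma nn_integral_mat_apply:
  assumes "A \<in> carrier_mat n n" "Determinant.det A \<noteq> 0" "f \<in> borel_measurable (cvec {..<n})"
  shows "(\<integral>\<^sup>+x. f x \<partial>cvec {..<n}) = ennreal ((cmod (Determinant.det A))\<^sup>2) * (\<integral>\<^sup>+x. f (mat_apply n A x) \<partial>cvec {..<n})"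
  using assms
proof (induction n arbitrary: A f)
  case 0
  thus ?case by (simp add: PiM_empty mat_apply_def nn_integral_count_space_finite restrict_def)
next
  case (Suc n)
  note A = Suc.prems(1) and f = Suc.prems(3)
  show ?case
  proof (cases "A $$ (n,n) = 0")
    case False
    show ?thesis by (rule nn_integral_mat_apply_pivot[OF Suc.IH A Suc.prems(2) False f])
  next
    case True
    \<comment> \<open>An invertible matrix has a nonzero entry in its last row. Swapping that column
      into the last place permutes coordinates and changes only the sign of the determinant.\<close>
    obtain m where m: "m < Suc n" "A $$ (n,m) \<noteq> 0"
    proof (rule ccontr)
      assume "\<not> thesis"
      hence "A $$ (n,j) = 0" if "j < Suc n" for j using that \<open>\<And>m. m < Suc n \<Longrightarrow> A $$ (n, m) \<noteq> 0 \<Longrightarrow> thesis\<close> by blast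
      hence "row A n = 0\<^sub>v (Suc n)" using A by (intro eq_vecI) auto
      hence "Determinant.det A = 0" using laplace_expansion_row[OF A, of n] \<open>\<And>j. j < Suc n \<Longrightarrow> A $$ (n,j) = 0\<close> by simp
      thus False using Suc.prems(2) by simp
    qed
    have mn: "m \<noteq> n" using m True by auto
    let ?\<pi> = "Transposition.transpose m n"
    let ?A = "swapcols m n A"
    have A': "?A \<in> carrier_mat (Suc n) (Suc n)" using A by simp
    have detA': "Determinant.det ?A = - Determinant.det A" by (rule det_swapcols[OF m(1) _ mn A]) simp
    have \<pi>: "bij_betw ?\<pi> {..<Suc n} {..<Suc n}"
      using m by (intro bij_betw_byWitness[where f' = ?\<pi>]) (auto simp: Transposition.transpose_def)
    have eq: "mat_apply (Suc n) A (\<lambda>i\<in>{..<Suc n}. x (?\<pi> i)) = mat_apply (Suc n) ?A x" for x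
    proof -
      have "(\<Sum>j<Suc n. A $$ (i,j) * x (?\<pi> j)) = (\<Sum>j<Suc n. ?A $$ (i,j) * x j)" if "i < Suc n" for i
      proof -
        have "(\<Sum>j<Suc n. ?A $$ (i,j) * x j) = (\<Sum>j<Suc n. ?A $$ (i,?\<pi> j) * x (?\<pi> j))"
          using sum.reindex_bij_betw[OF \<pi>, of "\<lambda>j. ?A $$ (i,j) * x j"] by simp
        also have "\<dots> = (\<Sum>j<Suc n. A $$ (i,j) * x (?\<pi> j))"
          using A m that mn by (intro sum.cong refl) (auto simp: Transposition.transpose_def)
        finally show ?thesis ..
      qed
      thus ?thesis by (auto simp: mat_apply_def fun_eq_iff restrict_def)
    qed
    have "(\<integral>\<^sup>+x. f x \<partial>cvec {..<Suc n}) = ennreal ((cmod (Determinant.det ?A))\<^sup>2) * (\<integral>\<^sup>+x. f (mat_apply (Suc n) ?A x) \<partial>cvec {..<Suc n})"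
      using m A Suc.prems(2) detA' by (intro nn_integral_mat_apply_pivot[OF Suc.IH A' _ _ f]) auto
    also have "(\<integral>\<^sup>+x. f (mat_apply (Suc n) ?A x) \<partial>cvec {..<Suc n}) = (\<integral>\<^sup>+x. f (mat_apply (Suc n) A x) \<partial>cvec {..<Suc n})"
      using nn_integral_cvec_reindex[OF \<pi>, of "\<lambda>x. f (mat_apply (Suc n) A x)"] measurable_compose[OF measurable_mat_apply f, of A]
      by (simp add: eq)
    finally show ?thesis by (simp add: detA')
  qed
qed

lemma nn_integral_cvec_Un:
  assumes "finite I" "finite J" "I \<inter> J = {}" "f \<in> borel_measurable (cvec (I \<union> J))"
  shows "(\<integral>\<^sup>+x. f x \<partial>cvec (I \<union> J)) = (\<integral>\<^sup>+x. (\<integral>\<^sup>+y. f (merge I J (x, y)) \<partial>cvec J) \<partial>cvec I)"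
  by (rule clborel.product_nn_integral_fold[OF assms(3,1,2,4)])

text \<open>The column index set is arbitrary so that the change of variables can be proved by
  adding one column at a time, each contributing a factor |det V|^2.\<close>

definition lmul :: "nat \<Rightarrow> 'j set \<Rightarrow> complex mat \<Rightarrow> (nat \<times> 'j \<Rightarrow> complex) \<Rightarrow> nat \<times> 'j \<Rightarrow> complex" where
  "lmul n J V G = (\<lambda>p\<in>{..<n} \<times> J. \<Sum>k<n. V $$ (fst p,k) * G (k, snd p))"

lemma measurable_lmul [measurable]: "lmul n J V \<in> cvec ({..<n} \<times> J) \<rightarrow>\<^sub>M cvec ({..<n} \<times> J)"
  unfolding lmul_def by (intro measurable_restrict borel_measurable_sum borel_measurable_times borel_measurable_const) auto

lemma nn_integral_lmul:
  assumes V: "V \<in> carrier_mat n n" and det: "Determinant.det V \<noteq> 0" and J: "finite J"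
    and "f \<in> borel_measurable (cvec ({..<n} \<times> J))"
  shows "(\<integral>\<^sup>+G. f G \<partial>cvec ({..<n} \<times> J)) = ennreal ((cmod (Determinant.det V)) ^ (2 * card J)) * (\<integral>\<^sup>+G. f (lmul n J V G) \<partial>cvec ({..<n} \<times> J))"
  using J assms(4)
proof (induction J arbitrary: f rule: finite_induct)
  case empty
  thus ?case by (simp add: PiM_empty lmul_def nn_integral_count_space_finite restrict_def)
next
  case (insert j J)
  let ?I = "{..<n} \<times> J" and ?K = "{..<n} \<times> {j}"
  have I: "finite ?I" "finite ?K" "?I \<inter> ?K = {}" and Un: "{..<n} \<times> insert j J = ?I \<union> ?K"
    using insert.hyps by auto
  have f [measurable]: "f \<in> borel_measurable (cvec (?I \<union> ?K))" using insert.prems unfolding Un .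
  define h where "h x = (\<lambda>p\<in>?K. x (fst p))" for x :: "nat \<Rightarrow> complex"
  have h_meas [measurable]: "h \<in> cvec {..<n} \<rightarrow>\<^sub>M cvec ?K"
    unfolding h_def by (intro measurable_restrict) auto
  have bij: "bij_betw fst ?K {..<n}" by (auto simp: bij_betw_def inj_on_def)
  have K: "(\<integral>\<^sup>+y. g y \<partial>cvec ?K) = (\<integral>\<^sup>+x. g (h x) \<partial>cvec {..<n})" if "g \<in> borel_measurable (cvec ?K)" for g
    using nn_integral_cvec_reindex[OF bij _ that] by (simp add: h_def)
  have mrg [measurable]: "merge ?I ?K \<in> cvec ?I \<Otimes>\<^sub>M cvec ?K \<rightarrow>\<^sub>M cvec (?I \<union> ?K)" by (rule measurable_merge)
  have lm [measurable]: "lmul n (insert j J) V \<in> cvec (?I \<union> ?K) \<rightarrow>\<^sub>M cvec (?I \<union> ?K)"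
    using measurable_lmul[of n "insert j J" V] unfolding Un .
  interpret K: sigma_finite_measure "cvec ?K" by (rule clborel.sigma_finite) simp
  interpret N: sigma_finite_measure "cvec {..<n}" by (rule clborel.sigma_finite) simp
  have mf: "(\<lambda>p. f (merge ?I ?K p)) \<in> borel_measurable (cvec ?I \<Otimes>\<^sub>M cvec ?K)" by measurable
  have mfx: "(\<lambda>y. f (merge ?I ?K (x, y))) \<in> borel_measurable (cvec ?K)" if "x \<in> space (cvec ?I)" for x
    using measurable_compose[OF measurable_Pair1'[OF that] mf] by simp
  have mfh: "(\<lambda>p. f (merge ?I ?K (fst p, h (snd p)))) \<in> borel_measurable (cvec ?I \<Otimes>\<^sub>M cvec {..<n})"
    by measurable
  have mfhx: "(\<lambda>y. f (merge ?I ?K (x, h y))) \<in> borel_measurable (cvec {..<n})" if "x \<in> space (cvec ?I)" for x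
    using measurable_compose[OF measurable_Pair1'[OF that] mfh] by simp
  have eq: "lmul n (insert j J) V (merge ?I ?K (x, h y)) = merge ?I ?K (lmul n J V x, h (mat_apply n V y))" for x y
    using insert.hyps by (auto simp: lmul_def merge_def h_def mat_apply_def fun_eq_iff intro!: sum.cong)
  have split: "(\<integral>\<^sup>+G. g G \<partial>cvec ({..<n} \<times> insert j J)) = (\<integral>\<^sup>+x. (\<integral>\<^sup>+y. g (merge ?I ?K (x, h y)) \<partial>cvec {..<n}) \<partial>cvec ?I)"
    if g [measurable]: "g \<in> borel_measurable (cvec (?I \<union> ?K))" for g
  proof -
    have "(\<lambda>y. g (merge ?I ?K (x, y))) \<in> borel_measurable (cvec ?K)" if "x \<in> space (cvec ?I)" for x
      using measurable_compose[OF measurable_Pair1'[OF that] measurable_compose[OF mrg g]] by simp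
    thus ?thesis unfolding Un nn_integral_cvec_Un[OF I g]
      by (intro nn_integral_cong K)
  qed
  define c where "c = ennreal ((cmod (Determinant.det V))\<^sup>2)"
  have "(\<integral>\<^sup>+G. f G \<partial>cvec ({..<n} \<times> insert j J)) = (\<integral>\<^sup>+x. (\<integral>\<^sup>+y. f (merge ?I ?K (x, h y)) \<partial>cvec {..<n}) \<partial>cvec ?I)"
    by (rule split) measurable
  also have "\<dots> = (\<integral>\<^sup>+x. c * (\<integral>\<^sup>+y. f (merge ?I ?K (x, h (mat_apply n V y))) \<partial>cvec {..<n}) \<partial>cvec ?I)"
    unfolding c_def by (intro nn_integral_cong nn_integral_mat_apply[OF V det] mfhx)
  also have "\<dots> = c * (\<integral>\<^sup>+x. (\<integral>\<^sup>+y. f (merge ?I ?K (x, h (mat_apply n V y))) \<partial>cvec {..<n}) \<partial>cvec ?I)"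
    by (rule nn_integral_cmult) measurable
  also have "(\<integral>\<^sup>+x. (\<integral>\<^sup>+y. f (merge ?I ?K (x, h (mat_apply n V y))) \<partial>cvec {..<n}) \<partial>cvec ?I)
     = ennreal ((cmod (Determinant.det V)) ^ (2 * card J)) * (\<integral>\<^sup>+x. (\<integral>\<^sup>+y. f (merge ?I ?K (lmul n J V x, h (mat_apply n V y))) \<partial>cvec {..<n}) \<partial>cvec ?I)"
    by (rule insert.IH) measurable
  also have "(\<integral>\<^sup>+x. (\<integral>\<^sup>+y. f (merge ?I ?K (lmul n J V x, h (mat_apply n V y))) \<partial>cvec {..<n}) \<partial>cvec ?I)
     = (\<integral>\<^sup>+G. f (lmul n (insert j J) V G) \<partial>cvec ({..<n} \<times> insert j J))"
    unfolding eq[symmetric] by (rule split[symmetric]) measurable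
  finally show ?case
    using insert.hyps by (simp add: c_def mult.assoc[symmetric] ennreal_mult[symmetric] power_add[symmetric])
qed

definition mat_fun :: "nat \<Rightarrow> complex mat \<Rightarrow> nat \<times> nat \<Rightarrow> complex" where
  "mat_fun n M = (\<lambda>p\<in>{..<n} \<times> {..<n}. M $$ p)"

abbreviation fun_mat :: "nat \<Rightarrow> (nat \<times> nat \<Rightarrow> complex) \<Rightarrow> complex mat" where
  "fun_mat n G \<equiv> mat n n G"

abbreviation cmat :: "nat \<Rightarrow> (nat \<times> nat \<Rightarrow> complex) measure" where
  "cmat n \<equiv> cvec ({..<n} \<times> {..<n})"

text \<open>Right multiplication is left multiplication by the transpose between two transpositions
  of the array; the Jacobians of the two multiplications are inverse to each other.\<close>

lemma nn_integral_similarity: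
  assumes V: "V \<in> carrier_mat n n" and W: "W \<in> carrier_mat n n" and VW: "V * W = 1\<^sub>m n"
    and f: "f \<in> borel_measurable (cmat n)"
  shows "(\<integral>\<^sup>+G. f (mat_fun n (V * fun_mat n G * W)) \<partial>cmat n) = (\<integral>\<^sup>+G. f G \<partial>cmat n)"
proof -
  let ?N = "{..<n} \<times> {..<n}"
  have "Determinant.det V * Determinant.det W = 1" using det_mult[OF V W] VW by simp
  hence d: "Determinant.det V \<noteq> 0" "Determinant.det (transpose_mat W) \<noteq> 0"
    "cmod (Determinant.det V) * cmod (Determinant.det (transpose_mat W)) = 1"
    using det_transpose[OF W] by (auto simp: norm_mult[symmetric])
  define T where "T G = (\<lambda>p\<in>?N. G (prod.swap p))" for G :: "nat \<times> nat \<Rightarrow> complex"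
  have T_meas [measurable]: "T \<in> cmat n \<rightarrow>\<^sub>M cmat n"
    unfolding T_def by (intro measurable_restrict measurable_component_singleton) auto
  have bij: "bij_betw prod.swap ?N ?N" by (intro bij_betw_byWitness[where f' = prod.swap]) auto
  have T_int: "(\<integral>\<^sup>+G. g (T G) \<partial>cmat n) = (\<integral>\<^sup>+G. g G \<partial>cmat n)" if "g \<in> borel_measurable (cmat n)" for g
    unfolding T_def using nn_integral_cvec_reindex[OF bij _ that] by simp
  note [measurable] = f
  have eq: "mat_fun n (V * fun_mat n G * W) = lmul n {..<n} V (T (lmul n {..<n} (transpose_mat W) (T G)))" for G
    using V W by (auto simp: mat_fun_def lmul_def T_def fun_eq_iff restrict_def scalar_prod_def atLeast0LessThan
        sum_distrib_left sum_distrib_right mult_ac intro: sum.swap)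
  let ?a = "ennreal ((cmod (Determinant.det V)) ^ (2 * card {..<n}))" and ?b = "ennreal ((cmod (Determinant.det (transpose_mat W))) ^ (2 * card {..<n}))"
  have ab: "?a * ?b = 1"
    using d(3) by (simp add: ennreal_mult[symmetric] power_mult_distrib[symmetric])
  have "(\<integral>\<^sup>+G. f (mat_fun n (V * fun_mat n G * W)) \<partial>cmat n) = (\<integral>\<^sup>+G. f (lmul n {..<n} V (T (lmul n {..<n} (transpose_mat W) G))) \<partial>cmat n)"
    unfolding eq by (rule T_int) measurable
  also have "\<dots> = ?a * (?b * \<dots>)" using ab by (simp add: mult.assoc[symmetric])
  also have "?b * (\<integral>\<^sup>+G. f (lmul n {..<n} V (T (lmul n {..<n} (transpose_mat W) G))) \<partial>cmat n) = (\<integral>\<^sup>+G. f (lmul n {..<n} V (T G)) \<partial>cmat n)"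
    using W d by (intro nn_integral_lmul[symmetric]) (auto simp del: card_lessThan)
  also have "\<dots> = (\<integral>\<^sup>+G. f (lmul n {..<n} V G) \<partial>cmat n)" by (rule T_int) measurable
  also have "?a * \<dots> = (\<integral>\<^sup>+G. f G \<partial>cmat n)"
    using V d by (intro nn_integral_lmul[symmetric]) (auto simp del: card_lessThan)
  finally show ?thesis .
qed

section \<open>Bordered matrices\<close>

abbreviation colm :: "nat \<Rightarrow> (nat \<Rightarrow> complex) \<Rightarrow> complex mat" where
  "colm n c \<equiv> mat n 1 (\<lambda>p. c (fst p))"
abbreviation rowm :: "nat \<Rightarrow> (nat \<Rightarrow> complex) \<Rightarrow> complex mat" where
  "rowm n b \<equiv> mat 1 n (\<lambda>p. b (snd p))"
abbreviation scm :: "complex \<Rightarrow> complex mat" where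
  "scm a \<equiv> mat 1 1 (\<lambda>_. a)"

definition border :: "complex mat \<Rightarrow> (nat \<Rightarrow> complex) \<Rightarrow> (nat \<Rightarrow> complex) \<Rightarrow> complex \<Rightarrow> complex mat" where
  "border D b c a = four_block_mat D (colm (dim_row D) c) (rowm (dim_col D) b) (scm a)"

lemma border_carrier [simp]: "D \<in> carrier_mat n n \<Longrightarrow> border D b c a \<in> carrier_mat (Suc n) (Suc n)"
  unfolding border_def by auto

lemma border_index:
  assumes "D \<in> carrier_mat n n" "i < Suc n" "j < Suc n"
  shows "border D b c a $$ (i,j) = (if i < n then if j < n then D $$ (i,j) else c i else if j < n then b j else a)"
  using assms unfolding border_def by auto

lemma mat_adjoin_mult:
  assumes "A \<in> carrier_mat n n" "B \<in> carrier_mat n n"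
  shows "border A b c a * border B b' c' a' =
    border (mat n n (\<lambda>(i,j). (A * B) $$ (i,j) + c i * b' j)) (\<lambda>j. (\<Sum>k<n. b k * B $$ (k,j)) + a * b' j)
      (\<lambda>i. (\<Sum>k<n. A $$ (i,k) * c' k) + c i * a') ((\<Sum>k<n. b k * c' k) + a * a')"
  by (rule eq_matI) (use assms in \<open>auto simp: border_index scalar_prod_def less_Suc_eq atLeast0LessThan border_def\<close>)

lemma poly_char_poly:
  assumes "A \<in> carrier_mat n n"
  shows "poly (char_poly A) (x :: complex) = Determinant.det (mat n n (\<lambda>(i,j). (if i = j then x else 0) - A $$ (i,j)))"
  unfolding char_poly_def
  by (rule poly_det_cong[where n = n]) (use assms in \<open>auto simp: char_poly_matrix_def\<close>)

lemma poly_char_poly_border_lower: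
  assumes D: "D \<in> carrier_mat n n"
  shows "poly (char_poly (border D b (\<lambda>_. 0) l)) x = (x - l) * poly (char_poly D) (x :: complex)"
proof -
  let ?D = "mat n n (\<lambda>(i,j). (if i = j then x else 0) - D $$ (i,j))"
  have "mat (Suc n) (Suc n) (\<lambda>(i,j). (if i = j then x else 0) - border D b (\<lambda>_. 0) l $$ (i,j))
      = four_block_mat ?D (0\<^sub>m n 1) (rowm n (\<lambda>j. - b j)) (scm (x - l))"
    by (rule eq_matI) (use D in \<open>auto simp: border_index less_Suc_eq\<close>)
  thus ?thesis
    by (subst poly_char_poly[OF border_carrier[OF D]], subst poly_char_poly[OF D])
       (simp, subst det_four_block_mat_upper_right_zero[where n = n and m = 1], auto simp: det_single)
qed

text \<open>Expand along the last row: no cofactor of that row contains the corner entry, so the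
  characteristic polynomial is affine in it. This is what makes the corner entry a rational function
  of an eigenvalue.\<close>

lemma poly_char_poly_border_corner:
  assumes D: "D \<in> carrier_mat n n"
  shows "poly (char_poly (border D b c a)) x = poly (char_poly (border D b c 0)) x - a * poly (char_poly D) (x :: complex)"
proof -
  let ?M = "\<lambda>a. mat (Suc n) (Suc n) (\<lambda>(i,j). (if i = j then x else 0) - border D b c a $$ (i,j))"
  have cof: "cofactor (?M a) n j = cofactor (?M 0) n j" if "j < Suc n" for j
  proof -
    have "mat_delete (?M a) n j = mat_delete (?M 0) n j"
      by (rule eq_matI) (use D that in \<open>auto simp: mat_delete_def border_index\<close>)
    thus ?thesis by (simp add: cofactor_def)
  qed
  have corner: "cofactor (?M 0) n n = poly (char_poly D) x"
  proof -
    have "mat_delete (?M 0) n n = mat n n (\<lambda>(i,j). (if i = j then x else 0) - D $$ (i,j))"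
      by (rule eq_matI) (use D in \<open>auto simp: mat_delete_def border_index\<close>)
    thus ?thesis by (simp add: cofactor_def poly_char_poly[OF D])
  qed
  have "Determinant.det (?M a) = (\<Sum>j<Suc n. ?M a $$ (n,j) * cofactor (?M a) n j)" for a
    by (rule laplace_expansion_row) auto
  hence "Determinant.det (?M a) - Determinant.det (?M 0) = (\<Sum>j<Suc n. ?M a $$ (n,j) * cofactor (?M 0) n j) - (\<Sum>j<Suc n. ?M 0 $$ (n,j) * cofactor (?M 0) n j)"
    using cof by simp
  also have "\<dots> = (\<Sum>j<Suc n. (if j = n then - a * cofactor (?M 0) n n else 0))"
    unfolding sum_subtractf[symmetric] using D by (intro sum.cong refl) (auto simp: border_index algebra_simps)
  also have "\<dots> = - a * poly (char_poly D) x" by (simp add: corner del: lessThan_Suc)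
  finally show ?thesis
    unfolding poly_char_poly[OF border_carrier[OF D]] by (simp add: algebra_simps)
qed

text \<open>A functional of square matrices that is invariant under similarity and splits off eigenvalues:
  \<open>F A\<close> is the product of \<open>w l\<close> over the eigenvalues \<open>l\<close> of \<open>A\<close>.\<close>

definition spectral_product :: "(complex mat \<Rightarrow> ennreal) \<Rightarrow> (complex \<Rightarrow> ennreal) \<Rightarrow> bool" where
  "spectral_product F w \<longleftrightarrow> w \<in> borel_measurable borel \<and>
     (\<forall>n. (\<lambda>G. F (fun_mat n G)) \<in> borel_measurable (cmat n)) \<and>
     (\<forall>n A P Q. A \<in> carrier_mat n n \<longrightarrow> P \<in> carrier_mat n n \<longrightarrow> Q \<in> carrier_mat n n \<longrightarrow> P * Q = 1\<^sub>m n \<longrightarrow> F (P * A * Q) = F A) \<and>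
     (\<forall>n D b l. D \<in> carrier_mat n n \<longrightarrow> F (border D b (\<lambda>_. 0) l) = w l * F D) \<and>
     F (mat 0 0 (\<lambda>_. 0)) = 1"

lemma poly_char_poly_similar:
  assumes "A \<in> carrier_mat n n" "P \<in> carrier_mat n n" "Q \<in> carrier_mat n n" "P * Q = 1\<^sub>m n"
  shows "char_poly (P * A * Q) = char_poly (A :: complex mat)"
proof (rule char_poly_similar)
  have "Q * P = 1\<^sub>m n" by (rule mat_mult_left_right_inverse[OF assms(2-4)])
  thus "similar_mat (P * A * Q) A"
    unfolding similar_mat_def similar_mat_wit_def Let_def
    using assms by (intro exI[of _ P] exI[of _ Q]) auto
qed

lemma measurable_det [measurable (raw)]:
  assumes "\<And>i j. i < n \<Longrightarrow> j < n \<Longrightarrow> (\<lambda>x. g x (i,j)) \<in> borel_measurable M"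
  shows "(\<lambda>x. Determinant.det (mat n n (g x)) :: complex) \<in> borel_measurable M"
  unfolding det_mat_def
proof (intro borel_measurable_sum borel_measurable_times borel_measurable_prod borel_measurable_const)
  fix p i assume "p \<in> {p. p permutes {..<n}}" "i \<in> {..<n}"
  thus "(\<lambda>x. g x (i, p i)) \<in> borel_measurable M"
    using assms[of i "p i"] permutes_in_image[of p "{..<n}" i] by auto
qed

lemma measurable_char_poly:
  assumes "\<And>i j. i < n \<Longrightarrow> j < n \<Longrightarrow> (\<lambda>x. g x (i,j)) \<in> borel_measurable M" and "h \<in> borel_measurable M"
  shows "(\<lambda>x. poly (char_poly (fun_mat n (g x))) (h x)) \<in> borel_measurable M"
proof -
  have "poly (char_poly (fun_mat n (g x))) (h x) = Determinant.det (mat n n (\<lambda>p. (if fst p = snd p then h x else 0) - g x p))" for x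
    by (subst poly_char_poly[where n = n], force) (intro arg_cong[where f = Determinant.det] eq_matI, auto)
  moreover have "(\<lambda>x. (if i = j then h x else 0) - g x (i,j)) \<in> borel_measurable M" if "i < n" "j < n" for i j
    using assms that by (cases "i = j") auto
  ultimately show ?thesis by (simp add: measurable_det del: if_split)
qed

text \<open>This closure drives the induction on the dimension: splitting off an eigenvalue
  \<open>x\<close> leaves the remaining matrix weighted by exactly such a factor.\<close>

lemma spectral_product_char_poly:
  assumes F: "spectral_product F w"
  shows "spectral_product (\<lambda>A. F A * ennreal ((cmod (poly (char_poly A) x))\<^sup>2)) (\<lambda>l. w l * ennreal ((cmod (x - l))\<^sup>2))"
  unfolding spectral_product_def
proof (intro conjI allI impI)
  show "(\<lambda>l. w l * ennreal ((cmod (x - l))\<^sup>2)) \<in> borel_measurable borel"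
    using F unfolding spectral_product_def by auto
  fix n
  have "(\<lambda>G. poly (char_poly (fun_mat n G)) x) \<in> borel_measurable (cmat n)"
    by (rule measurable_char_poly) auto
  moreover have "(\<lambda>G. F (fun_mat n G)) \<in> borel_measurable (cmat n)"
    using F unfolding spectral_product_def by blast
  ultimately show "(\<lambda>G. F (fun_mat n G) * ennreal ((cmod (poly (char_poly (fun_mat n G)) x))\<^sup>2)) \<in> borel_measurable (cmat n)"
    by measurable
next
  fix n and A P Q :: "complex mat"
  assume *: "A \<in> carrier_mat n n" "P \<in> carrier_mat n n" "Q \<in> carrier_mat n n" "P * Q = 1\<^sub>m n"
  show "F (P * A * Q) * ennreal ((cmod (poly (char_poly (P * A * Q)) x))\<^sup>2) = F A * ennreal ((cmod (poly (char_poly A) x))\<^sup>2)"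
    using F * unfolding spectral_product_def poly_char_poly_similar[OF *] by metis
next
  fix n b l and D :: "complex mat" assume *: "D \<in> carrier_mat n n"
  show "F (border D b (\<lambda>_. 0) l) * ennreal ((cmod (poly (char_poly (border D b (\<lambda>_. 0) l)) x))\<^sup>2)
      = w l * ennreal ((cmod (x - l))\<^sup>2) * (F D * ennreal ((cmod (poly (char_poly D) x))\<^sup>2))"
    using F * unfolding spectral_product_def poly_char_poly_border_lower[OF *]
    by (simp add: norm_mult power_mult_distrib ennreal_mult mult_ac)
next
  show "F (mat 0 0 (\<lambda>_. 0)) * ennreal ((cmod (poly (char_poly (mat 0 0 (\<lambda>_. 0))) x))\<^sup>2) = 1"
    using F unfolding spectral_product_def by (simp add: poly_char_poly[where n = 0])
qed

lemma spectral_product_one: "spectral_product (\<lambda>_. 1) (\<lambda>_. 1)"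
  by (auto simp: spectral_product_def)

text \<open>The matrix with eigenvector \<open>(y, 1)\<close> and eigenvalue \<open>l\<close>, compressed to \<open>D - y b\<close> on the quotient.\<close>

definition eig_border :: "complex mat \<Rightarrow> (nat \<Rightarrow> complex) \<Rightarrow> (nat \<Rightarrow> complex) \<Rightarrow> complex \<Rightarrow> complex mat" where
  "eig_border D b y l = (let n = dim_row D in
     border D b (\<lambda>i. l * y i - (\<Sum>k<n. D $$ (i,k) * y k)) (l - (\<Sum>k<n. b k * y k)))"

definition compress :: "complex mat \<Rightarrow> (nat \<Rightarrow> complex) \<Rightarrow> (nat \<Rightarrow> complex) \<Rightarrow> complex mat" where
  "compress D b y = mat (dim_row D) (dim_row D) (\<lambda>(i,j). D $$ (i,j) - y i * b j)"

lemma border_one: "border (1\<^sub>m n) (\<lambda>_. 0) (\<lambda>_. 0) 1 = 1\<^sub>m (Suc n)"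
  by (rule eq_matI) (auto simp: border_index[where n = n] less_Suc_eq border_def)

lemma border_cong:
  assumes "D \<in> carrier_mat n n" "D = D'" "\<And>j. j < n \<Longrightarrow> b j = b' j" "\<And>i. i < n \<Longrightarrow> c i = c' i" "a = a'"
  shows "border D b c a = border D' b' c' a'"
  unfolding border_def using assms by (intro cong_four_block_mat) (auto intro!: eq_matI)

lemma shear_inverse: "border (1\<^sub>m n) (\<lambda>_. 0) y 1 * border (1\<^sub>m n) (\<lambda>_. 0) (\<lambda>i. - y i) 1 = 1\<^sub>m (Suc n)"
  by (subst mat_adjoin_mult[where n = n], simp, simp, subst border_one[symmetric], rule border_cong[where n = n])
     (auto simp: sum_negf if_distrib[of "\<lambda>x. x * _"] cong: if_cong)

text \<open>The shear sends the last coordinate vector to (y, 1); in sheared coordinates the last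
  column is therefore (0, l) and the matrix is block lower triangular.\<close>

lemma eig_border_similar:
  assumes D: "D \<in> carrier_mat n n"
  shows "eig_border D b y l = border (1\<^sub>m n) (\<lambda>_. 0) y 1 * border (compress D b y) b (\<lambda>_. 0) l * border (1\<^sub>m n) (\<lambda>_. 0) (\<lambda>i. - y i) 1"
proof -
  have C: "compress D b y \<in> carrier_mat n n" using D by (simp add: compress_def)
  have 1: "border (1\<^sub>m n) (\<lambda>_. 0) y 1 * border (compress D b y) b (\<lambda>_. 0) l = border D b (\<lambda>i. l * y i) l"
    using D C by (subst mat_adjoin_mult[where n = n], simp, simp, intro border_cong[where n = n])
      (auto simp: compress_def intro!: eq_matI)
  have "border D b (\<lambda>i. l * y i) l * border (1\<^sub>m n) (\<lambda>_. 0) (\<lambda>i. - y i) 1 = eig_border D b y l"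
    unfolding eig_border_def Let_def using D
    by (subst mat_adjoin_mult[where n = n], simp, simp, intro border_cong[where n = n])
      (auto simp: sum_negf if_distrib[of "\<lambda>x. _ * x"] cong: if_cong intro!: eq_matI)
  thus ?thesis unfolding 1 ..
qed

lemma spectral_product_eig_border:
  assumes F: "spectral_product F w" and D: "D \<in> carrier_mat n n"
  shows "F (eig_border D b y l) = w l * F (compress D b y)"
proof -
  have C: "compress D b y \<in> carrier_mat n n" using D by (simp add: compress_def)
  have "F (eig_border D b y l) = F (border (compress D b y) b (\<lambda>_. 0) l)"
    unfolding eig_border_similar[OF D]
    using F C shear_inverse[of n y] border_carrier[OF C] border_carrier[OF one_carrier_mat] unfolding spectral_product_def by metis
  also have "\<dots> = w l * F (compress D b y)"
    using F C unfolding spectral_product_def by metis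
  finally show ?thesis .
qed

lemma poly_char_poly_eig_border:
  assumes D: "D \<in> carrier_mat n n"
  shows "poly (char_poly (eig_border D b y l)) x = (x - l) * poly (char_poly (compress D b y)) x"
proof -
  have C: "compress D b y \<in> carrier_mat n n" using D by (simp add: compress_def)
  show ?thesis
    unfolding eig_border_similar[OF D]
    by (subst poly_char_poly_similar[of _ "Suc n"]) (auto simp: C shear_inverse poly_char_poly_border_lower[OF C] border_carrier[OF C])
qed

text \<open>For fixed \<open>D\<close>, \<open>b\<close>, \<open>c\<close>, the corner entry for which a given number becomes an eigenvalue.\<close>

definition corner_of_eigenvalue :: "complex mat \<Rightarrow> (nat \<Rightarrow> complex) \<Rightarrow> (nat \<Rightarrow> complex) \<Rightarrow> complex \<Rightarrow> complex" where
  "corner_of_eigenvalue D b c x = poly (char_poly (border D b c 0)) x / poly (char_poly D) x"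

lemma poly_char_poly_border_eq:
  assumes "D \<in> carrier_mat n n" "poly (char_poly D) x \<noteq> 0"
  shows "poly (char_poly (border D b c a)) x = poly (char_poly D) x * (corner_of_eigenvalue D b c x - a)"
  using assms(2) unfolding poly_char_poly_border_corner[OF assms(1), of b c a] corner_of_eigenvalue_def
  by (simp add: field_simps)

text \<open>Away from eigenvalues of \<open>D\<close> the corner entry equals its value at
  \<open>l\<close> plus (x - l) times the quotient of the characteristic polynomials of the
  compressed matrix and of \<open>D\<close>, because the eigenvalue \<open>l\<close> splits off as a
  factor. The derivative at \<open>l\<close> is that quotient.\<close>

lemma eig_border_eq_border:
  assumes D: "D \<in> carrier_mat n n" and p: "poly (char_poly D) l \<noteq> 0"
    and c: "\<And>i. i < n \<Longrightarrow> c i = l * y i - (\<Sum>k<n. D $$ (i,k) * y k)"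
  shows "border D b c (corner_of_eigenvalue D b c l) = eig_border D b y l"
    and "(corner_of_eigenvalue D b c has_field_derivative poly (char_poly (compress D b y)) l / poly (char_poly D) l) (at l)"
proof -
  define a where "a = l - (\<Sum>k<n. b k * y k)"
  have e: "border D b c a = eig_border D b y l"
    unfolding eig_border_def Let_def a_def using D c by (intro border_cong[where n = n]) auto
  have "poly (char_poly (border D b c a)) l = 0"
    unfolding e poly_char_poly_eig_border[OF D] by simp
  hence a: "corner_of_eigenvalue D b c l = a"
    using p unfolding poly_char_poly_border_eq[OF D p] by simp
  thus "border D b c (corner_of_eigenvalue D b c l) = eig_border D b y l" using e by simp
  let ?q = "\<lambda>x. poly (char_poly (compress D b y)) x" and ?p = "\<lambda>x. poly (char_poly D) x"
  have val: "corner_of_eigenvalue D b c x = a + (x - l) * (?q x / ?p x)" if "?p x \<noteq> 0" for x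
    using poly_char_poly_border_eq[OF D that, of b c a] poly_char_poly_eig_border[OF D, of b y l x] that
    unfolding e by (simp add: field_simps)
  have "((\<lambda>x. a + (x - l) * (?q x / ?p x)) has_field_derivative
      0 + ((1 - 0) * (?q l / ?p l) + (poly (pderiv (char_poly (compress D b y))) l * ?p l - ?q l * poly (pderiv (char_poly D)) l) / (?p l * ?p l) * (l - l))) (at l)"
    by (intro DERIV_add DERIV_mult DERIV_diff DERIV_divide DERIV_const DERIV_ident poly_DERIV p)
  hence d: "((\<lambda>x. a + (x - l) * (?q x / ?p x)) has_field_derivative ?q l / ?p l) (at l)" by simp
  have "open {x. ?p x \<noteq> 0}"
    by (intro open_Collect_neq continuous_intros)
  hence "eventually (\<lambda>x. x \<in> {x. ?p x \<noteq> 0}) (nhds l)" using p by (intro eventually_nhds_in_open) auto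
  hence "eventually (\<lambda>x. corner_of_eigenvalue D b c x = a + (x - l) * (?q x / ?p x)) (nhds l)"
    by eventually_elim (use val in auto)
  thus "(corner_of_eigenvalue D b c has_field_derivative ?q l / ?p l) (at l)"
    using d by (subst DERIV_cong_ev[OF refl _ refl])
qed

section \<open>Unitary completion\<close>

text \<open>The squared Frobenius norm. Since exp(- fro A) is the unnormalized Gaussian density of
  the entries, its unitary invariance preserves the Gaussian weight under deflation.\<close>

definition fro :: "complex mat \<Rightarrow> real" where
  "fro A = (\<Sum>i<dim_row A. \<Sum>j<dim_col A. (cmod (A $$ (i,j)))\<^sup>2)"

text \<open>The hypothesis says that the columns of \<open>u\<close> are orthonormal. The invariance
  of \<open>fro\<close> uses this twice, once for the left and once for the right factor.\<close>

lemma sum_cmod_square_unitary: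
  fixes n :: nat
  assumes "\<And>k l. k < n \<Longrightarrow> l < n \<Longrightarrow> (\<Sum>i<n. cnj (u i l) * u i k) = (if l = k then 1 else 0)"
  shows "(\<Sum>i<n. (cmod (\<Sum>k<n. u i k * a k))\<^sup>2) = (\<Sum>k<n. (cmod (a k))\<^sup>2)"
proof -
  have "complex_of_real (\<Sum>i<n. (cmod (\<Sum>k<n. u i k * a k))\<^sup>2) = (\<Sum>i<n. (\<Sum>k<n. u i k * a k) * cnj (\<Sum>l<n. u i l * a l))"
    unfolding of_real_sum complex_norm_square ..
  also have "\<dots> = (\<Sum>i<n. \<Sum>k<n. \<Sum>l<n. a k * cnj (a l) * (cnj (u i l) * u i k))"
    by (simp add: sum_product mult_ac)
  also have "\<dots> = (\<Sum>k<n. \<Sum>l<n. \<Sum>i<n. a k * cnj (a l) * (cnj (u i l) * u i k))"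
    by (subst sum.swap, rule sum.cong[OF refl], subst sum.swap, rule refl)
  also have "\<dots> = (\<Sum>k<n. \<Sum>l<n. a k * cnj (a l) * (if l = k then 1 else 0))"
    using assms by (simp add: sum_distrib_left[symmetric])
  also have "\<dots> = complex_of_real (\<Sum>k<n. (cmod (a k))\<^sup>2)"
    unfolding of_real_sum complex_norm_square
  proof (rule sum.cong[OF refl])
    fix k assume "k \<in> {..<n}"
    have "(\<Sum>l<n. a k * cnj (a l) * (if l = k then 1 else 0)) = (\<Sum>l<n. if l = k then a k * cnj (a k) else 0)"
      by (intro sum.cong) auto
    also have "\<dots> = a k * cnj (a k)" using \<open>k \<in> {..<n}\<close> by (subst sum.delta) auto
    finally show "(\<Sum>l<n. a k * cnj (a l) * (if l = k then 1 else 0)) = a k * cnj (a k)" .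
  qed
  finally show ?thesis unfolding of_real_eq_iff .
qed

lemma fro_unitary:
  assumes U: "U \<in> carrier_mat n n" and U': "U' \<in> carrier_mat n n" and A: "A \<in> carrier_mat n n"
    and adj: "\<And>i j. i < n \<Longrightarrow> j < n \<Longrightarrow> U' $$ (i,j) = cnj (U $$ (j,i))" and UU: "U' * U = 1\<^sub>m n"
  shows "fro (U * A * U') = fro A"
proof -
  have orth: "(\<Sum>i<n. cnj (U $$ (i,l)) * U $$ (i,k)) = (if l = k then 1 else 0)" if "k < n" "l < n" for k l
    using arg_cong[OF UU, of "\<lambda>M. M $$ (l,k)"] that U U' adj by (simp add: scalar_prod_def atLeast0LessThan)
  have UA: "U * A \<in> carrier_mat n n" using U A by simp
  have "fro (U * A * U') = (\<Sum>i<n. \<Sum>j<n. (cmod (\<Sum>k<n. U $$ (j,k) * cnj ((U * A) $$ (i,k))))\<^sup>2)"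
  proof -
    have "(B * U') $$ (i,j) = cnj (\<Sum>k<n. U $$ (j,k) * cnj (B $$ (i,k)))" if "i < n" "j < n" "B \<in> carrier_mat n n" for i j B
      using that U' by (simp add: scalar_prod_def atLeast0LessThan adj mult.commute)
    from this[OF _ _ UA] show ?thesis unfolding fro_def using UA U' U
      by (intro sum.cong) (simp_all only: complex_mod_cnj index_mult_mat carrier_matD lessThan_iff)
  qed
  also have "\<dots> = (\<Sum>i<n. \<Sum>k<n. (cmod ((U * A) $$ (i,k)))\<^sup>2)"
    by (subst sum_cmod_square_unitary[OF orth]) auto
  also have "\<dots> = (\<Sum>k<n. \<Sum>i<n. (cmod (\<Sum>j<n. U $$ (i,j) * A $$ (j,k)))\<^sup>2)"
    using U A by (subst sum.swap) (simp add: scalar_prod_def atLeast0LessThan)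
  also have "\<dots> = (\<Sum>k<n. \<Sum>j<n. (cmod (A $$ (j,k)))\<^sup>2)"
    by (subst sum_cmod_square_unitary[OF orth]) auto
  also have "\<dots> = fro A" using A by (subst sum.swap) (simp add: fro_def)
  finally show ?thesis .
qed

lemma fro_border:
  assumes "D \<in> carrier_mat n n"
  shows "fro (border D b c a) = fro D + (\<Sum>j<n. (cmod (b j))\<^sup>2) + (\<Sum>i<n. (cmod (c i))\<^sup>2) + (cmod a)\<^sup>2"
  using assms unfolding fro_def carrier_matD[OF border_carrier[OF assms]]
  by (simp add: border_index[OF assms] sum.distrib)

lemma mult_regroup:
  fixes A :: "'a :: semiring_0 mat"
  assumes "A \<in> carrier_mat n n" "B \<in> carrier_mat n n" "C \<in> carrier_mat n n" "D \<in> carrier_mat n n"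
  shows "A * B * (C * D) = A * (B * C) * D"
    and "E \<in> carrier_mat n n \<Longrightarrow> A * B * E * (C * D) = A * (B * E * C) * D"
  using assms by (simp_all add: assoc_mult_mat[of _ n n _ n _ n] mult_carrier_mat[of _ n n _ n])

text \<open>A unitary matrix with last column proportional to \<open>(y, 1)\<close>, and its factorization through the shear
  that moves the eigenvector \<open>(y, 1)\<close> to the last coordinate vector.\<close>

locale unitary_completion =
  fixes n :: nat and y :: "nat \<Rightarrow> complex"
begin

definition "\<rho> = (\<Sum>k<n. (cmod (y k))\<^sup>2)"
definition "\<sigma> = sqrt (1 + \<rho>)"
text \<open>\<open>V\<close> and \<open>W\<close> are the positive square root of 1 + y y^* and its
  inverse: on \<open>y\<close> they act as \<sigma> and 1/\<sigma>, and they fix the orthogonal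
  complement of \<open>y\<close>. The denominators follow from |y|^2 = (\<sigma> - 1)(\<sigma> +
  1).\<close>

definition "W = mat n n (\<lambda>(i,j). (if i = j then 1 else 0) - y i * cnj (y j) / of_real (\<sigma> * (\<sigma> + 1)))"
definition "V = mat n n (\<lambda>(i,j). (if i = j then 1 else 0) + y i * cnj (y j) / of_real (\<sigma> + 1))"
definition "P = border V (\<lambda>j. - cnj (y j) / of_real \<sigma>) (\<lambda>_. 0) (1 / of_real \<sigma>)"
definition "P' = border W (\<lambda>j. cnj (y j) / of_real \<sigma>) (\<lambda>_. 0) (of_real \<sigma>)"
definition "U = border W (\<lambda>j. - cnj (y j) / of_real \<sigma>) (\<lambda>i. y i / of_real \<sigma>) (1 / of_real \<sigma>)"
definition "U' = border W (\<lambda>j. cnj (y j) / of_real \<sigma>) (\<lambda>i. - y i / of_real \<sigma>) (1 / of_real \<sigma>)"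

lemma \<rho>: "\<rho> \<ge> 0" "\<rho> = \<sigma>\<^sup>2 - 1" and \<sigma>: "\<sigma> \<ge> 1" "\<sigma> > 0"
proof -
  show 1: "\<rho> \<ge> 0" by (simp add: \<rho>_def sum_nonneg)
  thus "\<rho> = \<sigma>\<^sup>2 - 1" "\<sigma> \<ge> 1" by (auto simp: \<sigma>_def)
  thus "\<sigma> > 0" by simp
qed

lemma \<rho>_sum: "(\<Sum>k<n. cnj (y k) * y k) = complex_of_real (\<sigma>\<^sup>2 - 1)"
  unfolding \<rho>(2)[symmetric] \<rho>_def of_real_sum complex_norm_square by (simp add: mult.commute)

lemma carr [simp]: "W \<in> carrier_mat n n" "V \<in> carrier_mat n n" "P \<in> carrier_mat (Suc n) (Suc n)" "P' \<in> carrier_mat (Suc n) (Suc n)"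
  "U \<in> carrier_mat (Suc n) (Suc n)" "U' \<in> carrier_mat (Suc n) (Suc n)"
  by (auto simp: W_def V_def P_def P'_def U_def U'_def)

lemma W_y: "i < n \<Longrightarrow> (\<Sum>k<n. W $$ (i,k) * y k) = y i / of_real \<sigma>"
proof -
  assume i: "i < n"
  have "(\<Sum>k<n. W $$ (i,k) * y k) = (\<Sum>k<n. (if i = k then y k else 0) - y i / of_real (\<sigma> * (\<sigma> + 1)) * (cnj (y k) * y k))"
    using i by (intro sum.cong refl) (auto simp: W_def algebra_simps)
  also have "\<dots> = y i - y i / of_real (\<sigma> * (\<sigma> + 1)) * of_real (\<sigma>\<^sup>2 - 1)"
    unfolding sum_subtractf sum_distrib_left[symmetric] \<rho>_sum using i by simp
  also have "\<dots> = y i * of_real (1 - (\<sigma>\<^sup>2 - 1) / (\<sigma> * (\<sigma> + 1)))" by (simp add: algebra_simps)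
  also have "1 - (\<sigma>\<^sup>2 - 1) / (\<sigma> * (\<sigma> + 1)) = 1 / \<sigma>"
    using \<sigma> by (simp add: divide_simps) (simp add: algebra_simps power2_eq_square)
  finally show ?thesis by simp
qed

lemma y_W: "j < n \<Longrightarrow> (\<Sum>k<n. cnj (y k) * W $$ (k,j)) = cnj (y j) / of_real \<sigma>"
proof -
  assume j: "j < n"
  have "(\<Sum>k<n. cnj (y k) * W $$ (k,j)) = cnj (\<Sum>k<n. W $$ (j,k) * y k)"
    using j by (auto simp: W_def intro!: sum.cong)
  thus ?thesis using W_y[OF j] by simp
qed

lemma VW: "V * W = 1\<^sub>m n"
proof (rule eq_matI)
  fix i j assume "i < dim_row (1\<^sub>m n)" "j < dim_col (1\<^sub>m n)"
  hence ij: "i < n" "j < n" by auto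
  have "(V * W) $$ (i,j) = (\<Sum>k<n. (if i = k then W $$ (k,j) else 0) + y i / of_real (\<sigma> + 1) * (cnj (y k) * W $$ (k,j)))"
  proof -
    have "(V * W) $$ (i,j) = (\<Sum>k<n. V $$ (i,k) * W $$ (k,j))"
      using ij carrier_matD[OF carr(1)] carrier_matD[OF carr(2)] by (simp add: scalar_prod_def atLeast0LessThan)
    also have "\<dots> = (\<Sum>k<n. (if i = k then W $$ (k,j) else 0) + y i / of_real (\<sigma> + 1) * (cnj (y k) * W $$ (k,j)))"
      using ij by (intro sum.cong refl) (simp add: V_def algebra_simps)
    finally show ?thesis .
  qed
  also have "\<dots> = W $$ (i,j) + y i / of_real (\<sigma> + 1) * (cnj (y j) / of_real \<sigma>)"
    unfolding sum.distrib sum_distrib_left[symmetric] y_W[OF ij(2)] using ij by simp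
  also have "\<dots> = 1\<^sub>m n $$ (i,j)" using ij by (simp add: W_def mult.commute)
  finally show "(V * W) $$ (i,j) = 1\<^sub>m n $$ (i,j)" .
qed (auto simp: W_def V_def)

lemma PP': "P * P' = 1\<^sub>m (Suc n)"
  unfolding P_def P'_def using y_W \<sigma>
  by (subst mat_adjoin_mult[where n = n], simp, simp, subst border_one[symmetric], intro border_cong[where n = n])
     (auto simp: VW sum_negf sum_divide_distrib[symmetric] intro!: eq_matI)

lemma U_eq: "border (1\<^sub>m n) (\<lambda>_. 0) y 1 * P = U"
  unfolding P_def U_def
proof (subst mat_adjoin_mult[where n = n], simp, simp, rule border_cong[where n = n])
  have e: "y i * cnj (y j) / of_real (\<sigma> + 1) - y i * cnj (y j) / of_real \<sigma> = - (y i * cnj (y j) / of_real (\<sigma> * (\<sigma> + 1)))" for i j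
  proof -
    have "1 / (\<sigma> + 1) - 1 / \<sigma> = - (1 / (\<sigma> * (\<sigma> + 1)))" using \<sigma> by (simp add: field_simps)
    hence "complex_of_real (1 / (\<sigma> + 1) - 1 / \<sigma>) = complex_of_real (- (1 / (\<sigma> * (\<sigma> + 1))))" by simp
    from arg_cong[OF this, of "\<lambda>z. y i * cnj (y j) * z"] show ?thesis by (simp add: algebra_simps)
  qed
  show "mat n n (\<lambda>(i, j). (1\<^sub>m n * V) $$ (i, j) + y i * (- cnj (y j) / of_real \<sigma>)) = W"
    by (rule eq_matI) (use e in \<open>auto simp: V_def W_def\<close>)
qed (auto simp: sum_negf intro!: sum.neutral)

lemma U'_eq: "P' * border (1\<^sub>m n) (\<lambda>_. 0) (\<lambda>i. - y i) 1 = U'"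
  unfolding P'_def U'_def
proof (subst mat_adjoin_mult[where n = n], simp, simp, rule border_cong[where n = n])
  show "(\<Sum>k<n. cnj (y k) / of_real \<sigma> * - y k) + of_real \<sigma> * 1 = 1 / of_real \<sigma>"
  proof -
    have "(\<Sum>k<n. cnj (y k) / of_real \<sigma> * - y k) + of_real \<sigma> * 1 = complex_of_real (- ((\<sigma>\<^sup>2 - 1) / \<sigma>) + \<sigma>)"
      using \<rho>_sum by (simp add: sum_negf sum_divide_distrib[symmetric])
    also have "- ((\<sigma>\<^sup>2 - 1) / \<sigma>) + \<sigma> = 1 / \<sigma>" using \<sigma> by (simp add: field_simps power2_eq_square)
    finally show ?thesis by simp
  qed
  show "\<And>i. i < n \<Longrightarrow> (\<Sum>k<n. W $$ (i, k) * - y k) + 0 * 1 = - y i / of_real \<sigma>"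
    using W_y by (simp add: sum_negf)
qed (use carrier_matD[OF carr(1)] in \<open>auto simp: if_distrib[of "\<lambda>x. _ * x"] cong: if_cong intro!: eq_matI\<close>)

lemma U'_adjoint: "i < Suc n \<Longrightarrow> j < Suc n \<Longrightarrow> U' $$ (i,j) = cnj (U $$ (j,i))"
  unfolding U_def U'_def by (auto simp: border_index[where n = n] W_def)

lemma UU': "U * U' = 1\<^sub>m (Suc n)"
proof -
  let ?S = "border (1\<^sub>m n) (\<lambda>_. 0) y 1" and ?S' = "border (1\<^sub>m n) (\<lambda>_. 0) (\<lambda>i. - y i) 1"
  have c: "?S \<in> carrier_mat (Suc n) (Suc n)" "?S' \<in> carrier_mat (Suc n) (Suc n)" by simp_all
  have "U * U' = ?S * P * (P' * ?S')" by (simp add: U_eq U'_eq)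
  also have "\<dots> = ?S * (P * P') * ?S'"
    by (rule mult_regroup(1)[where n = "Suc n"]) simp_all
  also have "\<dots> = 1\<^sub>m (Suc n)" using c shear_inverse[of n y] right_mult_one_mat[OF c(1)] by (simp add: PP')
  finally show ?thesis .
qed

lemma U'U: "U' * U = 1\<^sub>m (Suc n)"
  by (rule mat_mult_left_right_inverse[OF _ _ UU']) auto

text \<open>\<open>U\<close> is unitary and is the shear, of determinant 1, times the block
  triangular \<open>P\<close>; hence |det V| = \<sigma>, and \<open>W\<close> is inverse to
  \<open>V\<close>.\<close>

lemma cmod_det_W: "cmod (Determinant.det W) = 1 / \<sigma>"
proof -
  let ?S = "border (1\<^sub>m n) (\<lambda>_. 0) y 1"
  have bd: "Determinant.det (border D b (\<lambda>_. 0) a) = Determinant.det D * a" if "D \<in> carrier_mat n n" for D b a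
  proof -
    have "border D b (\<lambda>_. 0) a = four_block_mat D (0\<^sub>m n 1) (rowm n b) (scm a)"
      unfolding border_def using that by (intro cong_four_block_mat) auto
    thus ?thesis using that
      by (simp, subst det_four_block_mat_upper_right_zero[where n = n and m = 1]) (auto simp: det_single)
  qed
  have S: "Determinant.det ?S = 1"
  proof -
    have "?S = four_block_mat (1\<^sub>m n) (colm n y) (0\<^sub>m 1 n) (scm 1)"
      unfolding border_def by (intro cong_four_block_mat) auto
    thus ?thesis by (simp, subst det_four_block_mat_lower_left_zero[where n = n and m = 1]) (auto simp: det_single)
  qed
  have dU: "Determinant.det U = Determinant.det V / of_real \<sigma>"
    unfolding U_eq[symmetric] by (subst det_mult[where n = "Suc n"]) (auto simp: S P_def bd)
  have "Determinant.det U' = cnj (Determinant.det U)"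
  proof -
    interpret cnj: comm_ring_hom cnj by standard auto
    have "U' = map_mat cnj (transpose_mat U)"
      using carrier_matD[OF carr(5)] carrier_matD[OF carr(6)] by (intro eq_matI) (auto simp: U'_adjoint)
    thus ?thesis using det_transpose[of U "Suc n"] by simp
  qed
  moreover have "Determinant.det U * Determinant.det U' = 1"
    using det_mult[of U "Suc n" U'] UU' by simp
  ultimately have "(cmod (Determinant.det U))\<^sup>2 = 1"
    using complex_norm_square[of "Determinant.det U"] by (metis of_real_eq_1_iff)
  hence "cmod (Determinant.det U) = 1" by (simp add: power2_eq_1_iff) (metis norm_ge_zero not_one_le_zero neg_0_le_iff_le)
  hence "cmod (Determinant.det V) = \<sigma>" using \<sigma> by (simp add: dU norm_divide)
  moreover have "Determinant.det V * Determinant.det W = 1" using det_mult[of V n W] VW by simp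
  ultimately show ?thesis using \<sigma> by (metis nonzero_eq_divide_eq norm_mult norm_one mult.commute less_irrefl)
qed

text \<open>A row \<open>b\<close> given in the orthonormal coordinates of \<open>U\<close>,
  rewritten in the coordinates of the shear.\<close>

definition "last_row G l b = (\<lambda>j. (\<Sum>k<n. (b k - (\<Sum>m<n. cnj (y m) * G $$ (m,k))) / of_real \<sigma> * W $$ (k,j)) + l * cnj (y j) / of_real (\<sigma>\<^sup>2))"

lemma conj_P:
  assumes G: "G \<in> carrier_mat n n"
  shows "P * border G b (\<lambda>_. 0) l * P' = border (V * G * W) (last_row G l b) (\<lambda>_. 0) l"
proof -
  let ?r = "\<lambda>j. (\<Sum>k<n. (- cnj (y k) / of_real \<sigma>) * G $$ (k,j)) + 1 / of_real \<sigma> * b j"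
  have 1: "P * border G b (\<lambda>_. 0) l = border (V * G) ?r (\<lambda>_. 0) (l / of_real \<sigma>)"
    unfolding P_def using G carrier_matD[OF carr(2)]
    by (subst mat_adjoin_mult[where n = n], simp, simp, intro border_cong[where n = n]) (auto intro!: eq_matI)
  have "\<dots> * P' = border (V * G * W) (last_row G l b) (\<lambda>_. 0) l"
    unfolding P'_def
  proof (subst mat_adjoin_mult[where n = n], simp add: mult_carrier_mat[OF carr(2) G], simp, intro border_cong[where n = n], goal_cases)
    case (3 j)
    have "?r k = (b k - (\<Sum>m<n. cnj (y m) * G $$ (m,k))) / of_real \<sigma>" for k
      by (simp add: sum_negf sum_divide_distrib diff_divide_distrib)
    thus ?case using \<sigma> by (simp add: last_row_def power2_eq_square)
  qed (use G \<sigma> carrier_matD[OF carr(1)] carrier_matD[OF carr(2)] in \<open>auto intro!: eq_matI\<close>)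
  thus ?thesis unfolding 1 .
qed

text \<open>In these coordinates the matrix is conjugate under \<open>U\<close> to the block
  triangular matrix made of \<open>G\<close>, \<open>b\<close> and \<open>l\<close>, so the Gaussian
  weight factors over the three.\<close>

lemma fro_eig_border:
  assumes G: "G \<in> carrier_mat n n" and D: "D \<in> carrier_mat n n" and DG: "compress D (last_row G l b) y = V * G * W"
  shows "fro (eig_border D (last_row G l b) y l) = fro G + (\<Sum>j<n. (cmod (b j))\<^sup>2) + (cmod l)\<^sup>2"
proof -
  let ?S = "border (1\<^sub>m n) (\<lambda>_. 0) y 1" and ?S' = "border (1\<^sub>m n) (\<lambda>_. 0) (\<lambda>i. - y i) 1" and ?T = "border G b (\<lambda>_. 0) l"
  have c: "?S \<in> carrier_mat (Suc n) (Suc n)" "?S' \<in> carrier_mat (Suc n) (Suc n)" "?T \<in> carrier_mat (Suc n) (Suc n)" using G by simp_all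
  have "eig_border D (last_row G l b) y l = ?S * (P * ?T * P') * ?S'"
    unfolding eig_border_similar[OF D] DG conj_P[OF G] ..
  also have "\<dots> = (?S * P) * ?T * (P' * ?S')"
    by (rule mult_regroup(2)[where n = "Suc n", symmetric]) (simp_all add: G)
  also have "\<dots> = U * ?T * U'" by (simp add: U_eq U'_eq)
  finally show ?thesis
    using fro_unitary[OF carr(5,6) c(3) U'_adjoint U'U] by (simp add: fro_border[OF G])
qed

end

section \<open>Deflation of one eigenvalue\<close>

lemma sigma_finite_cvec: "finite I \<Longrightarrow> sigma_finite_measure (cvec I)"
  by (rule clborel.sigma_finite)

text \<open>\<open>border\<close> at the level of entry functions, restricted to the index square
  because product measures live on extensional functions.\<close>

definition assemble :: "nat \<Rightarrow> (nat \<times> nat \<Rightarrow> complex) \<Rightarrow> (nat \<Rightarrow> complex) \<Rightarrow> (nat \<Rightarrow> complex) \<Rightarrow> complex \<Rightarrow> nat \<times> nat \<Rightarrow> complex" where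
  "assemble n D b c a = (\<lambda>p\<in>{..<Suc n} \<times> {..<Suc n}.
     if fst p < n then if snd p < n then D p else c (fst p) else if snd p < n then b (snd p) else a)"

lemma fun_mat_assemble: "fun_mat (Suc n) (assemble n D b c a) = border (fun_mat n D) b c a"
  by (rule eq_matI) (auto simp: assemble_def border_index[where n = n] border_def)

lemma measurable_assemble:
  assumes D: "\<And>p. p \<in> {..<n} \<times> {..<n} \<Longrightarrow> (\<lambda>x. D x p) \<in> borel_measurable M"
    and b: "\<And>j. j < n \<Longrightarrow> (\<lambda>x. b x j) \<in> borel_measurable M" and c: "\<And>j. j < n \<Longrightarrow> (\<lambda>x. c x j) \<in> borel_measurable M"
    and a: "a \<in> borel_measurable M"
  shows "(\<lambda>x. assemble n (D x) (b x) (c x) (a x)) \<in> M \<rightarrow>\<^sub>M cmat (Suc n)"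
  unfolding assemble_def
proof (rule measurable_restrict)
  fix p :: "nat \<times> nat" assume "p \<in> {..<Suc n} \<times> {..<Suc n}"
  thus "(\<lambda>x. if fst p < n then if snd p < n then D x p else c x (fst p) else if snd p < n then b x (snd p) else a x) \<in> M \<rightarrow>\<^sub>M lborel"
    using D[of p] b c a by (cases "fst p < n"; cases "snd p < n") (auto simp: mem_Times_iff)
qed

text \<open>All entries except the corner: that entry is integrated innermost, being the variable
  exchanged for an eigenvalue.\<close>

abbreviation corner_space :: "nat \<Rightarrow> (((nat \<times> nat \<Rightarrow> complex) \<times> (nat \<Rightarrow> complex)) \<times> (nat \<Rightarrow> complex)) measure" where
  "corner_space n \<equiv> (cmat n \<Otimes>\<^sub>M cvec {..<n}) \<Otimes>\<^sub>M cvec {..<n}"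

lemma measurable_assemble_pair:
  "(\<lambda>(t, a). assemble n (fst (fst t)) (snd (fst t)) (snd t) a) \<in> corner_space n \<Otimes>\<^sub>M lborel \<rightarrow>\<^sub>M cmat (Suc n)"
  unfolding case_prod_beta'
proof (rule measurable_assemble)
  let ?M = "corner_space n \<Otimes>\<^sub>M (lborel :: complex measure)"
  have D: "(\<lambda>x. fst (fst (fst x))) \<in> ?M \<rightarrow>\<^sub>M cmat n" and b: "(\<lambda>x. snd (fst (fst x))) \<in> ?M \<rightarrow>\<^sub>M cvec {..<n}"
    and c: "(\<lambda>x. snd (fst x)) \<in> ?M \<rightarrow>\<^sub>M cvec {..<n}"
    by (rule measurable_compose[OF measurable_fst measurable_compose[OF measurable_fst measurable_fst]]
        measurable_compose[OF measurable_fst measurable_compose[OF measurable_fst measurable_snd]]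
        measurable_compose[OF measurable_fst measurable_snd])+
  show "(\<lambda>x. fst (fst (fst x)) p) \<in> borel_measurable ?M" if "p \<in> {..<n} \<times> {..<n}" for p
    using measurable_compose[OF D measurable_component_singleton[OF that]] by simp
  show "(\<lambda>x. snd (fst (fst x)) j) \<in> borel_measurable ?M" "(\<lambda>x. snd (fst x) j) \<in> borel_measurable ?M" if "j < n" for j
    using measurable_compose[OF b measurable_component_singleton, of j] measurable_compose[OF c measurable_component_singleton, of j] that by simp_all
  show "snd \<in> borel_measurable ?M" using measurable_snd[of "corner_space n" "lborel :: complex measure"] by simp
qed

lemma distr_assemble:
  "distr (((cmat n \<Otimes>\<^sub>M cvec {..<n}) \<Otimes>\<^sub>M cvec {..<n}) \<Otimes>\<^sub>M lborel) (cmat (Suc n))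
     (\<lambda>(((D, b), c), a). assemble n D b c a) = cmat (Suc n)"
proof (rule clborel.PiM_eqI)
  interpret b: sigma_finite_measure "cvec {..<n}" by (rule sigma_finite_cvec) simp
  let ?M = "((cmat n \<Otimes>\<^sub>M cvec {..<n}) \<Otimes>\<^sub>M cvec {..<n}) \<Otimes>\<^sub>M (lborel :: complex measure)"
  have meas: "(\<lambda>(((D, b), c), a). assemble n D b c a) \<in> ?M \<rightarrow>\<^sub>M cmat (Suc n)"
    using measurable_assemble_pair[of n] by (simp add: case_prod_beta')
  fix A :: "nat \<times> nat \<Rightarrow> complex set" assume A: "\<And>p. p \<in> {..<Suc n} \<times> {..<Suc n} \<Longrightarrow> A p \<in> sets lborel"
  let ?D = "Pi\<^sub>E ({..<n} \<times> {..<n}) A" and ?b = "Pi\<^sub>E {..<n} (\<lambda>j. A (n, j))" and ?c = "Pi\<^sub>E {..<n} (\<lambda>i. A (i, n))"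
  have sD: "?D \<in> sets (cmat n)" and sb: "?b \<in> sets (cvec {..<n})" and sc: "?c \<in> sets (cvec {..<n})" and sa: "A (n,n) \<in> sets lborel"
    using A by (auto intro!: sets_PiM_I_finite)
  have "(\<lambda>(((D, b), c), a). assemble n D b c a) -` (Pi\<^sub>E ({..<Suc n} \<times> {..<Suc n}) A) \<inter> space ?M = ((?D \<times> ?b) \<times> ?c) \<times> A (n,n)"
  proof -
    have key: "assemble n D b c a \<in> Pi\<^sub>E ({..<Suc n} \<times> {..<Suc n}) A \<longleftrightarrow>
      (\<forall>p\<in>{..<n} \<times> {..<n}. D p \<in> A p) \<and> (\<forall>j<n. b j \<in> A (n,j)) \<and> (\<forall>i<n. c i \<in> A (i,n)) \<and> a \<in> A (n,n)" for D b c a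
    proof -
      have conv: "(\<forall>p\<in>{..<m} \<times> {..<m}. Q p) \<longleftrightarrow> (\<forall>i<m. \<forall>j<m. Q (i,j))" for m :: nat and Q by auto
      show ?thesis unfolding assemble_def restrict_PiE_iff conv by (auto simp: All_less_Suc)
    qed
    have sp: "x \<in> Pi\<^sub>E I B \<longleftrightarrow> x \<in> space (cvec I) \<and> (\<forall>i\<in>I. x i \<in> B i)"
        "z \<in> Pi\<^sub>E K C \<longleftrightarrow> z \<in> space (cvec K) \<and> (\<forall>i\<in>K. z i \<in> C i)"
      for x and I :: "nat set" and B and z and K :: "(nat \<times> nat) set" and C
      by (auto simp: space_PiM PiE_iff)
    show ?thesis
    proof (rule Set.set_eqI)
      fix x :: "(((nat \<times> nat \<Rightarrow> complex) \<times> (nat \<Rightarrow> complex)) \<times> (nat \<Rightarrow> complex)) \<times> complex"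
      obtain D b c a where x: "x = (((D, b), c), a)" by (metis surj_pair)
      have "x \<in> (\<lambda>(((D, b), c), a). assemble n D b c a) -` (Pi\<^sub>E ({..<Suc n} \<times> {..<Suc n}) A) \<inter> space ?M \<longleftrightarrow>
          assemble n D b c a \<in> Pi\<^sub>E ({..<Suc n} \<times> {..<Suc n}) A \<and> D \<in> space (cmat n) \<and> b \<in> space (cvec {..<n}) \<and> c \<in> space (cvec {..<n})"
        by (simp add: x space_pair_measure)
      also have "\<dots> \<longleftrightarrow> x \<in> ((?D \<times> ?b) \<times> ?c) \<times> A (n,n)"
        unfolding key unfolding x mem_Times_iff fst_conv snd_conv sp by auto
      finally show "x \<in> (\<lambda>(((D, b), c), a). assemble n D b c a) -` (Pi\<^sub>E ({..<Suc n} \<times> {..<Suc n}) A) \<inter> space ?M \<longleftrightarrow>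
          x \<in> ((?D \<times> ?b) \<times> ?c) \<times> A (n,n)" .
    qed
  qed
  hence "emeasure (distr ?M (cmat (Suc n)) (\<lambda>(((D, b), c), a). assemble n D b c a)) (Pi\<^sub>E ({..<Suc n} \<times> {..<Suc n}) A)
     = emeasure ?M (((?D \<times> ?b) \<times> ?c) \<times> A (n,n))"
    using A by (subst emeasure_distr[OF meas]) (auto intro!: sets_PiM_I_finite)
  also have "\<dots> = emeasure (cmat n) ?D * emeasure (cvec {..<n}) ?b * emeasure (cvec {..<n}) ?c * emeasure lborel (A (n,n))"
    using sD sb sc sa
    by (subst lborel.emeasure_pair_measure_Times, simp, simp, subst b.emeasure_pair_measure_Times, simp, simp, subst b.emeasure_pair_measure_Times) simp_all
  also have "emeasure (cmat n) ?D = (\<Prod>p\<in>{..<n} \<times> {..<n}. emeasure lborel (A p))"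
    using A by (intro clborel.emeasure_PiM) auto
  also have "emeasure (cvec {..<n}) ?b = (\<Prod>j<n. emeasure lborel (A (n,j)))"
    using A by (intro clborel.emeasure_PiM) auto
  also have "emeasure (cvec {..<n}) ?c = (\<Prod>i<n. emeasure lborel (A (i,n)))"
    using A by (intro clborel.emeasure_PiM) auto
  also have "(\<Prod>p\<in>{..<n} \<times> {..<n}. emeasure lborel (A p)) * (\<Prod>j<n. emeasure lborel (A (n,j))) * (\<Prod>i<n. emeasure lborel (A (i,n))) * emeasure lborel (A (n,n))
      = (\<Prod>p\<in>{..<Suc n} \<times> {..<Suc n}. emeasure lborel (A p))"
  proof -
    have "(\<Prod>p\<in>{..<m} \<times> {..<m}. h p) = (\<Prod>i<m. \<Prod>j<m. h (i,j))" for m :: nat and h :: "nat \<times> nat \<Rightarrow> ennreal"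
      by (simp add: prod.cartesian_product)
    thus ?thesis by (simp add: prod.distrib mult_ac)
  qed
  finally show "emeasure (distr ?M (cmat (Suc n)) (\<lambda>(((D, b), c), a). assemble n D b c a)) (Pi\<^sub>E ({..<Suc n} \<times> {..<Suc n}) A)
     = (\<Prod>p\<in>{..<Suc n} \<times> {..<Suc n}. emeasure lborel (A p))" .
qed simp_all

lemma sigma_finite_corner:
  "sigma_finite_measure (cmat n \<Otimes>\<^sub>M cvec {..<n})" "sigma_finite_measure (corner_space n)"
proof -
  interpret D: sigma_finite_measure "cmat n" by (rule sigma_finite_cvec) simp
  interpret b: sigma_finite_measure "cvec {..<n}" by (rule sigma_finite_cvec) simp
  interpret Db: pair_sigma_finite "cmat n" "cvec {..<n}" by standard
  show "sigma_finite_measure (cmat n \<Otimes>\<^sub>M cvec {..<n})" by (rule Db.sigma_finite_measure_axioms)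
  interpret X: sigma_finite_measure "cmat n \<Otimes>\<^sub>M cvec {..<n}" by (rule Db.sigma_finite_measure_axioms)
  interpret Dbc: pair_sigma_finite "cmat n \<Otimes>\<^sub>M cvec {..<n}" "cvec {..<n}" by standard
  show "sigma_finite_measure (corner_space n)" by (rule Dbc.sigma_finite_measure_axioms)
qed

lemma nn_integral_cmat_Suc:
  assumes f: "f \<in> borel_measurable (cmat (Suc n))"
  shows "(\<integral>\<^sup>+G. f G \<partial>cmat (Suc n)) = (\<integral>\<^sup>+t. (\<integral>\<^sup>+a. f (assemble n (fst (fst t)) (snd (fst t)) (snd t) a) \<partial>lborel) \<partial>corner_space n)"
proof -
  let ?h = "\<lambda>p. assemble n (fst (fst (fst p))) (snd (fst (fst p))) (snd (fst p)) (snd p)"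
  have m: "?h \<in> corner_space n \<Otimes>\<^sub>M lborel \<rightarrow>\<^sub>M cmat (Suc n)"
    using measurable_assemble_pair[of n] by (simp add: case_prod_beta')
  have "(\<integral>\<^sup>+G. f G \<partial>cmat (Suc n)) = (\<integral>\<^sup>+G. f G \<partial>distr (corner_space n \<Otimes>\<^sub>M lborel) (cmat (Suc n)) ?h)"
    using distr_assemble[of n] by (simp add: case_prod_beta')
  also have "\<dots> = (\<integral>\<^sup>+p. f (?h p) \<partial>(corner_space n \<Otimes>\<^sub>M lborel))"
    using f by (intro nn_integral_distr[OF m]) simp
  also have "\<dots> = (\<integral>\<^sup>+t. (\<integral>\<^sup>+a. f (?h (t, a)) \<partial>lborel) \<partial>corner_space n)"
    by (rule lborel.nn_integral_fst[symmetric, OF measurable_compose[OF m f]])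
  finally show ?thesis by simp
qed

lemma spectral_product_measurable:
  assumes F: "spectral_product F w" and h: "\<And>i j. i < n \<Longrightarrow> j < n \<Longrightarrow> (\<lambda>x. h x (i,j)) \<in> borel_measurable M"
  shows "(\<lambda>x. F (fun_mat n (h x))) \<in> borel_measurable M"
proof -
  have 1: "(\<lambda>x. \<lambda>p\<in>{..<n} \<times> {..<n}. h x p) \<in> M \<rightarrow>\<^sub>M cmat n"
    using h by (intro measurable_restrict) auto
  have 2: "(\<lambda>G. F (fun_mat n G)) \<in> borel_measurable (cmat n)" using F unfolding spectral_product_def by blast
  have "fun_mat n (\<lambda>p\<in>{..<n} \<times> {..<n}. h x p) = fun_mat n (h x)" for x by (rule eq_matI) auto
  thus ?thesis using measurable_compose[OF 1 2] by simp
qed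

lemma fro_measurable:
  assumes h: "\<And>i j. i < n \<Longrightarrow> j < n \<Longrightarrow> (\<lambda>x. h x (i,j)) \<in> borel_measurable M"
  shows "(\<lambda>x. fro (fun_mat n (h x))) \<in> borel_measurable M"
  using h by (simp add: fro_def borel_measurable_sum)

section \<open>Gaussian means and the corner entry as a function of an eigenvalue\<close>

definition gauss_weight :: "(complex mat \<Rightarrow> ennreal) \<Rightarrow> complex mat \<Rightarrow> ennreal" where
  "gauss_weight F A = ennreal (exp (- fro A)) * F A"

text \<open>Not normalized: the power of pi in the Ginibre density enters only when the moment is
  evaluated.\<close>

definition gauss_mean :: "(complex mat \<Rightarrow> ennreal) \<Rightarrow> nat \<Rightarrow> ennreal" where
  "gauss_mean F n = (\<integral>\<^sup>+G. gauss_weight F (fun_mat n G) \<partial>cmat n)"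

lemma gauss_weight_measurable:
  assumes F: "spectral_product F w" and h: "\<And>i j. i < n \<Longrightarrow> j < n \<Longrightarrow> (\<lambda>x. h x (i,j)) \<in> borel_measurable M"
  shows "(\<lambda>x. gauss_weight F (fun_mat n (h x))) \<in> borel_measurable M"
  unfolding gauss_weight_def
  using spectral_product_measurable[where h = h, OF F h] fro_measurable[where h = h, OF h] by measurable

lemma border_fun_mat:
  "border (fun_mat n D) b c a = fun_mat (Suc n) (\<lambda>p. if fst p < n then if snd p < n then D p else c (fst p) else if snd p < n then b (snd p) else a)"
  by (rule eq_matI) (auto simp: border_index[where n = n] border_def)

text \<open>The derivative of the corner entry in the eigenvalue, written as a sequential limit of
  difference quotients so that joint measurability in all arguments is immediate.\<close>

definition eig_jac :: "complex mat \<Rightarrow> (nat \<Rightarrow> complex) \<Rightarrow> (nat \<Rightarrow> complex) \<Rightarrow> complex \<Rightarrow> complex" where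
  "eig_jac D b c x = lim (\<lambda>m. (corner_of_eigenvalue D b c (x + 1 / of_nat (Suc m)) - corner_of_eigenvalue D b c x) * of_nat (Suc m))"

lemma eig_jac_eqI:
  assumes "(corner_of_eigenvalue D b c has_field_derivative d) (at x)"
  shows "eig_jac D b c x = d"
  unfolding eig_jac_def
proof (rule limI)
  have "((\<lambda>h. (corner_of_eigenvalue D b c (x + h) - corner_of_eigenvalue D b c x) / h) \<longlongrightarrow> d) (at 0)"
    using assms by (simp add: DERIV_def)
  moreover have "filterlim (\<lambda>m. 1 / of_nat (Suc m) :: complex) (at 0) sequentially"
    unfolding filterlim_at
    by (auto intro!: LIMSEQ_Suc[OF lim_const_over_n] simp del: of_nat_Suc)
  ultimately have "(\<lambda>m. (corner_of_eigenvalue D b c (x + 1 / of_nat (Suc m)) - corner_of_eigenvalue D b c x) / (1 / of_nat (Suc m))) \<longlonglongrightarrow> d"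
    by (rule filterlim_compose)
  thus "(\<lambda>m. (corner_of_eigenvalue D b c (x + 1 / of_nat (Suc m)) - corner_of_eigenvalue D b c x) * of_nat (Suc m)) \<longlonglongrightarrow> d"
    by (simp del: of_nat_Suc)
qed

lemma corner_of_eigenvalue_deriv:
  assumes p: "poly (char_poly D) x \<noteq> 0"
  shows "(corner_of_eigenvalue D b c has_field_derivative eig_jac D b c x) (at x)"
proof -
  have "\<exists>d. (corner_of_eigenvalue D b c has_field_derivative d) (at x)"
    unfolding corner_of_eigenvalue_def by (rule exI, rule DERIV_divide[OF poly_DERIV poly_DERIV p])
  thus ?thesis using eig_jac_eqI by blast
qed

lemma corner_of_eigenvalue_measurable:
  assumes D: "\<And>i j. i < n \<Longrightarrow> j < n \<Longrightarrow> (\<lambda>x. D x (i,j)) \<in> borel_measurable M"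
    and b: "\<And>j. j < n \<Longrightarrow> (\<lambda>x. b x j) \<in> borel_measurable M" and c: "\<And>j. j < n \<Longrightarrow> (\<lambda>x. c x j) \<in> borel_measurable M"
    and l: "l \<in> borel_measurable M"
  shows "(\<lambda>x. corner_of_eigenvalue (fun_mat n (D x)) (b x) (c x) (l x)) \<in> borel_measurable M"
    and "(\<lambda>x. eig_jac (fun_mat n (D x)) (b x) (c x) (l x)) \<in> borel_measurable M"
proof -
  have 1: "(\<lambda>x. corner_of_eigenvalue (fun_mat n (D x)) (b x) (c x) (l x)) \<in> borel_measurable M" if l: "l \<in> borel_measurable M" for l
    unfolding corner_of_eigenvalue_def border_fun_mat
  proof (intro borel_measurable_divide measurable_char_poly D l)
    fix i j assume "i < Suc n" "j < Suc n"
    thus "(\<lambda>x. if fst (i, j) < n then if snd (i, j) < n then D x (i, j) else c x (fst (i, j))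
               else if snd (i, j) < n then b x (snd (i, j)) else 0) \<in> borel_measurable M"
      using D b c by (cases "i < n"; cases "j < n") auto
  qed
  show "(\<lambda>x. corner_of_eigenvalue (fun_mat n (D x)) (b x) (c x) (l x)) \<in> borel_measurable M" by (rule 1[OF l])
  show "(\<lambda>x. eig_jac (fun_mat n (D x)) (b x) (c x) (l x)) \<in> borel_measurable M"
    unfolding eig_jac_def
    by (intro borel_measurable_lim_metric borel_measurable_times borel_measurable_diff 1 borel_measurable_add l borel_measurable_const)
qed

text \<open>A point of the fibre over \<open>a\<close> is a root of the characteristic polynomial
  with corner entry \<open>a\<close>, which has degree n + 1. The eigenvalues of \<open>D\<close>
  are excluded as possible poles.\<close>

lemma eigenvalue_count:
  assumes D: "D \<in> carrier_mat n n"
    and meas: "corner_of_eigenvalue D b c \<in> borel_measurable borel" "eig_jac D b c \<in> borel_measurable borel"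
  obtains cnt :: "complex \<Rightarrow> ennreal" where "cnt \<in> borel_measurable borel" "\<And>a. cnt a \<le> of_nat (Suc n)"
    "\<And>g. g \<in> borel_measurable borel \<Longrightarrow>
      (\<integral>\<^sup>+x. indicator {x. poly (char_poly D) x \<noteq> 0} x * (g (corner_of_eigenvalue D b c x) * ennreal ((cmod (eig_jac D b c x))\<^sup>2)) \<partial>lborel)
      = (\<integral>\<^sup>+a. g a * cnt a \<partial>lborel)"
proof (rule holomorphic_area_formula[OF _ _ meas(2,1)])
  show "open {x. poly (char_poly D) x \<noteq> 0}" by (intro open_Collect_neq continuous_intros)
  show "\<And>x. x \<in> {x. poly (char_poly D) x \<noteq> 0} \<Longrightarrow> (corner_of_eigenvalue D b c has_field_derivative eig_jac D b c x) (at x)"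
    by (rule corner_of_eigenvalue_deriv) simp
  fix a
  let ?q = "char_poly (border D b c a)"
  have deg: "degree ?q = Suc n" using degree_monic_char_poly[OF border_carrier[OF D]] by blast
  hence q0: "?q \<noteq> 0" by auto
  have sub: "{x \<in> {x. poly (char_poly D) x \<noteq> 0}. corner_of_eigenvalue D b c x = a} \<subseteq> {x. poly ?q x = 0}"
    using poly_char_poly_border_eq[OF D] by auto
  show "finite {x \<in> {x. poly (char_poly D) x \<noteq> 0}. corner_of_eigenvalue D b c x = a}"
    using finite_subset[OF sub poly_roots_finite[OF q0]] .
  have "card {x. poly ?q x = 0} \<le> Suc n" using card_poly_roots_bound[OF q0] deg by simp
  thus "card {x \<in> {x. poly (char_poly D) x \<noteq> 0}. corner_of_eigenvalue D b c x = a} \<le> Suc n"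
    using card_mono[OF poly_roots_finite[OF q0] sub] by simp
qed (use that in blast)

section \<open>Gaussian integrals and the volume of the space of directions\<close>

lemma nn_integral_gauss_scaled:
  assumes s: "s > 0"
  shows "(\<integral>\<^sup>+z. ennreal (exp (- s * (cmod z)\<^sup>2)) \<partial>lborel) = ennreal (pi / s)"
proof -
  have "(\<integral>\<^sup>+z. ennreal (exp (- (cmod z)\<^sup>2)) \<partial>lborel) = (\<integral>\<^sup>+z. ennreal (cmod z powr (2 * 0) * exp (- (cmod z)\<^sup>2)) \<partial>lborel)"
  proof (rule nn_integral_cong_AE)
    have "AE z in lborel. z \<noteq> (0 :: complex)" by (rule AE_lborel_singleton)
    thus "AE z in lborel. ennreal (exp (- (cmod z)\<^sup>2)) = ennreal (cmod z powr (2 * 0) * exp (- (cmod z)\<^sup>2))"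
      by eventually_elim simp
  qed
  also have "\<dots> = ennreal pi" using nn_integral_cmod_powr_gauss[of 0] by simp
  finally have "ennreal pi = (\<integral>\<^sup>+z. ennreal (exp (- (cmod z)\<^sup>2)) \<partial>lborel)" ..
  also have "\<dots> = ennreal ((cmod (of_real (sqrt s)))\<^sup>2) * (\<integral>\<^sup>+z. ennreal (exp (- (cmod (of_real (sqrt s) * z))\<^sup>2)) \<partial>lborel)"
    by (rule nn_integral_complex_cmult) (use s in auto)
  also have "\<dots> = ennreal s * (\<integral>\<^sup>+z. ennreal (exp (- s * (cmod z)\<^sup>2)) \<partial>lborel)"
    using s by (simp add: norm_mult power_mult_distrib)
  finally have *: "ennreal pi = ennreal s * (\<integral>\<^sup>+z. ennreal (exp (- s * (cmod z)\<^sup>2)) \<partial>lborel)" .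
  have "ennreal (pi / s) = ennreal (1 / s) * ennreal pi" using s by (simp add: ennreal_mult[symmetric])
  also have "\<dots> = (ennreal (1 / s) * ennreal s) * (\<integral>\<^sup>+z. ennreal (exp (- s * (cmod z)\<^sup>2)) \<partial>lborel)"
    unfolding * by (simp add: mult.assoc)
  also have "ennreal (1 / s) * ennreal s = 1" using s by (simp add: ennreal_mult[symmetric])
  finally show ?thesis by simp
qed

lemma nn_integral_cvec_gauss:
  assumes s: "s > 0"
  shows "(\<integral>\<^sup>+b. ennreal (exp (- s * (\<Sum>j<n. (cmod (b j))\<^sup>2))) \<partial>cvec {..<n}) = ennreal ((pi / s) ^ n)"
proof -
  have "(\<integral>\<^sup>+b. ennreal (exp (- s * (\<Sum>j<n. (cmod (b j))\<^sup>2))) \<partial>cvec {..<n}) = (\<integral>\<^sup>+b. (\<Prod>j<n. ennreal (exp (- s * (cmod (b j))\<^sup>2))) \<partial>cvec {..<n})"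
    by (simp add: sum_distrib_left exp_sum prod_ennreal)
  also have "\<dots> = (\<Prod>j<n. \<integral>\<^sup>+z. ennreal (exp (- s * (cmod z)\<^sup>2)) \<partial>lborel)"
    by (rule clborel.product_nn_integral_prod) auto
  finally show ?thesis unfolding nn_integral_gauss_scaled[OF s] using s by (simp add: ennreal_power)
qed

text \<open>Writes a negative power of \<open>a\<close> as a mixture of exponentials, which makes
  Gaussian integrals available for negative powers of 1 + |y|^2.\<close>

lemma nn_integral_erlang:
  assumes a: "a > 0"
  shows "(\<integral>\<^sup>+s. ennreal (s ^ n * exp (- a * s) / fact n) * indicator {0..} s \<partial>lborel) = ennreal (1 / a ^ Suc n)"
proof -
  interpret prob_space "density lborel (erlang_density n a)" by (rule prob_space_erlang_density[OF a])
  have "1 = emeasure (density lborel (erlang_density n a)) UNIV" using emeasure_space_1 by simp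
  also have "\<dots> = (\<integral>\<^sup>+s. ennreal (erlang_density n a s) \<partial>lborel)"
    by (subst emeasure_density) auto
  also have "\<dots> = (\<integral>\<^sup>+s. ennreal (a ^ Suc n) * (ennreal (s ^ n * exp (- a * s) / fact n) * indicator {0..} s) \<partial>lborel)"
    using a by (intro nn_integral_cong) (auto simp: erlang_density_def indicator_def ennreal_mult[symmetric])
  also have "\<dots> = ennreal (a ^ Suc n) * (\<integral>\<^sup>+s. ennreal (s ^ n * exp (- a * s) / fact n) * indicator {0..} s \<partial>lborel)"
    by (rule nn_integral_cmult) auto
  finally have *: "ennreal (a ^ Suc n) * (\<integral>\<^sup>+s. ennreal (s ^ n * exp (- a * s) / fact n) * indicator {0..} s \<partial>lborel) = 1" ..
  have "(\<integral>\<^sup>+s. ennreal (s ^ n * exp (- a * s) / fact n) * indicator {0..} s \<partial>lborel)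
    = (ennreal (1 / a ^ Suc n) * ennreal (a ^ Suc n)) * (\<integral>\<^sup>+s. ennreal (s ^ n * exp (- a * s) / fact n) * indicator {0..} s \<partial>lborel)"
    using a by (subst ennreal_mult[symmetric]) auto
  also have "\<dots> = ennreal (1 / a ^ Suc n)" using * by (simp only: mult.assoc mult_1_right)
  finally show ?thesis .
qed

text \<open>The Fubini--Study volume of the space of directions, computed by mixing Gaussians.\<close>

lemma nn_integral_fubini_study:
  "(\<integral>\<^sup>+y. ennreal (1 / (1 + (\<Sum>k<n. (cmod (y k))\<^sup>2)) ^ Suc n) \<partial>cvec {..<n}) = ennreal (pi ^ n / fact n)"
proof -
  interpret C: sigma_finite_measure "cvec {..<n}" by (rule sigma_finite_cvec) simp
  interpret P: pair_sigma_finite "cvec {..<n}" "lborel :: real measure" by standard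
  let ?r = "\<lambda>y. (\<Sum>k<n. (cmod (y k))\<^sup>2)"
  have "(\<integral>\<^sup>+y. ennreal (1 / (1 + ?r y) ^ Suc n) \<partial>cvec {..<n})
     = (\<integral>\<^sup>+y. (\<integral>\<^sup>+s. ennreal (s ^ n * exp (- (1 + ?r y) * s) / fact n) * indicator {0..} s \<partial>lborel) \<partial>cvec {..<n})"
    by (intro nn_integral_cong nn_integral_erlang[symmetric]) (auto intro!: add_pos_nonneg sum_nonneg)
  also have "\<dots> = (\<integral>\<^sup>+s. (\<integral>\<^sup>+y. ennreal (s ^ n * exp (- (1 + ?r y) * s) / fact n) * indicator {0..} s \<partial>cvec {..<n}) \<partial>lborel)"
    by (rule P.Fubini'[symmetric]) measurable
  \<comment> \<open>Integrating out \<open>y\<close> gives (pi/s)^n, which cancels the factor s^n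
    and leaves a plain exponential in \<open>s\<close>.\<close>
  also have "\<dots> = (\<integral>\<^sup>+s. ennreal (pi ^ n) * (ennreal (s ^ 0 * exp (- 1 * s) / fact 0 / fact n) * indicator {0..} s) \<partial>lborel)"
  proof (rule nn_integral_cong_AE)
    have "AE s in lborel. s \<noteq> (0 :: real)" by (rule AE_lborel_singleton)
    thus "AE s in lborel. (\<integral>\<^sup>+y. ennreal (s ^ n * exp (- (1 + ?r y) * s) / fact n) * indicator {0..} s \<partial>cvec {..<n})
       = ennreal (pi ^ n) * (ennreal (s ^ 0 * exp (- 1 * s) / fact 0 / fact n) * indicator {0..} s)"
    proof eventually_elim
      case (elim s)
      show ?case
      proof (cases "s > 0")
        case True
        have "(\<integral>\<^sup>+y. ennreal (s ^ n * exp (- (1 + ?r y) * s) / fact n) * indicator {0..} s \<partial>cvec {..<n})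
            = (\<integral>\<^sup>+y. ennreal (s ^ n * exp (- s) / fact n) * ennreal (exp (- s * ?r y)) \<partial>cvec {..<n})"
          using True by (intro nn_integral_cong) (auto simp: ennreal_mult[symmetric] algebra_simps exp_add exp_diff exp_minus divide_inverse)
        also have "\<dots> = ennreal (s ^ n * exp (- s) / fact n) * ennreal ((pi / s) ^ n)"
          by (subst nn_integral_cmult) (simp_all add: nn_integral_cvec_gauss[OF True, simplified])
        also have "\<dots> = ennreal (pi ^ n) * (ennreal (s ^ 0 * exp (- 1 * s) / fact 0 / fact n) * indicator {0..} s)"
          using True by (simp add: ennreal_mult[symmetric] power_divide)
        finally show ?thesis .
      qed (use elim in auto)
    qed
  qed
  also have "\<dots> = ennreal (pi ^ n) * (\<integral>\<^sup>+s. ennreal (s ^ 0 * exp (- 1 * s) / fact 0 / fact n) * indicator {0..} s \<partial>lborel)"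
    by (rule nn_integral_cmult) measurable
  also have "(\<integral>\<^sup>+s. ennreal (s ^ 0 * exp (- 1 * s) / fact 0 / fact n) * indicator {0..} s \<partial>lborel)
     = (\<integral>\<^sup>+s. ennreal (1 / fact n) * (ennreal (s ^ 0 * exp (- 1 * s) / fact 0) * indicator {0..} s) \<partial>lborel)"
    by (intro nn_integral_cong) (auto simp: indicator_def ennreal_mult[symmetric])
  also have "\<dots> = ennreal (1 / fact n)"
    using nn_integral_erlang[of 1 0] by (subst nn_integral_cmult) auto
  finally show ?thesis by (simp add: ennreal_mult[symmetric])
qed

section \<open>Exchanging the last column for an eigenvector\<close>

lemma eig_border_fun_mat:
  "eig_border (fun_mat n D) b y l = border (fun_mat n D) b (\<lambda>i. l * y i - (\<Sum>k<n. (fun_mat n D) $$ (i,k) * y k)) (l - (\<Sum>k<n. b k * y k))"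
  by (simp add: eig_border_def Let_def)

lemma compress_fun_mat:
  "compress (fun_mat n D) b y = fun_mat n (\<lambda>p. D p - y (fst p) * b (snd p))"
  by (rule eq_matI) (auto simp: compress_def)

lemma eig_border_cong:
  assumes "\<And>j. j < n \<Longrightarrow> b j = b' j" "D \<in> carrier_mat n n"
  shows "eig_border D b y l = eig_border D b' y l" "compress D b y = compress D b' y"
proof -
  have "(\<Sum>k<n. b k * y k) = (\<Sum>k<n. b' k * y k)" using assms(1) by (intro sum.cong) auto
  thus "eig_border D b y l = eig_border D b' y l"
    unfolding eig_border_def Let_def using assms by (intro border_cong[where n = n]) auto
  show "compress D b y = compress D b' y"
    using assms by (auto simp: compress_def intro!: eq_matI)
qed

text \<open>Only the numerator of the corner derivative occurs: its denominator cancels against the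
  Jacobian of the map from \<open>y\<close> to the last column.\<close>

definition eig_density :: "(complex mat \<Rightarrow> ennreal) \<Rightarrow> nat \<Rightarrow> (nat \<times> nat \<Rightarrow> complex) \<Rightarrow> (nat \<Rightarrow> complex) \<Rightarrow> (nat \<Rightarrow> complex) \<Rightarrow> complex \<Rightarrow> ennreal" where
  "eig_density F n D b y l = gauss_weight F (eig_border (fun_mat n D) b y l) * ennreal ((cmod (poly (char_poly (compress (fun_mat n D) b y)) l))\<^sup>2)"

text \<open>Set to zero at the eigenvalues of \<open>D\<close>, in accordance with the open set used
  in the area formula.\<close>

definition corner_density :: "(complex mat \<Rightarrow> ennreal) \<Rightarrow> nat \<Rightarrow> (nat \<times> nat \<Rightarrow> complex) \<Rightarrow> (nat \<Rightarrow> complex) \<Rightarrow> (nat \<Rightarrow> complex) \<Rightarrow> complex \<Rightarrow> ennreal" where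
  "corner_density F n D b c l = (if poly (char_poly (fun_mat n D)) l = 0 then 0 else
     gauss_weight F (border (fun_mat n D) b c (corner_of_eigenvalue (fun_mat n D) b c l)) * ennreal ((cmod (eig_jac (fun_mat n D) b c l))\<^sup>2))"

lemma border_measurable_gauss_weight:
  assumes F: "spectral_product F w"
    and D: "\<And>i j. i < n \<Longrightarrow> j < n \<Longrightarrow> (\<lambda>x. D x (i,j)) \<in> borel_measurable M"
    and b: "\<And>j. j < n \<Longrightarrow> (\<lambda>x. b x j) \<in> borel_measurable M" and c: "\<And>j. j < n \<Longrightarrow> (\<lambda>x. c x j) \<in> borel_measurable M"
    and a: "a \<in> borel_measurable M"
  shows "(\<lambda>x. gauss_weight F (border (fun_mat n (D x)) (b x) (c x) (a x))) \<in> borel_measurable M"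
  unfolding border_fun_mat
proof (rule gauss_weight_measurable[OF F])
  fix i j assume "i < Suc n" "j < Suc n"
  thus "(\<lambda>x. if fst (i, j) < n then if snd (i, j) < n then D x (i, j) else c x (fst (i, j))
             else if snd (i, j) < n then b x (snd (i, j)) else a x) \<in> borel_measurable M"
    using D b c a by (cases "i < n"; cases "j < n") auto
qed

lemma density_measurable:
  assumes F: "spectral_product F w"
    and D: "\<And>i j. i < n \<Longrightarrow> j < n \<Longrightarrow> (\<lambda>x. D x (i,j)) \<in> borel_measurable M"
    and b: "\<And>j. j < n \<Longrightarrow> (\<lambda>x. b x j) \<in> borel_measurable M" and c: "\<And>j. j < n \<Longrightarrow> (\<lambda>x. c x j) \<in> borel_measurable M"
    and l [measurable]: "l \<in> borel_measurable M"
  shows "(\<lambda>x. eig_density F n (D x) (b x) (c x) (l x)) \<in> borel_measurable M"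
    and "(\<lambda>x. corner_density F n (D x) (b x) (c x) (l x)) \<in> borel_measurable M"
proof -
  have 1: "(\<lambda>x. gauss_weight F (eig_border (fun_mat n (D x)) (b x) (c x) (l x))) \<in> borel_measurable M"
    unfolding eig_border_fun_mat
  proof (rule border_measurable_gauss_weight[OF F])
    show "(\<lambda>x. l x * c x i - (\<Sum>k<n. fun_mat n (D x) $$ (i, k) * c x k)) \<in> borel_measurable M" if "i < n" for i
      using that by (intro borel_measurable_diff borel_measurable_times borel_measurable_sum l c) (auto intro: D c)
  qed (use D b c in \<open>auto intro!: borel_measurable_diff borel_measurable_sum borel_measurable_times\<close>)
  have 2: "(\<lambda>x. poly (char_poly (compress (fun_mat n (D x)) (b x) (c x))) (l x)) \<in> borel_measurable M"
    unfolding compress_fun_mat using D b c by (intro measurable_char_poly) auto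
  show "(\<lambda>x. eig_density F n (D x) (b x) (c x) (l x)) \<in> borel_measurable M"
    unfolding eig_density_def using 1 2 by measurable
  have 3: "(\<lambda>x. corner_of_eigenvalue (fun_mat n (D x)) (b x) (c x) (l x)) \<in> borel_measurable M"
     "(\<lambda>x. eig_jac (fun_mat n (D x)) (b x) (c x) (l x)) \<in> borel_measurable M"
    using corner_of_eigenvalue_measurable[where D = D and b = b and c = c and l = l, OF D b c l] by auto
  have 4: "(\<lambda>x. gauss_weight F (border (fun_mat n (D x)) (b x) (c x) (corner_of_eigenvalue (fun_mat n (D x)) (b x) (c x) (l x)))) \<in> borel_measurable M"
    using D b c 3(1) by (rule border_measurable_gauss_weight[OF F])
  have 5: "(\<lambda>x. poly (char_poly (fun_mat n (D x))) (l x)) \<in> borel_measurable M"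
    using D by (intro measurable_char_poly) auto
  show "(\<lambda>x. corner_density F n (D x) (b x) (c x) (l x)) \<in> borel_measurable M"
    unfolding corner_density_def using 3(2) 4 5 by measurable
qed

text \<open>The upper rows of the eigenvalue equation for (y, 1) read c = (l - D) y. This linear
  substitution has Jacobian |det(l - D)|^2, which is the squared modulus of the denominator of the
  corner derivative.\<close>

lemma nn_integral_corner_density:
  assumes F: "spectral_product F w" and p: "poly (char_poly (fun_mat n D)) l \<noteq> 0"
  shows "(\<integral>\<^sup>+c. corner_density F n D b c l \<partial>cvec {..<n}) = (\<integral>\<^sup>+y. eig_density F n D b y l \<partial>cvec {..<n})"
proof -
  define A where "A = mat n n (\<lambda>(i,j). (if i = j then l else 0) - fun_mat n D $$ (i,j))"
  have A: "A \<in> carrier_mat n n" by (simp add: A_def)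
  have detA: "Determinant.det A = poly (char_poly (fun_mat n D)) l"
    unfolding A_def by (rule poly_char_poly[symmetric]) simp
  have meas: "(\<lambda>c. corner_density F n D b c l) \<in> borel_measurable (cvec {..<n})"
    by (rule density_measurable(2)[OF F]) auto
  have meas2: "(\<lambda>c. corner_density F n D b (mat_apply n A c) l) \<in> borel_measurable (cvec {..<n})"
    using measurable_compose[OF measurable_mat_apply meas] by simp
  have "(\<integral>\<^sup>+c. corner_density F n D b c l \<partial>cvec {..<n})
      = ennreal ((cmod (Determinant.det A))\<^sup>2) * (\<integral>\<^sup>+y. corner_density F n D b (mat_apply n A y) l \<partial>cvec {..<n})"
    by (rule nn_integral_mat_apply[OF A _ meas]) (simp add: detA p)
  also have "\<dots> = (\<integral>\<^sup>+y. ennreal ((cmod (Determinant.det A))\<^sup>2) * corner_density F n D b (mat_apply n A y) l \<partial>cvec {..<n})"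
    by (rule nn_integral_cmult[symmetric, OF meas2])
  also have "\<dots> = (\<integral>\<^sup>+y. eig_density F n D b y l \<partial>cvec {..<n})"
  proof (rule nn_integral_cong)
    fix y
    have c: "mat_apply n A y i = l * y i - (\<Sum>k<n. fun_mat n D $$ (i,k) * y k)" if "i < n" for i
    proof -
      have "mat_apply n A y i = (\<Sum>k<n. (if i = k then l * y k else 0) - fun_mat n D $$ (i,k) * y k)"
        using that unfolding mat_apply_def A_def by (auto simp: algebra_simps intro!: sum.cong)
      thus ?thesis using that by (simp add: sum_subtractf)
    qed
    note * = eig_border_eq_border[where n = n and D = "fun_mat n D" and b = b and c = "mat_apply n A y" and y = y and l = l, OF _ p c]
    have j: "eig_jac (fun_mat n D) b (mat_apply n A y) l = poly (char_poly (compress (fun_mat n D) b y)) l / poly (char_poly (fun_mat n D)) l"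
      by (rule eig_jac_eqI, rule *(2)) auto
    have e: "border (fun_mat n D) b (mat_apply n A y) (corner_of_eigenvalue (fun_mat n D) b (mat_apply n A y) l) = eig_border (fun_mat n D) b y l"
      by (rule *(1)) auto
    have "ennreal ((cmod (Determinant.det A))\<^sup>2) * corner_density F n D b (mat_apply n A y) l
       = gauss_weight F (eig_border (fun_mat n D) b y l) * (ennreal ((cmod (Determinant.det A))\<^sup>2) * ennreal ((cmod (poly (char_poly (compress (fun_mat n D) b y)) l / poly (char_poly (fun_mat n D)) l))\<^sup>2))"
      using p unfolding corner_density_def e j by (simp add: mult_ac)
    also have "ennreal ((cmod (Determinant.det A))\<^sup>2) * ennreal ((cmod (poly (char_poly (compress (fun_mat n D) b y)) l / poly (char_poly (fun_mat n D)) l))\<^sup>2)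
       = ennreal ((cmod (poly (char_poly (compress (fun_mat n D) b y)) l))\<^sup>2)"
      unfolding detA using p by (simp add: ennreal_mult[symmetric] norm_divide power_divide)
    finally show "ennreal ((cmod (Determinant.det A))\<^sup>2) * corner_density F n D b (mat_apply n A y) l = eig_density F n D b y l"
      unfolding eig_density_def .
  qed
  finally show ?thesis .
qed

lemma cvec_component:
  "i \<in> I \<Longrightarrow> f \<in> M \<rightarrow>\<^sub>M cvec I \<Longrightarrow> (\<lambda>z. f z i) \<in> borel_measurable M"
  using measurable_compose[OF _ measurable_component_singleton[of i I "\<lambda>_. lborel :: complex measure"], of f M] by simp

lemma vec_component: "j < n \<Longrightarrow> f \<in> M \<rightarrow>\<^sub>M cvec {..<n} \<Longrightarrow> (\<lambda>z. f z j) \<in> borel_measurable M"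
  by (rule cvec_component) auto

lemma cmat_component: "i < n \<Longrightarrow> j < n \<Longrightarrow> f \<in> M \<rightarrow>\<^sub>M cmat n \<Longrightarrow> (\<lambda>z. f z (i,j)) \<in> borel_measurable M"
  by (rule cvec_component) auto

text \<open>The last column is moved inside so that the substitution can be made for fixed
  \<open>l\<close>, then the eigenvalue is moved outermost. The eigenvalues of \<open>D\<close>,
  where the substitution degenerates, form a finite and hence null set.\<close>

lemma nn_integral_corner_density_swap:
  assumes F: "spectral_product F w"
  shows "(\<lambda>t. \<integral>\<^sup>+l. corner_density F n (fst (fst t)) (snd (fst t)) (snd t) l \<partial>lborel) \<in> borel_measurable (corner_space n)"
    and "(\<integral>\<^sup>+t. (\<integral>\<^sup>+l. corner_density F n (fst (fst t)) (snd (fst t)) (snd t) l \<partial>lborel) \<partial>corner_space n)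
    = (\<integral>\<^sup>+l. (\<integral>\<^sup>+y. (\<integral>\<^sup>+x. eig_density F n (fst x) (snd x) y l \<partial>(cmat n \<Otimes>\<^sub>M cvec {..<n})) \<partial>cvec {..<n}) \<partial>lborel)"
proof -
  let ?X = "cmat n \<Otimes>\<^sub>M cvec {..<n}" and ?C = "cvec {..<n}" and ?L = "lborel :: complex measure"
  interpret X: sigma_finite_measure ?X by (rule sigma_finite_corner)
  interpret C: sigma_finite_measure ?C by (rule sigma_finite_cvec) simp
  interpret CL: pair_sigma_finite ?C ?L by standard
  interpret LC: pair_sigma_finite ?L ?C by standard
  interpret LCs: sigma_finite_measure "?L \<Otimes>\<^sub>M ?C" by (rule LC.sigma_finite_measure_axioms)
  interpret XLC: pair_sigma_finite ?X "?L \<Otimes>\<^sub>M ?C" by standard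
  have f1: "(\<lambda>x. fst (fst (fst x))) \<in> corner_space n \<Otimes>\<^sub>M ?L \<rightarrow>\<^sub>M cmat n"
    and f2: "(\<lambda>x. snd (fst (fst x))) \<in> corner_space n \<Otimes>\<^sub>M ?L \<rightarrow>\<^sub>M ?C"
    and f3: "(\<lambda>x. snd (fst x)) \<in> corner_space n \<Otimes>\<^sub>M ?L \<rightarrow>\<^sub>M ?C"
    and f4: "(\<lambda>x. fst (fst x)) \<in> ?X \<Otimes>\<^sub>M (?L \<Otimes>\<^sub>M ?C) \<rightarrow>\<^sub>M cmat n"
    and f5: "(\<lambda>x. snd (fst x)) \<in> ?X \<Otimes>\<^sub>M (?L \<Otimes>\<^sub>M ?C) \<rightarrow>\<^sub>M ?C"
    and f6: "(\<lambda>x. snd (snd x)) \<in> ?X \<Otimes>\<^sub>M (?L \<Otimes>\<^sub>M ?C) \<rightarrow>\<^sub>M ?C"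
    by (rule measurable_compose[OF measurable_fst measurable_compose[OF measurable_fst measurable_fst]]
        measurable_compose[OF measurable_fst measurable_compose[OF measurable_fst measurable_snd]]
        measurable_compose[OF measurable_fst measurable_snd] measurable_compose[OF measurable_fst measurable_fst]
        measurable_compose[OF measurable_snd measurable_snd])+
  have H1: "(\<lambda>(t, l). corner_density F n (fst (fst t)) (snd (fst t)) (snd t) l) \<in> borel_measurable (corner_space n \<Otimes>\<^sub>M ?L)"
    unfolding case_prod_beta'
    using density_measurable(2)[where D = "\<lambda>x. fst (fst (fst x))" and b = "\<lambda>x. snd (fst (fst x))" and c = "\<lambda>x. snd (fst x)" and l = snd
        and M = "corner_space n \<Otimes>\<^sub>M ?L", OF F cmat_component[OF _ _ f1] vec_component[OF _ f2] vec_component[OF _ f3]]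
    by simp
  have H2: "(\<lambda>(c, l). corner_density F n (fst x) (snd x) c l) \<in> borel_measurable (?C \<Otimes>\<^sub>M ?L)" for x
    unfolding case_prod_beta'
    using density_measurable(2)[where D = "\<lambda>_. fst x" and b = "\<lambda>_. snd x" and c = fst and l = snd
        and M = "?C \<Otimes>\<^sub>M ?L", OF F _ _ vec_component[OF _ measurable_fst]] by simp
  have H3: "(\<lambda>(x, z). eig_density F n (fst x) (snd x) (snd z) (fst z)) \<in> borel_measurable (?X \<Otimes>\<^sub>M (?L \<Otimes>\<^sub>M ?C))"
    unfolding case_prod_beta'
    using density_measurable(1)[where D = "\<lambda>x. fst (fst x)" and b = "\<lambda>x. snd (fst x)" and c = "\<lambda>x. snd (snd x)" and l = "\<lambda>x. fst (snd x)"
        and M = "?X \<Otimes>\<^sub>M (?L \<Otimes>\<^sub>M ?C)", OF F cmat_component[OF _ _ f4] vec_component[OF _ f5] vec_component[OF _ f6]]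
    by simp
  have H4: "(\<lambda>z. eig_density F n (fst x) (snd x) (snd z) (fst z)) \<in> borel_measurable (?L \<Otimes>\<^sub>M ?C)" for x
    using density_measurable(1)[where D = "\<lambda>_. fst x" and b = "\<lambda>_. snd x" and c = snd and l = fst
        and M = "?L \<Otimes>\<^sub>M ?C", OF F _ _ vec_component[OF _ measurable_snd]] by simp
  show meas: "(\<lambda>t. \<integral>\<^sup>+l. corner_density F n (fst (fst t)) (snd (fst t)) (snd t) l \<partial>lborel) \<in> borel_measurable (corner_space n)"
    using lborel.borel_measurable_nn_integral[OF H1] .
  have "(\<integral>\<^sup>+t. (\<integral>\<^sup>+l. corner_density F n (fst (fst t)) (snd (fst t)) (snd t) l \<partial>lborel) \<partial>corner_space n)
     = (\<integral>\<^sup>+x. (\<integral>\<^sup>+c. (\<integral>\<^sup>+l. corner_density F n (fst x) (snd x) c l \<partial>lborel) \<partial>?C) \<partial>?X)"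
    using C.nn_integral_fst[OF meas] by simp
  also have "\<dots> = (\<integral>\<^sup>+x. (\<integral>\<^sup>+l. (\<integral>\<^sup>+c. corner_density F n (fst x) (snd x) c l \<partial>?C) \<partial>lborel) \<partial>?X)"
    by (intro nn_integral_cong CL.Fubini'[symmetric] H2)
  also have "\<dots> = (\<integral>\<^sup>+x. (\<integral>\<^sup>+l. (\<integral>\<^sup>+y. eig_density F n (fst x) (snd x) y l \<partial>?C) \<partial>lborel) \<partial>?X)"
  proof (rule nn_integral_cong, rule nn_integral_cong_AE)
    fix x :: "(nat \<times> nat \<Rightarrow> complex) \<times> (nat \<Rightarrow> complex)"
    let ?p = "char_poly (fun_mat n (fst x))"
    have "?p \<noteq> 0" using degree_monic_char_poly[of "fun_mat n (fst x)" n] by (metis coeff_0 mat_carrier zero_neq_one)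
    hence "finite {l. poly ?p l = 0}" by (rule poly_roots_finite)
    hence "{l. poly ?p l = 0} \<in> null_sets lborel" by (rule finite_imp_null_set_lborel)
    hence "AE l in lborel. poly ?p l \<noteq> 0" using AE_not_in by fastforce
    thus "AE l in lborel. (\<integral>\<^sup>+c. corner_density F n (fst x) (snd x) c l \<partial>?C) = (\<integral>\<^sup>+y. eig_density F n (fst x) (snd x) y l \<partial>?C)"
      by eventually_elim (rule nn_integral_corner_density[OF F])
  qed
  also have "\<dots> = (\<integral>\<^sup>+x. (\<integral>\<^sup>+z. eig_density F n (fst x) (snd x) (snd z) (fst z) \<partial>(?L \<Otimes>\<^sub>M ?C)) \<partial>?X)"
    using C.nn_integral_fst[OF H4] by simp
  also have "\<dots> = (\<integral>\<^sup>+z. (\<integral>\<^sup>+x. eig_density F n (fst x) (snd x) (snd z) (fst z) \<partial>?X) \<partial>(?L \<Otimes>\<^sub>M ?C))"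
    by (rule XLC.Fubini'[symmetric, OF H3])
  also have "\<dots> = (\<integral>\<^sup>+l. (\<integral>\<^sup>+y. (\<integral>\<^sup>+x. eig_density F n (fst x) (snd x) y l \<partial>?X) \<partial>?C) \<partial>lborel)"
  proof -
    have "(\<lambda>(z, x). eig_density F n (fst x) (snd x) (snd z) (fst z)) \<in> borel_measurable ((?L \<Otimes>\<^sub>M ?C) \<Otimes>\<^sub>M ?X)"
      using measurable_compose[OF measurable_pair_swap' H3] by (simp add: case_prod_beta')
    from C.nn_integral_fst[OF X.borel_measurable_nn_integral[OF this]] show ?thesis by simp
  qed
  finally show "(\<integral>\<^sup>+t. (\<integral>\<^sup>+l. corner_density F n (fst (fst t)) (snd (fst t)) (snd t) l \<partial>lborel) \<partial>corner_space n)
    = (\<integral>\<^sup>+l. (\<integral>\<^sup>+y. (\<integral>\<^sup>+x. eig_density F n (fst x) (snd x) y l \<partial>?X) \<partial>?C) \<partial>lborel)" .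
qed

text \<open>For fixed \<open>y\<close> and \<open>l\<close> three substitutions bring the integrand
  to product form: a rank one shift of \<open>D\<close>, conjugation by \<open>V\<close> and
  \<open>W\<close>, and an affine map of the row \<open>b\<close>. Together they realize the unitary
  conjugation by \<open>U\<close>, after which the Gaussian weight splits. The row integrates to
  pi^n, and its Jacobian is the Fubini-Study density in \<open>y\<close>.\<close>

lemma nn_integral_eig_density:
  assumes F: "spectral_product F w"
  shows "(\<integral>\<^sup>+x. eig_density F n (fst x) (snd x) y l \<partial>(cmat n \<Otimes>\<^sub>M cvec {..<n}))
    = ennreal (pi ^ n) * ennreal (1 / (1 + (\<Sum>k<n. (cmod (y k))\<^sup>2)) ^ Suc n) * (w l * ennreal (exp (- (cmod l)\<^sup>2))
        * gauss_mean (\<lambda>A. F A * ennreal ((cmod (poly (char_poly A) l))\<^sup>2)) n)"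
proof -
  interpret uc: unitary_completion n y .
  let ?C = "cvec {..<n}"
  interpret D: sigma_finite_measure "cmat n" by (rule sigma_finite_cvec) simp
  interpret C: sigma_finite_measure ?C by (rule sigma_finite_cvec) simp
  interpret DC: pair_sigma_finite "cmat n" ?C by standard
  define F2 where "F2 = (\<lambda>A. F A * ennreal ((cmod (poly (char_poly A) l))\<^sup>2))"
  have F2: "spectral_product F2 (\<lambda>a. w a * ennreal ((cmod (l - a))\<^sup>2))"
    unfolding F2_def by (rule spectral_product_char_poly[OF F])
  \<comment> \<open>Adding the rank one matrix y b undoes the subtraction in
    \<open>compress\<close>, so the shifted block has compression \<open>G\<close>.\<close>
  define sh where "sh b G = (\<lambda>p\<in>{..<n} \<times> {..<n}. y (fst p) * b (snd p) + G p)" for b and G :: "nat \<times> nat \<Rightarrow> complex"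
  define E where "E G b = ennreal (exp (- fro (eig_border (fun_mat n (sh b G)) b y l))) * (w l * F2 (fun_mat n G))" for G b
  define cj where "cj G = mat_fun n (uc.V * fun_mat n G * uc.W)" for G
  have comp_sh: "compress (fun_mat n (sh b G)) b y = fun_mat n G" for b G
    unfolding compress_fun_mat by (rule eq_matI) (auto simp: sh_def)
  have dens: "eig_density F n (sh b G) b y l = E G b" for b G
    unfolding eig_density_def gauss_weight_def E_def F2_def
    by (simp add: spectral_product_eig_border[OF F, where n = n] comp_sh mult_ac)
  have E_meas: "(\<lambda>z. E (fst z) (snd z)) \<in> borel_measurable (cmat n \<Otimes>\<^sub>M ?C)"
    unfolding dens[symmetric]
  proof (rule density_measurable(1)[where D = "\<lambda>z. sh (snd z) (fst z)" and b = snd and c = "\<lambda>_. y" and l = "\<lambda>_. l", OF F])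
    show "(\<lambda>x. sh (snd x) (fst x) (i, j)) \<in> borel_measurable (cmat n \<Otimes>\<^sub>M ?C)" if "i < n" "j < n" for i j
      using that cmat_component[OF that measurable_fst] vec_component[OF that(2) measurable_snd]
      by (simp add: sh_def)
    show "(\<lambda>x. snd x j) \<in> borel_measurable (cmat n \<Otimes>\<^sub>M ?C)" if "j < n" for j
      by (rule vec_component[OF that measurable_snd])
  qed simp_all
  have cj_meas: "cj \<in> cmat n \<rightarrow>\<^sub>M cmat n"
    unfolding cj_def mat_fun_def
  proof (rule measurable_restrict)
    fix p :: "nat \<times> nat" assume p: "p \<in> {..<n} \<times> {..<n}"
    have "(uc.V * fun_mat n G * uc.W) $$ p = (\<Sum>k<n. (\<Sum>m<n. uc.V $$ (fst p, m) * G (m, k)) * uc.W $$ (k, snd p))" for G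
      using p carrier_matD[OF uc.carr(1)] carrier_matD[OF uc.carr(2)]
      by (cases p) (auto simp: scalar_prod_def atLeast0LessThan)
    moreover have "(\<lambda>G. \<Sum>k<n. (\<Sum>m<n. uc.V $$ (fst p, m) * G (m, k)) * uc.W $$ (k, snd p)) \<in> borel_measurable (cmat n)"
      using cmat_component[of _ n _ "\<lambda>G. G"] by (intro borel_measurable_sum borel_measurable_times borel_measurable_const) auto
    ultimately show "(\<lambda>G. (uc.V * fun_mat n G * uc.W) $$ p) \<in> cmat n \<rightarrow>\<^sub>M lborel" by simp
  qed
  have Ecj_meas: "(\<lambda>(G, b). E (cj G) b) \<in> borel_measurable (cmat n \<Otimes>\<^sub>M ?C)"
    using measurable_compose[OF measurable_Pair[OF measurable_compose[OF measurable_fst cj_meas] measurable_snd] E_meas]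
    by (simp add: case_prod_beta')
  have E1: "(\<lambda>G. E G b) \<in> borel_measurable (cmat n)" if "b \<in> space ?C" for b
    using measurable_compose[OF measurable_Pair2'[OF that] E_meas] by simp
  have E2: "(\<lambda>b. E G b) \<in> borel_measurable ?C" if "G \<in> space (cmat n)" for G
    using measurable_compose[OF measurable_Pair1'[OF that] E_meas] by simp
  have fun_cj: "fun_mat n (cj G) = uc.V * fun_mat n G * uc.W" for G
    using carrier_matD[OF uc.carr(1)] carrier_matD[OF uc.carr(2)] by (intro eq_matI) (auto simp: cj_def mat_fun_def)
  \<comment> \<open>\<open>B\<close> and \<open>s\<close> are the linear part and the constant part
    of \<open>last_row\<close> as an affine function of \<open>b\<close>.\<close>
  define B where "B = mat n n (\<lambda>(j,k). uc.W $$ (k,j) / of_real uc.\<sigma>)"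
  define s where "s G j = (\<Sum>k<n. - (\<Sum>m<n. cnj (y m) * G (m,k)) / of_real uc.\<sigma> * uc.W $$ (k,j)) + l * cnj (y j) / of_real (uc.\<sigma>\<^sup>2)" for G :: "nat \<times> nat \<Rightarrow> complex" and j
  \<comment> \<open>The scalar 1/\<sigma> in dimension n gives \<sigma>^(-n), and det W gives one
    more factor; squaring produces the exponent n + 1 of 1 + |y|^2.\<close>
  have detB: "(cmod (Determinant.det B))\<^sup>2 = 1 / (1 + (\<Sum>k<n. (cmod (y k))\<^sup>2)) ^ Suc n"
  proof -
    have "B = (1 / of_real uc.\<sigma>) \<cdot>\<^sub>m transpose_mat uc.W"
      using carrier_matD[OF uc.carr(1)] by (intro eq_matI) (auto simp: B_def)
    hence "cmod (Determinant.det B) = (1 / uc.\<sigma>) ^ n * (1 / uc.\<sigma>)"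
      using carrier_matD[OF uc.carr(1)] uc.cmod_det_W det_transpose[OF uc.carr(1)] uc.\<sigma>
      by (simp add: norm_mult norm_divide norm_power)
    hence "(cmod (Determinant.det B))\<^sup>2 = 1 / (uc.\<sigma>\<^sup>2) ^ Suc n"
      by (simp add: power_mult_distrib power_divide power2_eq_square flip: power_mult)
    moreover have "uc.\<sigma>\<^sup>2 = 1 + (\<Sum>k<n. (cmod (y k))\<^sup>2)"
      using uc.\<rho>(1) by (simp add: uc.\<sigma>_def uc.\<rho>_def)
    ultimately show ?thesis by simp
  qed
  have rowsh: "(\<lambda>j\<in>{..<n}. s G j + mat_apply n B b j) j = uc.last_row (fun_mat n G) l b j" if "j < n" for G b j
    using that by (simp add: s_def mat_apply_def B_def uc.last_row_def sum.distrib[symmetric] algebra_simps diff_divide_distrib)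
  have val: "E (cj G) (\<lambda>j\<in>{..<n}. s G j + mat_apply n B b j) = ennreal (exp (- (\<Sum>j<n. (cmod (b j))\<^sup>2))) *
      (ennreal (exp (- (cmod l)\<^sup>2)) * w l * gauss_weight F2 (fun_mat n G))" for G b
  proof -
    let ?b = "\<lambda>j\<in>{..<n}. s G j + mat_apply n B b j" and ?b' = "uc.last_row (fun_mat n G) l b"
    let ?D = "fun_mat n (sh ?b (cj G))"
    have c: "compress ?D ?b' y = uc.V * fun_mat n G * uc.W"
      using comp_sh[of ?b "cj G"] eig_border_cong(2)[of n ?b ?b' ?D y, OF rowsh] by (simp add: fun_cj)
    have "eig_border ?D ?b y l = eig_border ?D ?b' y l"
      by (rule eig_border_cong(1)[of n, OF rowsh]) auto
    hence "fro (eig_border ?D ?b y l) = fro (fun_mat n G) + (\<Sum>j<n. (cmod (b j))\<^sup>2) + (cmod l)\<^sup>2"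
      using uc.fro_eig_border[OF _ _ c] by simp
    hence e1: "ennreal (exp (- fro (eig_border ?D ?b y l))) = ennreal (exp (- (\<Sum>j<n. (cmod (b j))\<^sup>2))) * (ennreal (exp (- (cmod l)\<^sup>2)) * ennreal (exp (- fro (fun_mat n G))))"
      by (simp add: ennreal_mult[symmetric] exp_add[symmetric])
    have inv: "F2 (P * A * Q) = F2 A" if "A \<in> carrier_mat n n" "P \<in> carrier_mat n n" "Q \<in> carrier_mat n n" "P * Q = 1\<^sub>m n" for A P Q
      using F2 that unfolding spectral_product_def by blast
    have e2: "F2 (uc.V * fun_mat n G * uc.W) = F2 (fun_mat n G)" by (rule inv) (auto simp: uc.VW)
    show ?thesis
      unfolding E_def gauss_weight_def e1 fun_cj e2 by (simp only: mult_ac)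
  qed
  have "(\<integral>\<^sup>+x. eig_density F n (fst x) (snd x) y l \<partial>(cmat n \<Otimes>\<^sub>M ?C)) = (\<integral>\<^sup>+D. (\<integral>\<^sup>+b. eig_density F n D b y l \<partial>?C) \<partial>cmat n)"
  proof -
    have "(\<lambda>x. eig_density F n (fst x) (snd x) y l) \<in> borel_measurable (cmat n \<Otimes>\<^sub>M ?C)"
      using density_measurable(1)[where D = fst and b = snd and c = "\<lambda>_. y" and l = "\<lambda>_. l" and M = "cmat n \<Otimes>\<^sub>M ?C",
        OF F cmat_component[OF _ _ measurable_fst] vec_component[OF _ measurable_snd]] by simp
    from C.nn_integral_fst[OF this] show ?thesis by simp
  qed
  also have "\<dots> = (\<integral>\<^sup>+b. (\<integral>\<^sup>+D. eig_density F n D b y l \<partial>cmat n) \<partial>?C)"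
  proof (rule DC.Fubini'[symmetric])
    show "(\<lambda>(D, b). eig_density F n D b y l) \<in> borel_measurable (cmat n \<Otimes>\<^sub>M ?C)"
      unfolding case_prod_beta'
      using density_measurable(1)[where D = fst and b = snd and c = "\<lambda>_. y" and l = "\<lambda>_. l" and M = "cmat n \<Otimes>\<^sub>M ?C",
        OF F cmat_component[OF _ _ measurable_fst] vec_component[OF _ measurable_snd]] by simp
  qed
  also have "\<dots> = (\<integral>\<^sup>+b. (\<integral>\<^sup>+G. E G b \<partial>cmat n) \<partial>?C)"
  proof (rule nn_integral_cong)
    fix b assume "b \<in> space ?C"
    have idc: "(\<lambda>D. D (i,j)) \<in> borel_measurable (cmat n)" if "i < n" "j < n" for i j
      by (rule cmat_component[where n = n and f = "\<lambda>D. D", OF that]) simp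
    have "(\<lambda>D. eig_density F n D b y l) \<in> borel_measurable (cmat n)"
      using density_measurable(1)[where D = "\<lambda>D. D" and b = "\<lambda>_. b" and c = "\<lambda>_. y" and l = "\<lambda>_. l" and M = "cmat n",
        OF F idc] by simp
    from nn_integral_cvec_translate[OF _ this, of "\<lambda>p. y (fst p) * b (snd p)"]
    show "(\<integral>\<^sup>+D. eig_density F n D b y l \<partial>cmat n) = (\<integral>\<^sup>+G. E G b \<partial>cmat n)"
      unfolding dens[symmetric] sh_def by simp
  qed
  also have "\<dots> = (\<integral>\<^sup>+b. (\<integral>\<^sup>+G. E (cj G) b \<partial>cmat n) \<partial>?C)"
    unfolding cj_def by (intro nn_integral_cong nn_integral_similarity[symmetric] uc.VW uc.carr E1)
  also have "\<dots> = (\<integral>\<^sup>+G. (\<integral>\<^sup>+b. E (cj G) b \<partial>?C) \<partial>cmat n)"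
    by (rule DC.Fubini'[OF Ecj_meas])
  also have "\<dots> = (\<integral>\<^sup>+G. ennreal (1 / (1 + (\<Sum>k<n. (cmod (y k))\<^sup>2)) ^ Suc n) * (ennreal (pi ^ n) *
      (ennreal (exp (- (cmod l)\<^sup>2)) * w l * gauss_weight F2 (fun_mat n G))) \<partial>cmat n)"
  proof (rule nn_integral_cong)
    fix G assume "G \<in> space (cmat n)"
    hence m: "(\<lambda>b. E (cj G) b) \<in> borel_measurable ?C" by (intro E2) (rule measurable_space[OF cj_meas])
    have m2: "(\<lambda>b. E (cj G) (\<lambda>j\<in>{..<n}. s G j + b j)) \<in> borel_measurable ?C"
    proof -
      have "(\<lambda>b. \<lambda>j\<in>{..<n}. s G j + b j) \<in> ?C \<rightarrow>\<^sub>M ?C" by measurable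
      from measurable_compose[OF this m] show ?thesis .
    qed
    have "(\<integral>\<^sup>+b. E (cj G) b \<partial>?C) = (\<integral>\<^sup>+b. E (cj G) (\<lambda>j\<in>{..<n}. s G j + b j) \<partial>?C)"
      by (rule nn_integral_cvec_translate[symmetric, OF _ m]) simp
    also have "\<dots> = ennreal ((cmod (Determinant.det B))\<^sup>2) * (\<integral>\<^sup>+b. E (cj G) (\<lambda>j\<in>{..<n}. s G j + mat_apply n B b j) \<partial>?C)"
    proof (rule nn_integral_mat_apply[OF _ _ m2])
      have "(cmod (Determinant.det B))\<^sup>2 > 0" unfolding detB by (simp add: add_pos_nonneg sum_nonneg)
      thus "Determinant.det B \<noteq> 0" by auto
    qed (simp add: B_def)
    also have "(\<integral>\<^sup>+b. E (cj G) (\<lambda>j\<in>{..<n}. s G j + mat_apply n B b j) \<partial>?C)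
       = (\<integral>\<^sup>+b. ennreal (exp (- 1 * (\<Sum>j<n. (cmod (b j))\<^sup>2))) \<partial>?C) * (ennreal (exp (- (cmod l)\<^sup>2)) * w l * gauss_weight F2 (fun_mat n G))"
      unfolding val by (subst nn_integral_multc[symmetric]) auto
    also have "\<dots> = ennreal (pi ^ n) * (ennreal (exp (- (cmod l)\<^sup>2)) * w l * gauss_weight F2 (fun_mat n G))"
      by (subst nn_integral_cvec_gauss) auto
    finally show "(\<integral>\<^sup>+b. E (cj G) b \<partial>?C) = ennreal (1 / (1 + (\<Sum>k<n. (cmod (y k))\<^sup>2)) ^ Suc n) * (ennreal (pi ^ n) *
      (ennreal (exp (- (cmod l)\<^sup>2)) * w l * gauss_weight F2 (fun_mat n G)))"
      unfolding detB .
  qed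
  also have "\<dots> = (\<integral>\<^sup>+G. (ennreal (pi ^ n) * ennreal (1 / (1 + (\<Sum>k<n. (cmod (y k))\<^sup>2)) ^ Suc n) * (w l * ennreal (exp (- (cmod l)\<^sup>2)))) * gauss_weight F2 (fun_mat n G) \<partial>cmat n)"
    by (simp add: mult_ac)
  also have "\<dots> = (ennreal (pi ^ n) * ennreal (1 / (1 + (\<Sum>k<n. (cmod (y k))\<^sup>2)) ^ Suc n) * (w l * ennreal (exp (- (cmod l)\<^sup>2)))) * gauss_mean F2 n"
    unfolding gauss_mean_def
    using gauss_weight_measurable[OF F2, where h = "\<lambda>G. G" and n = n and M = "cmat n"] cmat_component[of _ n _ "\<lambda>G. G" "cmat n"]
    by (intro nn_integral_cmult) simp
  finally show ?thesis unfolding F2_def by (simp add: mult.assoc)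
qed

section \<open>Counting eigenvalues by total mass\<close>

lemma nn_integral_eq_AE:
  assumes [measurable]: "f \<in> borel_measurable M" "g \<in> borel_measurable M"
    and le: "AE x in M. f x \<le> g x" and eq: "(\<integral>\<^sup>+x. f x \<partial>M) = (\<integral>\<^sup>+x. g x \<partial>M)" and fin: "(\<integral>\<^sup>+x. g x \<partial>M) < \<infinity>"
  shows "AE x in M. f x = g x"
proof -
  have "(\<integral>\<^sup>+x. g x - f x \<partial>M) = (\<integral>\<^sup>+x. g x \<partial>M) - (\<integral>\<^sup>+x. f x \<partial>M)"
    using le eq fin by (intro nn_integral_diff) auto
  hence "(\<integral>\<^sup>+x. g x - f x \<partial>M) = 0" using eq fin by simp
  hence "AE x in M. g x - f x = 0" by (subst (asm) nn_integral_0_iff_AE) auto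
  moreover have "AE x in M. g x \<noteq> \<infinity>" using fin by (intro nn_integral_PInf_AE) auto
  ultimately show ?thesis using le
    by eventually_elim (metis diff_eq_0_iff_ennreal antisym top.not_eq_extremum infinity_ennreal_def)
qed

text \<open>One factor pi^n comes from the Gaussian row, and pi^n/n! is the volume of the space of
  directions. On the left each matrix is still counted with an unknown multiplicity of at most n +
  1.\<close>

lemma deflation:
  assumes F: "spectral_product F w"
  shows "(\<integral>\<^sup>+t. (\<integral>\<^sup>+l. corner_density F n (fst (fst t)) (snd (fst t)) (snd t) l \<partial>lborel) \<partial>corner_space n)
    = ennreal (pi ^ (2 * n) / fact n) * (\<integral>\<^sup>+l. w l * ennreal (exp (- (cmod l)\<^sup>2)) * gauss_mean (\<lambda>A. F A * ennreal ((cmod (poly (char_poly A) l))\<^sup>2)) n \<partial>lborel)"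
proof -
  let ?g = "\<lambda>l. w l * ennreal (exp (- (cmod l)\<^sup>2)) * gauss_mean (\<lambda>A. F A * ennreal ((cmod (poly (char_poly A) l))\<^sup>2)) n"
  interpret C: sigma_finite_measure "cmat n" by (rule sigma_finite_cvec) simp
  have [measurable]: "w \<in> borel_measurable borel" using F by (simp add: spectral_product_def)
  have "(\<lambda>(l, G). gauss_weight F (fun_mat n G) * ennreal ((cmod (poly (char_poly (fun_mat n G)) l))\<^sup>2)) \<in> borel_measurable (lborel \<Otimes>\<^sub>M cmat n)"
  proof -
    have "(\<lambda>z. gauss_weight F (fun_mat n (snd z))) \<in> borel_measurable ((lborel :: complex measure) \<Otimes>\<^sub>M cmat n)"
      by (rule gauss_weight_measurable[OF F]) (rule cmat_component[OF _ _ measurable_snd])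
    moreover have "(\<lambda>z. poly (char_poly (fun_mat n (snd z))) (fst z)) \<in> borel_measurable ((lborel :: complex measure) \<Otimes>\<^sub>M cmat n)"
      by (rule measurable_char_poly, rule cmat_component[OF _ _ measurable_snd]) auto
    ultimately show ?thesis unfolding case_prod_beta' by measurable
  qed
  from C.borel_measurable_nn_integral[OF this]
  have [measurable]: "(\<lambda>l. gauss_mean (\<lambda>A. F A * ennreal ((cmod (poly (char_poly A) l))\<^sup>2)) n) \<in> borel_measurable borel"
    by (simp add: gauss_mean_def gauss_weight_def mult.assoc)
  have "(\<integral>\<^sup>+t. (\<integral>\<^sup>+l. corner_density F n (fst (fst t)) (snd (fst t)) (snd t) l \<partial>lborel) \<partial>corner_space n)
     = (\<integral>\<^sup>+l. (\<integral>\<^sup>+y. (ennreal (pi ^ n) * ?g l) * ennreal (1 / (1 + (\<Sum>k<n. (cmod (y k))\<^sup>2)) ^ Suc n) \<partial>cvec {..<n}) \<partial>lborel)"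
    unfolding nn_integral_corner_density_swap(2)[OF F] nn_integral_eig_density[OF F] by (simp add: mult_ac)
  also have "\<dots> = (\<integral>\<^sup>+l. (ennreal (pi ^ n) * ?g l) * ennreal (pi ^ n / fact n) \<partial>lborel)"
    by (subst nn_integral_cmult, measurable) (simp only: nn_integral_fubini_study)
  also have "\<dots> = (\<integral>\<^sup>+l. ennreal (pi ^ (2 * n) / fact n) * ?g l \<partial>lborel)"
  proof (intro nn_integral_cong)
    fix l
    have "ennreal (pi ^ (2 * n) / fact n) = ennreal (pi ^ n) * ennreal (pi ^ n / fact n)"
      by (simp add: ennreal_mult[symmetric] mult_2 power_add)
    thus "(ennreal (pi ^ n) * ?g l) * ennreal (pi ^ n / fact n) = ennreal (pi ^ (2 * n) / fact n) * ?g l"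
      by (simp add: mult_ac)
  qed
  also have "\<dots> = ennreal (pi ^ (2 * n) / fact n) * (\<integral>\<^sup>+l. ?g l \<partial>lborel)"
    by (rule nn_integral_cmult) measurable
  finally show ?thesis .
qed

text \<open>The order of quantifiers matters: one \<open>cnt\<close> works for all functionals, so
  what is learned about it from F = 1 can be used for every other \<open>F\<close>.\<close>

lemma corner_density_count:
  "\<exists>cnt :: complex \<Rightarrow> ennreal. cnt \<in> borel_measurable borel \<and> (\<forall>a. cnt a \<le> of_nat (Suc n)) \<and>
    (\<forall>F w. spectral_product F w \<longrightarrow>
      (\<integral>\<^sup>+l. corner_density F n D b c l \<partial>lborel) = (\<integral>\<^sup>+a. gauss_weight F (border (fun_mat n D) b c a) * cnt a \<partial>lborel))"
proof -
  have m: "corner_of_eigenvalue (fun_mat n D) b c \<in> borel_measurable borel" "eig_jac (fun_mat n D) b c \<in> borel_measurable borel"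
    by (rule corner_of_eigenvalue_measurable[where D = "\<lambda>_. D" and b = "\<lambda>_. b" and c = "\<lambda>_. c" and l = "\<lambda>x. x" and M = borel and n = n]; simp)+
  show ?thesis
  proof (rule eigenvalue_count[OF mat_carrier m], intro exI conjI allI impI)
    fix cnt :: "complex \<Rightarrow> ennreal" and F w
    assume cnt: "\<And>g. g \<in> borel_measurable borel \<Longrightarrow>
      (\<integral>\<^sup>+x. indicator {x. poly (char_poly (fun_mat n D)) x \<noteq> 0} x * (g (corner_of_eigenvalue (fun_mat n D) b c x) * ennreal ((cmod (eig_jac (fun_mat n D) b c x))\<^sup>2)) \<partial>lborel)
      = (\<integral>\<^sup>+a. g a * cnt a \<partial>lborel)"
    assume F: "spectral_product F w"
    have g: "(\<lambda>a. gauss_weight F (border (fun_mat n D) b c a)) \<in> borel_measurable borel"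
      by (rule border_measurable_gauss_weight[where D = "\<lambda>_. D" and b = "\<lambda>_. b" and c = "\<lambda>_. c" and a = "\<lambda>x. x" and M = borel, OF F]) simp_all
    show "(\<integral>\<^sup>+l. corner_density F n D b c l \<partial>lborel) = (\<integral>\<^sup>+a. gauss_weight F (border (fun_mat n D) b c a) * cnt a \<partial>lborel)"
      unfolding cnt[OF g, symmetric] corner_density_def
      by (intro nn_integral_cong) (auto simp: indicator_def)
  qed assumption+
qed

lemma gauss_mean_Suc:
  assumes F: "spectral_product F w"
  shows "gauss_mean F (Suc n) = (\<integral>\<^sup>+t. (\<integral>\<^sup>+a. gauss_weight F (border (fun_mat n (fst (fst t))) (snd (fst t)) (snd t) a) \<partial>lborel) \<partial>corner_space n)"
    and "(\<lambda>t. \<integral>\<^sup>+a. gauss_weight F (border (fun_mat n (fst (fst t))) (snd (fst t)) (snd t) a) \<partial>lborel) \<in> borel_measurable (corner_space n)"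
proof -
  have m: "(\<lambda>G. gauss_weight F (fun_mat (Suc n) G)) \<in> borel_measurable (cmat (Suc n))"
    using gauss_weight_measurable[OF F, where h = "\<lambda>G. G" and n = "Suc n" and M = "cmat (Suc n)"] cmat_component[of _ "Suc n" _ "\<lambda>G. G" "cmat (Suc n)"] by simp
  show "gauss_mean F (Suc n) = (\<integral>\<^sup>+t. (\<integral>\<^sup>+a. gauss_weight F (border (fun_mat n (fst (fst t))) (snd (fst t)) (snd t) a) \<partial>lborel) \<partial>corner_space n)"
    unfolding gauss_mean_def nn_integral_cmat_Suc[OF m] fun_mat_assemble ..
  have "(\<lambda>(t, a). gauss_weight F (border (fun_mat n (fst (fst t))) (snd (fst t)) (snd t) a)) \<in> borel_measurable (corner_space n \<Otimes>\<^sub>M lborel)"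
    using measurable_compose[OF measurable_assemble_pair m] by (simp add: case_prod_beta' fun_mat_assemble)
  from lborel.borel_measurable_nn_integral[OF this]
  show "(\<lambda>t. \<integral>\<^sup>+a. gauss_weight F (border (fun_mat n (fst (fst t))) (snd (fst t)) (snd t) a) \<partial>lborel) \<in> borel_measurable (corner_space n)" .
qed

text \<open>For almost every choice of the remaining entries the corner entry determines exactly \<open>n + 1\<close> eigenvalues.
  Only the upper bound is proved pointwise; equality follows by comparing total masses.\<close>

lemma gauss_mean_deflation:
  assumes F: "spectral_product F w"
    and mass: "ennreal (pi ^ (2 * n) / fact n) * (\<integral>\<^sup>+l. ennreal (exp (- (cmod l)\<^sup>2)) * gauss_mean (\<lambda>A. ennreal ((cmod (poly (char_poly A) l))\<^sup>2)) n \<partial>lborel)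
       = of_nat (Suc n) * gauss_mean (\<lambda>_. 1) (Suc n)"
    and fin: "gauss_mean (\<lambda>_. 1) (Suc n) < \<infinity>"
  shows "of_nat (Suc n) * gauss_mean F (Suc n) = ennreal (pi ^ (2 * n) / fact n) * (\<integral>\<^sup>+l. w l * ennreal (exp (- (cmod l)\<^sup>2)) * gauss_mean (\<lambda>A. F A * ennreal ((cmod (poly (char_poly A) l))\<^sup>2)) n \<partial>lborel)"
proof -
  note one = spectral_product_one
  let ?B = "\<lambda>t a. border (fun_mat n (fst (fst t))) (snd (fst t)) (snd t) a"
  let ?H = "\<lambda>F t. \<integral>\<^sup>+l. corner_density F n (fst (fst t)) (snd (fst t)) (snd t) l \<partial>lborel"
  let ?G = "\<lambda>F t. \<integral>\<^sup>+a. gauss_weight F (?B t a) \<partial>lborel"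
  have wm: "(\<lambda>a. gauss_weight F (?B t a)) \<in> borel_measurable borel" if "spectral_product F w" for F w t
    by (rule border_measurable_gauss_weight[where D = "\<lambda>_. fst (fst t)" and b = "\<lambda>_. snd (fst t)" and c = "\<lambda>_. snd t" and a = "\<lambda>x. x" and M = borel, OF that]) simp_all
  have le: "?H (\<lambda>_. 1) t \<le> of_nat (Suc n) * ?G (\<lambda>_. 1) t" for t
  proof -
    obtain cnt :: "complex \<Rightarrow> ennreal" where cnt: "cnt \<in> borel_measurable borel" "\<And>a. cnt a \<le> of_nat (Suc n)"
      "\<And>F w. spectral_product F w \<Longrightarrow> ?H F t = (\<integral>\<^sup>+a. gauss_weight F (?B t a) * cnt a \<partial>lborel)"
      using corner_density_count[of n "fst (fst t)" "snd (fst t)" "snd t"] by blast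
    have "?H (\<lambda>_. 1) t \<le> (\<integral>\<^sup>+a. gauss_weight (\<lambda>_. 1) (?B t a) * of_nat (Suc n) \<partial>lborel)"
      unfolding cnt(3)[OF one] by (intro nn_integral_mono mult_left_mono cnt(2)) simp
    also have "\<dots> = of_nat (Suc n) * ?G (\<lambda>_. 1) t"
      using wm[OF one, of t] by (subst nn_integral_multc) (auto simp: mult.commute)
    finally show ?thesis .
  qed
  have "AE t in corner_space n. ?H (\<lambda>_. 1) t = of_nat (Suc n) * ?G (\<lambda>_. 1) t"
  proof (rule nn_integral_eq_AE)
    show "?H (\<lambda>_. 1) \<in> borel_measurable (corner_space n)" by (rule nn_integral_corner_density_swap(1)[OF one])
    show "(\<lambda>t. of_nat (Suc n) * ?G (\<lambda>_. 1) t) \<in> borel_measurable (corner_space n)"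
      using gauss_mean_Suc(2)[OF one, of n] by measurable
    have e: "(\<integral>\<^sup>+t. of_nat (Suc n) * ?G (\<lambda>_. 1) t \<partial>corner_space n) = of_nat (Suc n) * gauss_mean (\<lambda>_. 1) (Suc n)"
      unfolding gauss_mean_Suc(1)[OF one] by (rule nn_integral_cmult[OF gauss_mean_Suc(2)[OF one]])
    show "(\<integral>\<^sup>+t. ?H (\<lambda>_. 1) t \<partial>corner_space n) = (\<integral>\<^sup>+t. of_nat (Suc n) * ?G (\<lambda>_. 1) t \<partial>corner_space n)"
      unfolding e mass[symmetric] deflation[OF one] by simp
    show "(\<integral>\<^sup>+t. of_nat (Suc n) * ?G (\<lambda>_. 1) t \<partial>corner_space n) < \<infinity>"
      unfolding e using fin by (simp add: ennreal_mult_less_top of_nat_less_top del: of_nat_Suc)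
  qed (use le in simp)
  moreover have "AE t in corner_space n. ?G (\<lambda>_. 1) t \<noteq> \<infinity>"
    using fin unfolding gauss_mean_Suc(1)[OF one] by (intro nn_integral_PInf_AE gauss_mean_Suc(2)[OF one]) auto
  ultimately have "AE t in corner_space n. ?H F t = of_nat (Suc n) * ?G F t"
  proof eventually_elim
    case (elim t)
    obtain cnt :: "complex \<Rightarrow> ennreal" where cnt: "cnt \<in> borel_measurable borel" "\<And>a. cnt a \<le> of_nat (Suc n)"
      "\<And>F w. spectral_product F w \<Longrightarrow> ?H F t = (\<integral>\<^sup>+a. gauss_weight F (?B t a) * cnt a \<partial>lborel)"
      using corner_density_count[of n "fst (fst t)" "snd (fst t)" "snd t"] by blast
    note [measurable] = cnt(1) wm[OF one, of t] wm[OF F, of t]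
    have e: "(\<integral>\<^sup>+a. gauss_weight (\<lambda>_. 1) (?B t a) * of_nat (Suc n) \<partial>lborel) = of_nat (Suc n) * ?G (\<lambda>_. 1) t"
      by (subst nn_integral_multc) (auto simp: mult.commute)
    have "AE a in lborel. gauss_weight (\<lambda>_. 1) (?B t a) * cnt a = gauss_weight (\<lambda>_. 1) (?B t a) * of_nat (Suc n)"
    proof (rule nn_integral_eq_AE)
      show "(\<integral>\<^sup>+a. gauss_weight (\<lambda>_. 1) (?B t a) * cnt a \<partial>lborel) = (\<integral>\<^sup>+a. gauss_weight (\<lambda>_. 1) (?B t a) * of_nat (Suc n) \<partial>lborel)"
        unfolding e elim(1)[symmetric] cnt(3)[OF one] ..
      show "(\<integral>\<^sup>+a. gauss_weight (\<lambda>_. 1) (?B t a) * of_nat (Suc n) \<partial>lborel) < \<infinity>"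
        unfolding e using elim(2) by (simp add: ennreal_mult_less_top of_nat_less_top top.not_eq_extremum del: of_nat_Suc)
      show "AE a in lborel. gauss_weight (\<lambda>_. 1) (?B t a) * cnt a \<le> gauss_weight (\<lambda>_. 1) (?B t a) * of_nat (Suc n)"
        using cnt(2) by (intro AE_I2 mult_left_mono) auto
    qed measurable
    \<comment> \<open>For F = 1 the weight is a strictly positive Gaussian, so it can be cancelled
      and the count itself is identified.\<close>
    hence cn: "AE a in lborel. cnt a = of_nat (Suc n)"
    proof eventually_elim
      case (elim a)
      thus ?case by (simp add: gauss_weight_def ennreal_mult_cancel_left del: of_nat_Suc)
    qed
    have "?H F t = (\<integral>\<^sup>+a. gauss_weight F (?B t a) * of_nat (Suc n) \<partial>lborel)"
      unfolding cnt(3)[OF F]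
    proof (rule nn_integral_cong_AE)
      show "AE a in lborel. gauss_weight F (?B t a) * cnt a = gauss_weight F (?B t a) * of_nat (Suc n)"
        using cn by eventually_elim simp
    qed
    also have "\<dots> = of_nat (Suc n) * ?G F t"
      by (subst nn_integral_multc) (auto simp: mult.commute)
    finally show ?case .
  qed
  hence "(\<integral>\<^sup>+t. ?H F t \<partial>corner_space n) = (\<integral>\<^sup>+t. of_nat (Suc n) * ?G F t \<partial>corner_space n)"
    by (rule nn_integral_cong_AE)
  also have "\<dots> = of_nat (Suc n) * gauss_mean F (Suc n)"
    unfolding gauss_mean_Suc(1)[OF F] by (rule nn_integral_cmult[OF gauss_mean_Suc(2)[OF F]])
  finally show ?thesis unfolding deflation[OF F] ..
qed

section \<open>Reduction to the eigenvalues\<close>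

lemma measurable_cnj [measurable (raw)]: "f \<in> borel_measurable M \<Longrightarrow> (\<lambda>x. cnj (f x)) \<in> borel_measurable M"
  by (rule measurable_compose[of f M borel]) (auto intro: borel_measurable_continuous_onI continuous_intros)

definition vandermonde_sq :: "nat \<Rightarrow> (nat \<Rightarrow> complex) \<Rightarrow> real" where
  "vandermonde_sq n x = (\<Prod>j<n. \<Prod>i<j. (cmod (x j - x i))\<^sup>2)"

lemma vandermonde_sq_nonneg: "vandermonde_sq n x \<ge> 0"
  unfolding vandermonde_sq_def by (intro prod_nonneg) auto

text \<open>The Vandermonde determinant is unchanged when powers of x are replaced by powers of x -
  u, and its squared modulus is the product with its conjugate; Andreief applies with the weight
  attached to one factor. A nonzero base point later allows powers of |z - u| in the weight to be
  absorbed. Being proportional to an integral of a nonnegative function, the determinant is real and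
  nonnegative.\<close>

lemma coulomb_integral:
  fixes \<omega> :: "complex \<Rightarrow> real" and u :: complex
  assumes \<omega>: "\<And>z. \<omega> z \<ge> 0"
    and int: "\<And>i j. i < n \<Longrightarrow> j < n \<Longrightarrow> integrable lborel (\<lambda>z. (z - u) ^ i * cnj ((z - u) ^ j) * of_real (\<omega> z))"
  defines "d \<equiv> Determinant.det (mat n n (\<lambda>(i,j). \<integral>z. (z - u) ^ i * cnj ((z - u) ^ j) * of_real (\<omega> z) \<partial>lborel))"
  shows "(\<integral>\<^sup>+x. ennreal ((\<Prod>i<n. \<omega> (x i)) * vandermonde_sq n x) \<partial>cvec {..<n}) = ennreal (fact n * Re d)"
    and "Im d = 0" and "Re d \<ge> 0"
proof -
  define \<phi> where "\<phi> i z = (z - u) ^ i * of_real (\<omega> z)" for i z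
  define \<psi> where "\<psi> i z = cnj ((z - u) ^ i)" for i and z
  define F where "F x = Determinant.det (mat n n (\<lambda>(i,j). \<phi> j (x i))) * Determinant.det (mat n n (\<lambda>(i,j). \<psi> j (x i)))" for x
  have pm: "degree ([:- u, 1:] ^ j) = j" "lead_coeff ([:- u, 1:] ^ j) = 1" for j
    by (simp add: degree_power_eq) (subst lead_coeff_power, simp)
  have V: "Determinant.det (mat n n (\<lambda>(i,j). (x i - u) ^ j)) = (\<Prod>j<n. \<Prod>i<j. x j - x i)" for x
    using det_vandermonde_monic[of n "\<lambda>j. [:- u, 1:] ^ j" x] pm by (simp add: poly_power)
  have F: "F x = complex_of_real ((\<Prod>i<n. \<omega> (x i)) * vandermonde_sq n x)" for x
  proof -
    have "Determinant.det (mat n n (\<lambda>(i,j). c i * g i j)) = (\<Prod>i<n. c i) * Determinant.det (mat n n (\<lambda>(i,j). g i j))"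
      for c :: "nat \<Rightarrow> complex" and g
      by (simp add: det_mat_def sum_distrib_left prod.distrib mult_ac)
    from this[of "\<lambda>i. of_real (\<omega> (x i))" "\<lambda>i j. (x i - u) ^ j"]
    have 1: "Determinant.det (mat n n (\<lambda>(i,j). \<phi> j (x i))) = (\<Prod>i<n. of_real (\<omega> (x i))) * (\<Prod>j<n. \<Prod>i<j. x j - x i)"
      unfolding V by (simp add: \<phi>_def mult.commute)
    have 2: "Determinant.det (mat n n (\<lambda>(i,j). \<psi> j (x i))) = cnj (\<Prod>j<n. \<Prod>i<j. x j - x i)"
      unfolding V[symmetric] \<psi>_def by (simp add: det_mat_def)
    have 3: "(\<Prod>j<n. \<Prod>i<j. x j - x i) * cnj (\<Prod>j<n. \<Prod>i<j. x j - x i) = complex_of_real (vandermonde_sq n x)"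
      unfolding vandermonde_sq_def of_real_prod complex_norm_square by (simp add: prod.distrib)
    show ?thesis unfolding F_def 1 2 by (simp only: mult.assoc 3 of_real_mult of_real_prod)
  qed
  have int': "integrable lborel (\<lambda>z. \<phi> i z * \<psi> j z)" if "i < n" "j < n" for i j
    using int[OF that] by (simp add: \<phi>_def \<psi>_def mult_ac)
  note A = lborel.andreief[where \<phi> = \<phi> and \<psi> = \<psi> and n = n, OF int']
  have I: "integrable (cvec {..<n}) (\<lambda>x. complex_of_real ((\<Prod>i<n. \<omega> (x i)) * vandermonde_sq n x))"
    using A(1) unfolding F_def[symmetric] F by simp
  have E: "(\<integral>x. complex_of_real ((\<Prod>i<n. \<omega> (x i)) * vandermonde_sq n x) \<partial>cvec {..<n}) = fact n * d"
    using A(2) unfolding F_def[symmetric] F d_def by (simp add: \<phi>_def \<psi>_def mult_ac)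
  have Ir: "integrable (cvec {..<n}) (\<lambda>x. (\<Prod>i<n. \<omega> (x i)) * vandermonde_sq n x)"
    using integrable_Re[OF I] by (simp only: Re_complex_of_real)
  define r where "r = (\<integral>x. (\<Prod>i<n. \<omega> (x i)) * vandermonde_sq n x \<partial>cvec {..<n})"
  have nn: "(\<Prod>i<n. \<omega> (x i)) * vandermonde_sq n x \<ge> 0" for x
    using \<omega> vandermonde_sq_nonneg by (intro mult_nonneg_nonneg prod_nonneg) auto
  have r: "r \<ge> 0" unfolding r_def using nn by (intro Bochner_Integration.integral_nonneg) auto
  have E': "complex_of_real r = fact n * d"
    using E unfolding r_def by (subst (asm) integral_complex_of_real)
  hence d: "d = complex_of_real (r / fact n)" by (simp add: field_simps)
  have Red: "Re d = r / fact n" unfolding d by (rule Re_complex_of_real)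
  show "Im d = 0" "Re d \<ge> 0" using r unfolding d Im_complex_of_real Re_complex_of_real by simp_all
  show "(\<integral>\<^sup>+x. ennreal ((\<Prod>i<n. \<omega> (x i)) * vandermonde_sq n x) \<partial>cvec {..<n}) = ennreal (fact n * Re d)"
    using nn_integral_eq_integral[OF Ir] nn unfolding r_def[symmetric] Red by simp
qed

lemma integrable_power_powr_gauss:
  fixes \<gamma> :: real
  assumes \<gamma>: "\<gamma> \<ge> 0"
  shows "integrable lborel (\<lambda>z. z ^ i * cnj (z ^ j) * complex_of_real (cmod z powr (2 * \<gamma>) * exp (- (cmod z)\<^sup>2)))"
proof (rule integrableI_bounded)
  have "(\<integral>\<^sup>+z. ennreal (norm (z ^ i * cnj (z ^ j) * complex_of_real (cmod z powr (2 * \<gamma>) * exp (- (cmod z)\<^sup>2)))) \<partial>lborel)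
      = (\<integral>\<^sup>+z. ennreal (cmod z powr (2 * (\<gamma> + real (i + j) / 2)) * exp (- (cmod z)\<^sup>2)) \<partial>lborel)"
  proof (rule nn_integral_cong_AE)
    have "AE z in lborel. z \<noteq> (0 :: complex)" by (rule AE_lborel_singleton)
    thus "AE z in lborel. ennreal (norm (z ^ i * cnj (z ^ j) * complex_of_real (cmod z powr (2 * \<gamma>) * exp (- (cmod z)\<^sup>2))))
       = ennreal (cmod z powr (2 * (\<gamma> + real (i + j) / 2)) * exp (- (cmod z)\<^sup>2))"
    proof eventually_elim
      case (elim z)
      have pos: "cmod z > 0" using elim by simp
      have e: "2 * (\<gamma> + real (i + j) / 2) = real i + real j + 2 * \<gamma>" by simp
      have "cmod z powr (2 * (\<gamma> + real (i + j) / 2)) = cmod z ^ i * cmod z ^ j * cmod z powr (2 * \<gamma>)"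
        unfolding e powr_add powr_realpow[OF pos] ..
      thus ?case by (simp add: norm_mult norm_power abs_mult)
    qed
  qed
  also have "\<dots> < \<infinity>" using \<gamma> by (subst nn_integral_cmod_powr_gauss) auto
  finally show "(\<integral>\<^sup>+z. ennreal (norm (z ^ i * cnj (z ^ j) * complex_of_real (cmod z powr (2 * \<gamma>) * exp (- (cmod z)\<^sup>2)))) \<partial>lborel) < \<infinity>" .
qed measurable

lemma integral_complex_rotate:
  fixes f :: "complex \<Rightarrow> complex"
  assumes c: "cmod c = 1" and f: "integrable lborel f"
  shows "(\<integral>z. f (c * z) \<partial>lborel) = (\<integral>z. f z \<partial>lborel)"
proof -
  have "c \<noteq> 0" using c by auto
  hence *: "lborel = distr lborel borel (\<lambda>z. c * z)"
    using lborel_eq_density_cmult[of c] c by (simp add: density_1)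
  have [measurable]: "f \<in> borel_measurable borel" using f by auto
  show ?thesis by (subst (2) *, subst integral_distr) auto
qed

text \<open>Rotation invariance makes the monomials orthogonal.\<close>

lemma moments_powr_gauss:
  fixes \<gamma> :: real
  assumes \<gamma>: "\<gamma> \<ge> 0"
  shows "(\<integral>z. z ^ i * cnj (z ^ j) * complex_of_real (cmod z powr (2 * \<gamma>) * exp (- (cmod z)\<^sup>2)) \<partial>lborel)
    = (if i = j then of_real (pi * Gamma (\<gamma> + real i + 1)) else 0)"
proof (cases "i = j")
  case True
  have "(\<integral>z. z ^ i * cnj (z ^ i) * complex_of_real (cmod z powr (2 * \<gamma>) * exp (- (cmod z)\<^sup>2)) \<partial>lborel)
     = (\<integral>z. complex_of_real (cmod z powr (2 * (\<gamma> + real i)) * exp (- (cmod z)\<^sup>2)) \<partial>lborel)"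
  proof (rule integral_cong_AE)
    have "AE z in lborel. z \<noteq> (0 :: complex)" by (rule AE_lborel_singleton)
    thus "AE z in lborel. z ^ i * cnj (z ^ i) * complex_of_real (cmod z powr (2 * \<gamma>) * exp (- (cmod z)\<^sup>2))
       = complex_of_real (cmod z powr (2 * (\<gamma> + real i)) * exp (- (cmod z)\<^sup>2))"
    proof eventually_elim
      case (elim z)
      have pos: "cmod z > 0" using elim by simp
      have e': "2 * (\<gamma> + real i) = real i + real i + 2 * \<gamma>" by simp
      have e: "cmod z powr (2 * (\<gamma> + real i)) = cmod z ^ i * cmod z ^ i * cmod z powr (2 * \<gamma>)"
        unfolding e' powr_add powr_realpow[OF pos] ..
      have "z ^ i * cnj (z ^ i) = complex_of_real (cmod z ^ i * cmod z ^ i)"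
        by (metis complex_norm_square norm_power power2_eq_square)
      thus ?case unfolding e by simp
    qed
  qed measurable
  also have "\<dots> = complex_of_real (\<integral>z. cmod z powr (2 * (\<gamma> + real i)) * exp (- (cmod z)\<^sup>2) \<partial>lborel)"
    by (rule integral_complex_of_real)
  also have "(\<integral>z. cmod z powr (2 * (\<gamma> + real i)) * exp (- (cmod z)\<^sup>2) \<partial>lborel) = enn2real (\<integral>\<^sup>+z. ennreal (cmod z powr (2 * (\<gamma> + real i)) * exp (- (cmod z)\<^sup>2)) \<partial>lborel)"
    by (rule integral_eq_nn_integral) auto
  also have "\<dots> = pi * Gamma (\<gamma> + real i + 1)"
    using \<gamma> by (subst nn_integral_cmod_powr_gauss) (auto intro!: mult_nonneg_nonneg less_imp_le[OF Gamma_real_pos])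
  finally show ?thesis using True by simp
next
  case False
  let ?f = "\<lambda>z. z ^ i * cnj (z ^ j) * complex_of_real (cmod z powr (2 * \<gamma>) * exp (- (cmod z)\<^sup>2))"
  let ?I = "\<integral>z. ?f z \<partial>lborel"
  have *: "?I = c ^ i * cnj (c ^ j) * ?I" if c: "cmod c = 1" for c
  proof -
    have "?I = (\<integral>z. ?f (c * z) \<partial>lborel)"
      by (rule integral_complex_rotate[symmetric, OF c integrable_power_powr_gauss[OF \<gamma>]])
    also have "\<dots> = (\<integral>z. c ^ i * cnj (c ^ j) * ?f z \<partial>lborel)"
      using c by (simp add: norm_mult power_mult_distrib mult_ac)
    also have "\<dots> = c ^ i * cnj (c ^ j) * ?I" by (rule integral_mult_right_zero)
    finally show ?thesis .
  qed
  \<comment> \<open>This rotation multiplies the integrand by exp(i pi), so the integral equals its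
    own negative.\<close>
  define c where "c = cis (pi / (real i - real j))"
  have "c ^ i * cnj (c ^ j) = cis (real i * (pi / (real i - real j)) - real j * (pi / (real i - real j)))"
    unfolding c_def complex_cnj_power cis_cnj Complex.DeMoivre cis_mult by simp
  also have "real i * (pi / (real i - real j)) - real j * (pi / (real i - real j)) = pi"
  proof -
    have "real i - real j \<noteq> 0" using False by simp
    thus ?thesis by (simp only: left_diff_distrib[symmetric]) simp
  qed
  finally have "?I = - ?I" using *[of c] by (simp add: c_def)
  thus ?thesis using False by simp
qed

lemma nn_integral_cvec_gauss_finite:
  assumes "finite I"
  shows "(\<integral>\<^sup>+x. ennreal (exp (- (\<Sum>i\<in>I. (cmod (x i))\<^sup>2))) \<partial>cvec I) = ennreal (pi ^ card I)"
proof -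
  have "(\<integral>\<^sup>+x. ennreal (exp (- (\<Sum>i\<in>I. (cmod (x i))\<^sup>2))) \<partial>cvec I) = (\<integral>\<^sup>+x. (\<Prod>i\<in>I. ennreal (exp (- (cmod (x i))\<^sup>2))) \<partial>cvec I)"
    using assms by (simp add: sum_negf[symmetric] exp_sum prod_ennreal)
  also have "\<dots> = (\<Prod>i\<in>I. \<integral>\<^sup>+z. ennreal (exp (- (cmod z)\<^sup>2)) \<partial>lborel)"
    by (rule clborel.product_nn_integral_prod[OF assms]) auto
  also have "\<dots> = ennreal (pi ^ card I)"
    using nn_integral_gauss_scaled[of 1] by (simp add: ennreal_power)
  finally show ?thesis .
qed

lemma fro_fun_mat: "fro (fun_mat n G) = (\<Sum>p\<in>{..<n} \<times> {..<n}. (cmod (G p))\<^sup>2)"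
  by (simp add: fro_def sum.cartesian_product)

lemma gauss_mean_one: "gauss_mean (\<lambda>_. 1) n = ennreal (pi ^ (n * n))"
  unfolding gauss_mean_def gauss_weight_def fro_fun_mat
  using nn_integral_cvec_gauss_finite[of "{..<n} \<times> {..<n}"] by simp

text \<open>Orthogonality of the monomials makes the Gram matrix diagonal with entries pi j!. This
  independently computed value is what fixes the total mass in the counting argument.\<close>

lemma coulomb_partition_function:
  "(\<integral>\<^sup>+x. ennreal ((\<Prod>i<n. exp (- (cmod (x i))\<^sup>2)) * vandermonde_sq n x) \<partial>cvec {..<n}) = ennreal (fact n * (\<Prod>j<n. pi * fact j))"
proof -
  have ae: "AE z in lborel. (z - 0) ^ i * cnj ((z - 0) ^ j) * complex_of_real (exp (- (cmod z)\<^sup>2))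
      = z ^ i * cnj (z ^ j) * complex_of_real (cmod z powr (2 * 0) * exp (- (cmod z)\<^sup>2))" for i j
  proof -
    have "AE z in lborel. z \<noteq> (0 :: complex)" by (rule AE_lborel_singleton)
    thus ?thesis by eventually_elim simp
  qed
  have int: "integrable lborel (\<lambda>z. (z - 0) ^ i * cnj ((z - 0) ^ j) * complex_of_real (exp (- (cmod z)\<^sup>2)))" for i j
  proof (rule integrable_cong_AE_imp[OF integrable_power_powr_gauss[of 0 i j]])
    show "AE z in lborel. z ^ i * cnj (z ^ j) * complex_of_real (cmod z powr (2 * 0) * exp (- (cmod z)\<^sup>2))
      = (z - 0) ^ i * cnj ((z - 0) ^ j) * complex_of_real (exp (- (cmod z)\<^sup>2))"
      using ae[of i j] by eventually_elim simp
  qed (simp, measurable)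
  have val: "(\<integral>z. (z - 0) ^ i * cnj ((z - 0) ^ j) * complex_of_real (exp (- (cmod z)\<^sup>2)) \<partial>lborel) = (if i = j then of_real (pi * fact i) else 0)" for i j
  proof -
    have "Gamma (0 + real i + 1) = fact i" by (metis Gamma_fact add.commute add_0)
    moreover have "(\<integral>z. (z - 0) ^ i * cnj ((z - 0) ^ j) * complex_of_real (exp (- (cmod z)\<^sup>2)) \<partial>lborel)
      = (\<integral>z. z ^ i * cnj (z ^ j) * complex_of_real (cmod z powr (2 * 0) * exp (- (cmod z)\<^sup>2)) \<partial>lborel)"
      by (rule integral_cong_AE[OF _ _ ae]) measurable
    ultimately show ?thesis using moments_powr_gauss[of 0 i j] by (simp only: order_refl)
  qed
  have "Determinant.det (mat n n (\<lambda>(i,j). if i = j then complex_of_real (pi * fact i) else 0)) = (\<Prod>j<n. complex_of_real (pi * fact j))"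
    by (subst det_upper_triangular[where n = n])
       (auto simp: upper_triangular_def diag_mat_def prod.list_conv_set_nth atLeast0LessThan)
  also have "\<dots> = complex_of_real (\<Prod>j<n. pi * fact j)" by simp
  finally have d: "Determinant.det (mat n n (\<lambda>(i,j). if i = j then complex_of_real (pi * fact i) else 0)) = complex_of_real (\<Prod>j<n. pi * fact j)" .
  show ?thesis
    using coulomb_integral(1)[of "\<lambda>z. exp (- (cmod z)\<^sup>2)" n 0, OF _ int] unfolding val d Re_complex_of_real by simp
qed

text \<open>The product of the deflation constants pi^(2m)/(m! (m+1)) over m < n: the exponents of
  pi add up to n^2 - n, and m! (m+1) = (m+1)!.\<close>

definition schur_const :: "nat \<Rightarrow> real" where
  "schur_const n = pi ^ (n * n - n) / (\<Prod>j\<le>n. fact j)"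

lemma schur_const_pos: "schur_const n > 0"
  unfolding schur_const_def by (intro divide_pos_pos prod_pos) auto

lemma schur_const_Suc: "pi ^ (2 * n) / fact n * schur_const n = real (Suc n) * schur_const (Suc n)"
proof -
  have "Suc n * Suc n - Suc n = 2 * n + (n * n - n)" by (cases n) auto
  hence "schur_const (Suc n) = pi ^ (2 * n) * pi ^ (n * n - n) / ((\<Prod>j\<le>n. fact j) * (real (Suc n) * fact n))"
    unfolding schur_const_def by (simp only: power_add) (simp add: prod.atMost_Suc)
  thus ?thesis by (simp add: schur_const_def del: of_nat_Suc)
qed

text \<open>Supplies the mass hypothesis of the counting argument: the powers of pi add up to
  (n+1)^2, and the factorials cancel except for the factor n + 1.\<close>

lemma schur_const_mass:
  "pi ^ (2 * n) / fact n * schur_const n * (fact (Suc n) * (\<Prod>j<Suc n. pi * fact j)) = real (Suc n) * pi ^ (Suc n * Suc n)"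
proof -
  have "pi ^ (Suc n * Suc n) = pi ^ (Suc n * Suc n - Suc n) * pi ^ Suc n"
    unfolding power_add[symmetric] by (rule arg_cong[where f = "power pi"]) simp
  moreover have "(\<Prod>j<Suc n. pi * fact j) = pi ^ Suc n * (\<Prod>j\<le>n. fact j)"
    by (simp add: prod.distrib lessThan_Suc_atMost del: prod.lessThan_Suc)
  moreover have "schur_const (Suc n) = pi ^ (Suc n * Suc n - Suc n) / ((\<Prod>j\<le>n. fact j) * fact (Suc n))"
    unfolding schur_const_def by (simp only: prod.atMost_Suc)
  moreover have "(\<Prod>j\<le>n. fact j :: real) \<noteq> 0" by simp
  moreover have "A * (B / (C * D)) * (D * (E * C)) = A * (B * E)" if "C \<noteq> 0" "D \<noteq> 0" for A B C D E :: real
    using that by simp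
  ultimately show ?thesis unfolding schur_const_Suc by (simp only: fact_nonzero not_False_eq_True)
qed

text \<open>The induction quantifies over \<open>F\<close>, since deflation multiplies
  \<open>F\<close> by the squared modulus of the characteristic polynomial at the eigenvalue split
  off. The same recursion for F = 1, evaluated by the Coulomb partition function, proves the mass
  hypothesis within the induction step.\<close>

theorem spectral_product_integral:
  assumes "spectral_product F w"
  shows "gauss_mean F n = ennreal (schur_const n) * (\<integral>\<^sup>+x. (\<Prod>i<n. w (x i) * ennreal (exp (- (cmod (x i))\<^sup>2))) * ennreal (vandermonde_sq n x) \<partial>cvec {..<n})"
  using assms
proof (induction n arbitrary: F w)
  case 0
  have "fun_mat 0 G = mat 0 0 (\<lambda>_. 0)" for G by (rule eq_matI) auto
  hence "F (fun_mat 0 G) = 1" for G using 0 unfolding spectral_product_def by metis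
  thus ?case
    by (simp add: gauss_mean_def gauss_weight_def PiM_empty nn_integral_count_space_finite schur_const_def vandermonde_sq_def fro_def)
next
  case (Suc n)
  let ?J = "\<lambda>w n. (\<integral>\<^sup>+x. (\<Prod>i<n. w (x i) * ennreal (exp (- (cmod (x i))\<^sup>2))) * ennreal (vandermonde_sq n x) \<partial>cvec {..<n})"
  define \<kappa> where "\<kappa> = pi ^ (2 * n) / fact n"
  have key: "ennreal \<kappa> * (\<integral>\<^sup>+l. w l * ennreal (exp (- (cmod l)\<^sup>2)) * gauss_mean (\<lambda>A. F A * ennreal ((cmod (poly (char_poly A) l))\<^sup>2)) n \<partial>lborel)
      = ennreal (\<kappa> * schur_const n) * ?J w (Suc n)" if F: "spectral_product F w" for F w
  proof -
    have [measurable]: "w \<in> borel_measurable borel" using F by (simp add: spectral_product_def)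
    let ?f = "\<lambda>n x. (\<Prod>i<n. w (x i) * ennreal (exp (- (cmod (x i))\<^sup>2))) * ennreal (vandermonde_sq n x)"
    have m: "?f m \<in> borel_measurable (cvec {..<m})" for m
      unfolding vandermonde_sq_def by measurable
    have "(\<integral>\<^sup>+l. w l * ennreal (exp (- (cmod l)\<^sup>2)) * gauss_mean (\<lambda>A. F A * ennreal ((cmod (poly (char_poly A) l))\<^sup>2)) n \<partial>lborel)
      = (\<integral>\<^sup>+l. ennreal (schur_const n) * (\<integral>\<^sup>+x. ?f (Suc n) (x(n := l)) \<partial>cvec {..<n}) \<partial>lborel)"
    proof (rule nn_integral_cong)
      fix l
      let ?g = "\<lambda>x. (\<Prod>i<n. w (x i) * ennreal ((cmod (l - x i))\<^sup>2) * ennreal (exp (- (cmod (x i))\<^sup>2))) * ennreal (vandermonde_sq n x)"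
      have gm: "?g \<in> borel_measurable (cvec {..<n})" unfolding vandermonde_sq_def by measurable
      have fe: "?f (Suc n) (x(n := l)) = w l * ennreal (exp (- (cmod l)\<^sup>2)) * ?g x" for x
      proof -
        have v: "vandermonde_sq (Suc n) (x(n := l)) = vandermonde_sq n x * (\<Prod>i<n. (cmod (l - x i))\<^sup>2)"
          by (simp add: vandermonde_sq_def)
        have nn: "(\<Prod>i<n. (cmod (l - x i))\<^sup>2) \<ge> 0" by (intro prod_nonneg) auto
        show ?thesis
          unfolding v ennreal_mult[OF vandermonde_sq_nonneg nn]
          by (simp add: prod.distrib prod_ennreal mult_ac)
      qed
      have "gauss_mean (\<lambda>A. F A * ennreal ((cmod (poly (char_poly A) l))\<^sup>2)) n = ennreal (schur_const n) * (\<integral>\<^sup>+x. ?g x \<partial>cvec {..<n})"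
        using Suc.IH[OF spectral_product_char_poly[OF F]] by simp
      thus "w l * ennreal (exp (- (cmod l)\<^sup>2)) * gauss_mean (\<lambda>A. F A * ennreal ((cmod (poly (char_poly A) l))\<^sup>2)) n
         = ennreal (schur_const n) * (\<integral>\<^sup>+x. ?f (Suc n) (x(n := l)) \<partial>cvec {..<n})"
        unfolding fe nn_integral_cmult[OF gm] by (simp add: mult_ac)
    qed
    also have "\<dots> = ennreal (schur_const n) * (\<integral>\<^sup>+l. (\<integral>\<^sup>+x. ?f (Suc n) (x(n := l)) \<partial>cvec {..<n}) \<partial>lborel)"
    proof (rule nn_integral_cmult)
      interpret C: sigma_finite_measure "cvec {..<n}" by (rule sigma_finite_cvec) simp
      have "(\<lambda>(l, x). ?f (Suc n) (x(n := l))) \<in> borel_measurable (lborel \<Otimes>\<^sub>M cvec {..<n})"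
        using measurable_compose[OF measurable_pair_swap' nn_integral_cvec_Suc(3)[OF m[of "Suc n"]]]
        unfolding case_prod_beta' fst_conv snd_conv .
      from C.borel_measurable_nn_integral[OF this]
      show "(\<lambda>l. \<integral>\<^sup>+x. ?f (Suc n) (x(n := l)) \<partial>cvec {..<n}) \<in> borel_measurable lborel" .
    qed
    also have "\<dots> = ennreal (schur_const n) * ?J w (Suc n)"
      unfolding nn_integral_cvec_Suc(2)[OF m[of "Suc n"]] ..
    finally have e: "(\<integral>\<^sup>+l. w l * ennreal (exp (- (cmod l)\<^sup>2)) * gauss_mean (\<lambda>A. F A * ennreal ((cmod (poly (char_poly A) l))\<^sup>2)) n \<partial>lborel)
      = ennreal (schur_const n) * ?J w (Suc n)" .
    have "ennreal (\<kappa> * schur_const n) = ennreal \<kappa> * ennreal (schur_const n)"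
      using less_imp_le[OF schur_const_pos[of n]] by (intro ennreal_mult) (auto simp: \<kappa>_def)
    thus ?thesis unfolding e by (simp only: mult.assoc)
  qed
  have J1: "?J (\<lambda>_. 1) (Suc n) = ennreal (fact (Suc n) * (\<Prod>j<Suc n. pi * fact j))"
  proof -
    have "(\<Prod>i<Suc n. 1 * ennreal (exp (- (cmod (x i))\<^sup>2))) * ennreal (vandermonde_sq (Suc n) x)
        = ennreal ((\<Prod>i<Suc n. exp (- (cmod (x i))\<^sup>2)) * vandermonde_sq (Suc n) x)" for x
      by (subst ennreal_mult) (auto intro!: prod_nonneg vandermonde_sq_nonneg simp: prod_ennreal simp del: prod.lessThan_Suc)
    thus ?thesis using coulomb_partition_function[of "Suc n"] by (simp only:)
  qed
  have mass: "ennreal \<kappa> * (\<integral>\<^sup>+l. ennreal (exp (- (cmod l)\<^sup>2)) * gauss_mean (\<lambda>A. ennreal ((cmod (poly (char_poly A) l))\<^sup>2)) n \<partial>lborel)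
       = of_nat (Suc n) * gauss_mean (\<lambda>_. 1) (Suc n)"
  proof -
    have "ennreal \<kappa> * (\<integral>\<^sup>+l. ennreal (exp (- (cmod l)\<^sup>2)) * gauss_mean (\<lambda>A. ennreal ((cmod (poly (char_poly A) l))\<^sup>2)) n \<partial>lborel)
      = ennreal (\<kappa> * schur_const n) * ?J (\<lambda>_. 1) (Suc n)"
      using key[OF spectral_product_one] by simp
    also have "\<dots> = ennreal (\<kappa> * schur_const n * (fact (Suc n) * (\<Prod>j<Suc n. pi * fact j)))"
      unfolding J1
    proof (rule ennreal_mult[symmetric])
      show "0 \<le> \<kappa> * schur_const n" using less_imp_le[OF schur_const_pos[of n]] by (simp add: \<kappa>_def)
      show "0 \<le> fact (Suc n) * (\<Prod>j<Suc n. pi * fact j)" by (intro mult_nonneg_nonneg prod_nonneg) auto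
    qed
    also have "\<dots> = ennreal (real (Suc n)) * ennreal (pi ^ (Suc n * Suc n))"
      unfolding \<kappa>_def schur_const_mass by (rule ennreal_mult) auto
    finally show ?thesis unfolding gauss_mean_one by (simp add: ennreal_of_nat_eq_real_of_nat)
  qed
  have "ennreal (real (Suc n)) * gauss_mean F (Suc n) = ennreal (\<kappa> * schur_const n) * ?J w (Suc n)"
    using gauss_mean_deflation[OF Suc.prems mass[unfolded \<kappa>_def]] key[OF Suc.prems]
    by (simp add: gauss_mean_one \<kappa>_def ennreal_of_nat_eq_real_of_nat)
  also have "\<kappa> * schur_const n = real (Suc n) * schur_const (Suc n)" unfolding \<kappa>_def by (rule schur_const_Suc)
  also have "ennreal (real (Suc n) * schur_const (Suc n)) * ?J w (Suc n) = ennreal (real (Suc n)) * (ennreal (schur_const (Suc n)) * ?J w (Suc n))"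
    using schur_const_pos[of "Suc n"] by (simp add: ennreal_mult mult.assoc)
  finally show ?case
    by (subst (asm) ennreal_mult_cancel_left) (auto simp del: prod.lessThan_Suc)
qed

section \<open>Moments of the characteristic polynomial\<close>

lemma index_mult_mat_sum:
  fixes A :: "'a :: semiring_0 mat"
  assumes "A \<in> carrier_mat n m" "B \<in> carrier_mat m p" "i < n" "j < p"
  shows "(A * B) $$ (i,j) = (\<Sum>l<m. A $$ (i,l) * B $$ (l,j))"
  using assms by (simp add: scalar_prod_def atLeast0LessThan)

text \<open>If the monomials are orthogonal with squared norms \<open>h l\<close>, the Gram matrix
  of the powers (z - u)^m is the product of the transposed coefficient matrix \<open>C\<close>, the
  diagonal \<open>H\<close> and the conjugate of \<open>C\<close>. Each factor has an explicit
  inverse; that of \<open>C\<close> is a Pascal matrix, since z^j = ((z - u) + u)^j. The wanted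
  block of size \<open>N\<close> is then a complementary minor.\<close>

lemma gram_shifted_monomials:
  fixes u :: complex and h :: "nat \<Rightarrow> complex" and k N :: nat
  assumes h: "\<And>l. h l \<noteq> 0"
  defines "e \<equiv> \<lambda>m. [:- u, 1:] ^ m"
  shows "Determinant.det (mat N N (\<lambda>(i,j). \<Sum>l<k+N. coeff (e (k+i)) l * h l * cnj (coeff (e (k+j)) l)))
    = (\<Prod>l<k+N. h l) * Determinant.det (mat k k (\<lambda>(a,b). \<Sum>l<k+N. cnj (of_nat (l choose a) * u ^ (l - a)) * (of_nat (l choose b) * u ^ (l - b)) / h l))"
proof -
  let ?n = "k + N"
  have pm: "degree (e j) = j" "lead_coeff (e j) = 1" for j
  proof -
    show d: "degree (e j) = j" by (simp add: e_def degree_power_eq)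
    show "lead_coeff (e j) = 1" unfolding e_def by (subst lead_coeff_power) simp
  qed
  define C where "C = mat ?n ?n (\<lambda>(l,m). coeff (e m) l)"
  define D where "D = mat ?n ?n (\<lambda>(m,l). of_nat (l choose m) * u ^ (l - m))"
  define H where "H = mat ?n ?n (\<lambda>(i,j). if i = j then h i else 0)"
  define H' where "H' = mat ?n ?n (\<lambda>(i,j). if i = j then 1 / h i else 0)"
  define cC where "cC = mat ?n ?n (\<lambda>(i,j). cnj (C $$ (i,j)))"
  define cD where "cD = mat ?n ?n (\<lambda>(i,j). cnj (D $$ (i,j)))"
  have carr: "C \<in> carrier_mat ?n ?n" "D \<in> carrier_mat ?n ?n" "H \<in> carrier_mat ?n ?n" "H' \<in> carrier_mat ?n ?n"
    "cC \<in> carrier_mat ?n ?n" "cD \<in> carrier_mat ?n ?n" "transpose_mat C \<in> carrier_mat ?n ?n" "transpose_mat D \<in> carrier_mat ?n ?n"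
    by (auto simp: C_def D_def H_def H'_def cC_def cD_def)
  have CDe: "(\<Sum>m<?n. coeff (e m) i * (of_nat (j choose m) * u ^ (j - m))) = (if i = j then 1 else 0)" if "i < ?n" "j < ?n" for i j
  proof -
    have "monom 1 j = ([:- u, 1:] + [:u:]) ^ j" by (simp add: monom_altdef)
    also have "\<dots> = (\<Sum>m\<le>j. of_nat (j choose m) * e m * [:u:] ^ (j - m))"
      unfolding e_def by (rule binomial_ring)
    also have "\<dots> = (\<Sum>m\<le>j. Polynomial.smult (of_nat (j choose m) * u ^ (j - m)) (e m))"
    proof (intro sum.cong refl)
      fix m
      have "of_nat (j choose m) = [:of_nat (j choose m) :: complex:]" by (rule of_nat_poly)
      moreover have "[:u:] ^ (j - m) = [:u ^ (j - m):]" by (simp add: poly_const_pow)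
      ultimately show "of_nat (j choose m) * e m * [:u:] ^ (j - m) = Polynomial.smult (of_nat (j choose m) * u ^ (j - m)) (e m)"
        by (simp add: mult.commute)
    qed
    finally have "coeff (monom 1 j) i = (\<Sum>m\<le>j. coeff (e m) i * (of_nat (j choose m) * u ^ (j - m)))"
      by (simp add: coeff_sum mult.commute)
    also have "\<dots> = (\<Sum>m<?n. coeff (e m) i * (of_nat (j choose m) * u ^ (j - m)))"
      using that by (intro sum.mono_neutral_left) auto
    finally show ?thesis by (auto simp: eq_commute)
  qed
  have CD: "C * D = 1\<^sub>m ?n"
    by (rule eq_matI) (auto simp: C_def D_def scalar_prod_def atLeast0LessThan CDe)
  have cCD: "cC * cD = 1\<^sub>m ?n"
  proof (rule eq_matI)
    fix i j assume "i < dim_row (1\<^sub>m ?n)" "j < dim_col (1\<^sub>m ?n)"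
    hence ij: "i < ?n" "j < ?n" by auto
    have "(cC * cD) $$ (i,j) = cnj (\<Sum>m<?n. coeff (e m) i * (of_nat (j choose m) * u ^ (j - m)))"
      using ij by (simp add: cC_def cD_def C_def D_def scalar_prod_def atLeast0LessThan)
    thus "(cC * cD) $$ (i,j) = 1\<^sub>m ?n $$ (i,j)" using ij CDe by simp
  qed (auto simp: cC_def cD_def)
  have HH: "H * H' = 1\<^sub>m ?n"
    by (rule eq_matI) (auto simp: H_def H'_def scalar_prod_def atLeast0LessThan h if_distrib[of "\<lambda>x. x * _"] cong: if_cong)
  have DC: "D * C = 1\<^sub>m ?n" by (rule mat_mult_left_right_inverse[OF carr(1,2) CD])
  have CtDt: "transpose_mat C * transpose_mat D = 1\<^sub>m ?n"
    using transpose_mult[OF carr(2,1)] DC by simp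
  define \<Gamma> where "\<Gamma> = transpose_mat C * H * cC"
  define \<Delta> where "\<Delta> = cD * H' * transpose_mat D"
  have G: "\<Gamma> \<in> carrier_mat ?n ?n" "\<Delta> \<in> carrier_mat ?n ?n" using carr by (auto simp: \<Gamma>_def \<Delta>_def)
  have "\<Gamma> * \<Delta> = transpose_mat C * H * (cC * cD) * (H' * transpose_mat D)"
    unfolding \<Gamma>_def \<Delta>_def using carr
    by (simp add: assoc_mult_mat[of _ ?n ?n _ ?n _ ?n] mult_carrier_mat[of _ ?n ?n _ ?n])
  also have "\<dots> = transpose_mat C * (H * H') * transpose_mat D"
    unfolding cCD using carr right_mult_one_mat[of "transpose_mat C * H" ?n ?n]
    by (simp add: assoc_mult_mat[of _ ?n ?n _ ?n _ ?n] mult_carrier_mat[of _ ?n ?n _ ?n])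
  also have "\<dots> = 1\<^sub>m ?n" unfolding HH using carr CtDt by simp
  finally have GD: "\<Gamma> * \<Delta> = 1\<^sub>m ?n" .
  have Gij: "\<Gamma> $$ (i,j) = (\<Sum>l<?n. coeff (e i) l * h l * cnj (coeff (e j) l))" if "i < ?n" "j < ?n" for i j
  proof -
    have "(transpose_mat C * H) $$ (i,l) = coeff (e i) l * h l" if "l < ?n" for l
      using \<open>i < ?n\<close> that by (simp add: C_def H_def scalar_prod_def atLeast0LessThan if_distrib[of "\<lambda>x. _ * x"] cong: if_cong)
    thus ?thesis using that carr unfolding \<Gamma>_def
      by (subst index_mult_mat(1)) (auto simp: scalar_prod_def atLeast0LessThan cC_def C_def simp del: index_mult_mat(1) intro!: sum.cong)
  qed
  have Dij: "\<Delta> $$ (a,b) = (\<Sum>l<?n. cnj (of_nat (l choose a) * u ^ (l - a)) * (of_nat (l choose b) * u ^ (l - b)) / h l)" if "a < ?n" "b < ?n" for a b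
  proof -
    have "(cD * H') $$ (a,l) = cnj (of_nat (l choose a) * u ^ (l - a)) / h l" if "l < ?n" for l
      using \<open>a < ?n\<close> that by (simp add: cD_def D_def H'_def scalar_prod_def atLeast0LessThan if_distrib[of "\<lambda>x. _ * x"] cong: if_cong)
    moreover have "\<Delta> $$ (a,b) = (\<Sum>l<?n. (cD * H') $$ (a,l) * transpose_mat D $$ (l,b))"
      unfolding \<Delta>_def by (rule index_mult_mat_sum) (use carr that in auto)
    moreover have "transpose_mat D $$ (l,b) = of_nat (l choose b) * u ^ (l - b)" if "l < ?n" for l
      using that \<open>b < ?n\<close> by (simp add: D_def)
    ultimately show ?thesis by (simp del: index_mult_mat index_transpose_mat cong: sum.cong_simp)
  qed
  have detG: "Determinant.det \<Gamma> = (\<Prod>l<?n. h l)"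
  proof -
    have C1: "Determinant.det C = 1" unfolding C_def by (rule det_monic_coeffs) (use pm in auto)
    have "Determinant.det cC = cnj (Determinant.det C)"
      unfolding cC_def C_def det_mat_def by (auto simp: permutes_in_image[of _ "{..<?n}", unfolded lessThan_iff] intro!: sum.cong prod.cong)
    moreover have "Determinant.det H = (\<Prod>l<?n. h l)"
      unfolding H_def by (subst det_upper_triangular[where n = ?n])
        (auto simp: upper_triangular_def diag_mat_def prod.list_conv_set_nth atLeast0LessThan)
    moreover have "Determinant.det \<Gamma> = Determinant.det (transpose_mat C) * Determinant.det H * Determinant.det cC"
      unfolding \<Gamma>_def using carr by (simp add: det_mult[where n = ?n])
    ultimately show ?thesis using det_transpose[OF carr(1)] C1 by simp
  qed
  have "mat N N (\<lambda>(i,j). \<Gamma> $$ (k+i,k+j)) = mat N N (\<lambda>(i,j). \<Sum>l<?n. coeff (e (k+i)) l * h l * cnj (coeff (e (k+j)) l))"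
    by (rule eq_matI) (auto simp: Gij)
  moreover have "mat k k (\<lambda>(i,j). \<Delta> $$ (i,j)) = mat k k (\<lambda>(a,b). \<Sum>l<?n. cnj (of_nat (l choose a) * u ^ (l - a)) * (of_nat (l choose b) * u ^ (l - b)) / h l)"
    by (rule eq_matI) (auto simp: Dij)
  ultimately show ?thesis using jacobi_complementary_minor[OF G GD] detG by simp
qed

lemma det_scale_rows_cols:
  fixes g :: "nat \<Rightarrow> nat \<Rightarrow> 'a :: comm_ring_1"
  shows "Determinant.det (mat n n (\<lambda>(i,j). c i * d j * g i j)) = (\<Prod>i<n. c i) * (\<Prod>i<n. d i) * Determinant.det (mat n n (\<lambda>(i,j). g i j))"
proof -
  have "(\<Prod>i<n. d (p i)) = (\<Prod>i<n. d i)" if "p permutes {..<n}" for p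
    using prod.permute[OF that, of d] by (simp add: o_def)
  thus ?thesis by (simp add: det_mat_def sum_distrib_left prod.distrib mult_ac)
qed

text \<open>Up to a! b! and powers of u and its conjugate, this is the mixed derivative of orders a
  and b in these two variables of the truncated kernel with terms r^l/Gamma(\<gamma>+l+1), where r =
  |u|^2.\<close>

definition wronskian_sum :: "real \<Rightarrow> real \<Rightarrow> nat \<Rightarrow> nat \<Rightarrow> nat \<Rightarrow> real" where
  "wronskian_sum \<gamma> r n a b = (\<Sum>l<n. real (l choose a) * real (l choose b) * r ^ l / Gamma (\<gamma> + real l + 1))"

text \<open>Values of the characteristic polynomial stand for the two determinants up to sign, which
  makes the invariance under similarity evident.\<close>

definition char_weight :: "real \<Rightarrow> nat \<Rightarrow> complex \<Rightarrow> complex mat \<Rightarrow> ennreal" where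
  "char_weight \<gamma> k u A = ennreal (cmod (poly (char_poly A) 0) powr (2 * \<gamma>) * cmod (poly (char_poly A) u) ^ (2 * k))"

lemma spectral_product_char_weight:
  "spectral_product (char_weight \<gamma> k u) (\<lambda>l. ennreal (cmod l powr (2 * \<gamma>) * cmod (u - l) ^ (2 * k)))"
  unfolding spectral_product_def
proof (intro conjI allI impI)
  fix n
  have [measurable]: "(\<lambda>G. poly (char_poly (fun_mat n G)) x) \<in> borel_measurable (cmat n)" for x
    by (rule measurable_char_poly) auto
  show "(\<lambda>G. char_weight \<gamma> k u (fun_mat n G)) \<in> borel_measurable (cmat n)"
    unfolding char_weight_def by measurable
next
  fix n and A P Q :: "complex mat"
  assume *: "A \<in> carrier_mat n n" "P \<in> carrier_mat n n" "Q \<in> carrier_mat n n" "P * Q = 1\<^sub>m n"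
  show "char_weight \<gamma> k u (P * A * Q) = char_weight \<gamma> k u A"
    unfolding char_weight_def poly_char_poly_similar[OF *] ..
next
  fix n b l and D :: "complex mat" assume *: "D \<in> carrier_mat n n"
  show "char_weight \<gamma> k u (border D b (\<lambda>_. 0) l) = ennreal (cmod l powr (2 * \<gamma>) * cmod (u - l) ^ (2 * k)) * char_weight \<gamma> k u D"
    unfolding char_weight_def poly_char_poly_border_lower[OF *]
    by (subst ennreal_mult[symmetric]) (auto simp: norm_mult powr_mult power_mult_distrib mult_ac)
qed (auto simp: char_weight_def poly_char_poly[where n = 0])

text \<open>Raising all powers of z - u by \<open>k\<close> absorbs |z - u|^(2k), so the Gram matrix
  of size \<open>N\<close> is the lower right block of the one of size k + N for the rotation
  invariant weight alone. The moments of that weight are pi Gamma(\<gamma>+l+1), and the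
  complementary minor has size \<open>k\<close>.\<close>

lemma gauss_mean_char_weight:
  fixes \<gamma> :: real and u :: complex and k N :: nat
  assumes \<gamma>: "\<gamma> \<ge> 0" and u: "u \<noteq> 0"
  defines "r \<equiv> (cmod u)\<^sup>2"
  defines "d \<equiv> (\<Prod>l<k+N. Gamma (\<gamma> + real l + 1)) * pi ^ N * ((\<Prod>a<k. 1 / r ^ a) * Determinant.det (mat k k (\<lambda>(a,b). wronskian_sum \<gamma> r (k + N) a b)))"
  shows "gauss_mean (char_weight \<gamma> k u) N = ennreal (schur_const N * fact N * d)" and "d \<ge> 0"
proof -
  define \<omega> where "\<omega> z = cmod z powr (2 * \<gamma>) * exp (- (cmod z)\<^sup>2)" for z
  define \<omega>' where "\<omega>' z = \<omega> z * cmod (z - u) ^ (2 * k)" for z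
  define e where "e m = [:- u, 1:] ^ m" for m
  define h where "h l = complex_of_real (pi * Gamma (\<gamma> + real l + 1))" for l :: nat
  have G: "Gamma (\<gamma> + real l + 1) > 0" for l using \<gamma> by (intro Gamma_real_pos) simp
  have h0: "h l \<noteq> 0" for l using G[of l] by (simp add: h_def)
  have deg: "degree (e m) = m" for m by (simp add: e_def degree_power_eq)
  have ex: "(z - u) ^ m = (\<Sum>l<k+N. coeff (e m) l * z ^ l)" if "m < k + N" for z m
    using poly_eq_sum_lessThan[of "e m" "k + N" z] deg[of m] that by (simp add: e_def poly_power mult.commute)
  have prodexp: "(z - u) ^ i * cnj ((z - u) ^ j) * of_real (\<omega> z)
      = (\<Sum>l<k+N. \<Sum>l'<k+N. coeff (e i) l * cnj (coeff (e j) l') * (z ^ l * cnj (z ^ l') * of_real (\<omega> z)))" if "i < k+N" "j < k+N" for i j z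
    unfolding ex[OF that(1)] ex[OF that(2)]
    by (simp only: cnj_sum sum_product sum_distrib_right) (intro sum.cong refl, simp add: sum_distrib_left mult_ac)
  have int0: "integrable lborel (\<lambda>z. z ^ l * cnj (z ^ l') * complex_of_real (\<omega> z))" for l l'
    unfolding \<omega>_def by (rule integrable_power_powr_gauss[OF \<gamma>])
  have val0: "(\<integral>z. z ^ l * cnj (z ^ l') * complex_of_real (\<omega> z) \<partial>lborel) = (if l = l' then h l else 0)" for l l'
    unfolding \<omega>_def h_def by (rule moments_powr_gauss[OF \<gamma>])
  have int1: "integrable lborel (\<lambda>z. (z - u) ^ i * cnj ((z - u) ^ j) * of_real (\<omega> z))" if "i < k+N" "j < k+N" for i j
    unfolding prodexp[OF that] by (intro Bochner_Integration.integrable_sum integrable_mult_right int0)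
  have val1: "(\<integral>z. (z - u) ^ i * cnj ((z - u) ^ j) * of_real (\<omega> z) \<partial>lborel) = (\<Sum>l<k+N. coeff (e i) l * h l * cnj (coeff (e j) l))" if "i < k+N" "j < k+N" for i j
  proof -
    have "(\<integral>z. (z - u) ^ i * cnj ((z - u) ^ j) * of_real (\<omega> z) \<partial>lborel)
       = (\<Sum>l<k+N. \<Sum>l'<k+N. coeff (e i) l * cnj (coeff (e j) l') * (if l = l' then h l else 0))"
      unfolding prodexp[OF that]
      by (subst Bochner_Integration.integral_sum, intro Bochner_Integration.integrable_sum integrable_mult_right int0,
          rule sum.cong[OF refl], subst Bochner_Integration.integral_sum, intro integrable_mult_right int0)
         (simp add: val0[symmetric] del: of_real_mult)
    also have "\<dots> = (\<Sum>l<k+N. coeff (e i) l * h l * cnj (coeff (e j) l))"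
      by (intro sum.cong refl) (simp add: if_distrib[of "\<lambda>x. _ * x"] sum.delta mult_ac cong: if_cong)
    finally show ?thesis .
  qed
  have shift: "(z - u) ^ i * cnj ((z - u) ^ j) * of_real (\<omega>' z) = (z - u) ^ (k + i) * cnj ((z - u) ^ (k + j)) * of_real (\<omega> z)" for z i j
  proof -
    have "complex_of_real (cmod (z - u) ^ (2 * k)) = (z - u) ^ k * cnj ((z - u) ^ k)"
      by (metis complex_norm_square norm_power power_mult mult.commute)
    thus ?thesis by (simp add: \<omega>'_def power_add mult_ac del: of_real_power)
  qed
  define M where "M = mat N N (\<lambda>(i,j). \<integral>z. (z - u) ^ i * cnj ((z - u) ^ j) * of_real (\<omega>' z) \<partial>lborel)"
  have M: "M = mat N N (\<lambda>(i,j). \<Sum>l<k+N. coeff (e (k+i)) l * h l * cnj (coeff (e (k+j)) l))"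
    unfolding M_def by (rule eq_matI) (auto simp only: index_mat dim_row_mat dim_col_mat prod.case shift val1 add_less_cancel_left)
  have \<omega>'0: "\<omega>' z \<ge> 0" for z by (simp add: \<omega>'_def \<omega>_def)
  have int': "integrable lborel (\<lambda>z. (z - u) ^ i * cnj ((z - u) ^ j) * of_real (\<omega>' z))" if "i < N" "j < N" for i j
    unfolding shift by (rule int1) (use that in auto)
  note coul = coulomb_integral[of \<omega>' N u, OF \<omega>'0 int', folded M_def]
  have r: "r > 0" using u by (simp add: r_def)
  \<comment> \<open>Powers of \<open>u\<close> and of its conjugate are taken out of columns and
    rows, which leaves a real matrix depending on \<open>u\<close> only through
    \<open>r\<close>.\<close>
  have "Determinant.det (mat k k (\<lambda>(a,b). \<Sum>l<k+N. cnj (of_nat (l choose a) * u ^ (l - a)) * (of_nat (l choose b) * u ^ (l - b)) / h l))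
     = Determinant.det (mat k k (\<lambda>(a,b). (1 / cnj u ^ a) * (1 / (of_real pi * u ^ b)) * complex_of_real (wronskian_sum \<gamma> r (k + N) a b)))"
  proof (rule arg_cong[where f = Determinant.det], rule eq_matI, goal_cases)
    case (1 a b)
    have "cnj (of_nat (l choose a) * u ^ (l - a)) * (of_nat (l choose b) * u ^ (l - b)) / h l
       = (1 / cnj u ^ a) * (1 / (of_real pi * u ^ b)) * complex_of_real (real (l choose a) * real (l choose b) * r ^ l / Gamma (\<gamma> + real l + 1))" for l
    proof (cases "a \<le> l \<and> b \<le> l")
      case True
      have "complex_of_real (r ^ l) = u ^ l * cnj u ^ l"
        unfolding r_def of_real_power complex_norm_square[symmetric] by (simp add: power_mult_distrib complex_norm_square flip: of_real_power)
      moreover have "u ^ l = u ^ (l - b) * u ^ b" "cnj u ^ l = cnj u ^ (l - a) * cnj u ^ a"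
        using True by (simp_all add: power_add[symmetric])
      ultimately show ?thesis using u by (simp add: h_def field_simps)
    qed (auto simp: binomial_eq_0)
    thus ?case using 1 by (simp add: wronskian_sum_def sum_distrib_left del: of_real_mult of_real_divide)
  qed auto
  also have "\<dots> = (\<Prod>a<k. 1 / cnj u ^ a) * (\<Prod>b<k. 1 / (of_real pi * u ^ b)) * complex_of_real (Determinant.det (mat k k (\<lambda>(a,b). wronskian_sum \<gamma> r (k + N) a b)))"
    unfolding det_scale_rows_cols by (simp add: det_mat_def)
  also have "(\<Prod>a<k. 1 / cnj u ^ a) * (\<Prod>b<k. 1 / (of_real pi * u ^ b)) = complex_of_real ((\<Prod>a<k. 1 / r ^ a) / pi ^ k)"
  proof -
    have "(1 / cnj u ^ a) * (1 / (of_real pi * u ^ a)) = complex_of_real (1 / r ^ a / pi)" for a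
    proof -
      have "complex_of_real (r ^ a) = u ^ a * cnj u ^ a"
        using complex_norm_square[of u] by (simp add: r_def power_mult_distrib)
      thus ?thesis by (simp add: mult_ac del: of_real_power)
    qed
    thus ?thesis unfolding prod.distrib[symmetric] by (simp only: of_real_prod[symmetric]) (simp add: prod_dividef prod.distrib)
  qed
  finally have det: "Determinant.det M = (\<Prod>l<k+N. h l) * (complex_of_real ((\<Prod>a<k. 1 / r ^ a) / pi ^ k) * complex_of_real (Determinant.det (mat k k (\<lambda>(a,b). wronskian_sum \<gamma> r (k + N) a b))))"
    using gram_shifted_monomials[where h = h and N = N and k = k and u = u, OF h0] unfolding M e_def by simp
  have "Determinant.det M = complex_of_real d"
    unfolding det d_def h_def by (simp add: prod.distrib power_add field_simps)
  hence Red: "Re (Determinant.det M) = d" by simp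
  show "d \<ge> 0" using coul(3) Red by simp
  have "(\<Prod>i<N. ennreal (cmod (x i) powr (2 * \<gamma>) * cmod (u - x i) ^ (2 * k)) * ennreal (exp (- (cmod (x i))\<^sup>2))) * ennreal (vandermonde_sq N x)
     = ennreal ((\<Prod>i<N. \<omega>' (x i)) * vandermonde_sq N x)" for x
  proof -
    have "ennreal (cmod z powr (2 * \<gamma>) * cmod (u - z) ^ (2 * k)) * ennreal (exp (- (cmod z)\<^sup>2)) = ennreal (\<omega>' z)" for z
      by (simp add: \<omega>'_def \<omega>_def ennreal_mult[symmetric] norm_minus_commute mult_ac)
    thus ?thesis using \<omega>'0 by (simp add: prod_ennreal ennreal_mult prod_nonneg vandermonde_sq_nonneg)
  qed
  hence "gauss_mean (char_weight \<gamma> k u) N = ennreal (schur_const N) * ennreal (fact N * d)"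
    unfolding spectral_product_integral[OF spectral_product_char_weight] using coul(1) Red by simp
  thus "gauss_mean (char_weight \<gamma> k u) N = ennreal (schur_const N * fact N * d)"
    using less_imp_le[OF schur_const_pos[of N]] by (simp add: ennreal_mult' mult.assoc)
qed

section \<open>The Laguerre ensemble\<close>

text \<open>A linear functional on polynomials; for a = p - k its Hankel matrix carries the
  distribution of the largest point.\<close>

definition lower_moment :: "real \<Rightarrow> real \<Rightarrow> real poly \<Rightarrow> real" where
  "lower_moment a r p = (\<integral>t. indicator {0<..<r} t * (poly p t * (t powr a * exp (- t))) \<partial>lborel)"

lemma integrable_powr_exp:
  fixes a :: real
  assumes a: "a \<ge> 0"
  shows "integrable lborel (\<lambda>t. indicator {0<..} t * (t powr a * exp (- t)))"
proof (rule integrableI_bounded)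
  have "(\<integral>\<^sup>+t. ennreal (norm (indicator {0<..} t * (t powr a * exp (- t)))) \<partial>lborel)
      = (\<integral>\<^sup>+t. ennreal (t powr ((a + 1) - 1) * exp (- t)) * indicator {0..} t \<partial>lborel)"
    by (intro nn_integral_cong) (auto simp: indicator_def)
  also have "\<dots> = ennreal (Gamma (a + 1))" using a by (intro nn_integral_Gamma) simp
  finally show "(\<integral>\<^sup>+t. ennreal (norm (indicator {0<..} t * (t powr a * exp (- t)))) \<partial>lborel) < \<infinity>" by simp
qed simp

lemma integral_powr_exp:
  fixes a :: real
  assumes a: "a \<ge> 0"
  shows "(\<integral>t. indicator {0<..} t * (t powr a * exp (- t)) \<partial>lborel) = Gamma (a + 1)"
proof -
  have "(\<integral>t. indicator {0<..} t * (t powr a * exp (- t)) \<partial>lborel) = enn2real (\<integral>\<^sup>+t. ennreal (indicator {0<..} t * (t powr a * exp (- t))) \<partial>lborel)"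
    by (rule integral_eq_nn_integral) auto
  also have "(\<integral>\<^sup>+t. ennreal (indicator {0<..} t * (t powr a * exp (- t))) \<partial>lborel)
      = (\<integral>\<^sup>+t. ennreal (t powr ((a + 1) - 1) * exp (- t)) * indicator {0..} t \<partial>lborel)"
    by (intro nn_integral_cong) (auto simp: indicator_def)
  also have "\<dots> = ennreal (Gamma (a + 1))" using a by (intro nn_integral_Gamma) simp
  finally show ?thesis using a by (simp add: less_imp_le[OF Gamma_real_pos])
qed

lemma integrable_monom_weight:
  fixes a :: real
  assumes a: "a \<ge> 0" and S: "S \<in> sets borel" "S \<subseteq> {0<..}"
  shows "integrable lborel (\<lambda>t. indicator S t * (t ^ m * (t powr a * exp (- t))))"
proof (rule Bochner_Integration.integrable_bound[OF integrable_powr_exp[of "a + real m"]])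
  show "AE t in lborel. norm (indicator S t * (t ^ m * (t powr a * exp (- t)))) \<le> norm (indicator {0<..} t * (t powr (a + real m) * exp (- t)))"
  proof (rule AE_I2)
    fix t
    show "norm (indicator S t * (t ^ m * (t powr a * exp (- t)))) \<le> norm (indicator {0<..} t * (t powr (a + real m) * exp (- t)))"
    proof (cases "t \<in> S")
      case True
      hence "t > 0" using S(2) by auto
      thus ?thesis using True by (simp add: powr_add powr_realpow mult_ac)
    qed simp
  qed
qed (use a S in auto)

text \<open>The condition that all points lie in \<open>S\<close> is a product of indicators, so it
  can be attached with the weight to one of two Vandermonde factors, and Andreief yields a Hankel
  determinant. Numerator and denominator of the probability both have this form.\<close>

lemma lue_integral:
  assumes a: "p \<ge> real k" and S: "S \<in> sets borel" "S \<subseteq> {0<..}"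
  shows "integrable (PiM {..<k} (\<lambda>_. lborel)) (\<lambda>t. indicator {t. \<forall>j<k. t j \<in> S} t * lue_weight k p t)"
    and "(\<integral>t. indicator {t. \<forall>j<k. t j \<in> S} t * lue_weight k p t \<partial>(PiM {..<k} (\<lambda>_. lborel)))
    = fact k * Determinant.det (mat k k (\<lambda>(i,j). \<integral>t. indicator S t * (t ^ (i + j) * (t powr (p - real k) * exp (- t))) \<partial>lborel))"
proof -
  define \<phi> where "\<phi> i t = indicator S t * (t ^ i * (t powr (p - real k) * exp (- t)))" for i :: nat and t :: real
  define \<psi> where "\<psi> i t = t ^ i" for i :: nat and t :: real
  have a': "p - real k \<ge> 0" using a by simp
  have V: "Determinant.det (mat k k (\<lambda>(i,j). \<psi> j (x i))) = (\<Prod>j<k. \<Prod>i<j. x j - x i)" for x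
    using det_vandermonde_monic[of k "\<lambda>j. monom 1 j" x] by (simp add: poly_monom degree_monom_eq \<psi>_def)
  have "Determinant.det (mat k k (\<lambda>(i,j). \<phi> j (x i))) = (\<Prod>i<k. indicator S (x i) * (x i powr (p - real k) * exp (- x i))) * (\<Prod>j<k. \<Prod>i<j. x j - x i)" for x
    unfolding V[symmetric] \<phi>_def \<psi>_def by (simp add: det_mat_def sum_distrib_left prod.distrib mult_ac)
  hence F: "Determinant.det (mat k k (\<lambda>(i,j). \<phi> j (x i))) * Determinant.det (mat k k (\<lambda>(i,j). \<psi> j (x i)))
     = indicator {t. \<forall>j<k. t j \<in> S} x * lue_weight k p x" for x
  proof -
    have "(\<Prod>i<k. indicator S (x i) * (x i powr (p - real k) * exp (- x i))) = indicator {t. \<forall>j<k. t j \<in> S} x * (\<Prod>i<k. x i powr (p - real k) * exp (- x i))"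
      by (auto simp: indicator_def intro!: prod.cong)
    moreover have "(\<Prod>j<k. \<Prod>i<j. x j - x i) * (\<Prod>j<k. \<Prod>i<j. x j - x i) = (\<Prod>j<k. \<Prod>i<j. (x j - x i)\<^sup>2)"
      by (simp add: prod.distrib[symmetric] power2_eq_square)
    ultimately show ?thesis
      unfolding \<open>\<And>x. Determinant.det (mat k k (\<lambda>(i,j). \<phi> j (x i))) = _ x\<close> V lue_weight_def by (simp add: mult_ac)
  qed
  have int: "integrable lborel (\<lambda>t. \<phi> i t * \<psi> j t)" for i j
  proof -
    have "\<phi> i t * \<psi> j t = indicator S t * (t ^ (i + j) * (t powr (p - real k) * exp (- t)))" for t
      by (simp add: \<phi>_def \<psi>_def power_add mult_ac)
    thus ?thesis using integrable_monom_weight[OF a' S] by simp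
  qed
  have val: "(\<integral>t. \<phi> i t * \<psi> j t \<partial>lborel) = (\<integral>t. indicator S t * (t ^ (i + j) * (t powr (p - real k) * exp (- t))) \<partial>lborel)" for i j
    by (rule Bochner_Integration.integral_cong) (simp_all add: \<phi>_def \<psi>_def power_add mult_ac)
  show "integrable (PiM {..<k} (\<lambda>_. lborel)) (\<lambda>t. indicator {t. \<forall>j<k. t j \<in> S} t * lue_weight k p t)"
    using lborel.andreief(1)[where \<phi> = \<phi> and \<psi> = \<psi> and n = k, OF int] unfolding F .
  show "(\<integral>t. indicator {t. \<forall>j<k. t j \<in> S} t * lue_weight k p t \<partial>(PiM {..<k} (\<lambda>_. lborel)))
    = fact k * Determinant.det (mat k k (\<lambda>(i,j). \<integral>t. indicator S t * (t ^ (i + j) * (t powr (p - real k) * exp (- t))) \<partial>lborel))"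
    using lborel.andreief(2)[where \<phi> = \<phi> and \<psi> = \<psi> and n = k, OF int] unfolding F val .
qed

text \<open>Gamma(a+i+j)/Gamma(a+i) is a rising factorial, a monic polynomial of degree j in i. What
  remains is a Vandermonde determinant with nodes 0, ..., k-1.\<close>

lemma det_gamma_hankel:
  fixes a :: real
  assumes a: "a > 0"
  shows "Determinant.det (mat k k (\<lambda>(i,j). Gamma (a + real (i + j)))) = (\<Prod>j<k. Gamma (a + real j)) * (\<Prod>j<k. fact j)"
proof -
  define q where "q i = (\<Prod>m<i. [:a + real m, 1:])" for i :: nat
  have q: "degree (q j) = j" "lead_coeff (q j) = 1" for j
  proof -
    show d: "degree (q j) = j" unfolding q_def by (subst degree_prod_eq_sum_degree) auto
    show "lead_coeff (q j) = 1" unfolding q_def by (subst lead_coeff_prod) auto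
  qed
  have G: "Gamma (a + real (i + j)) = Gamma (a + real i) * poly (q j) (real i)" for i j
  proof (induction j)
    case (Suc j)
    have "a + real (i + j) > 0" using a by simp
    hence "Gamma (a + real (i + j) + 1) = (a + real (i + j)) * Gamma (a + real (i + j))"
      using Gamma_plus1[of "a + real (i + j)"] by (auto simp: nonpos_Ints_def)
    thus ?case using Suc by (simp add: q_def algebra_simps)
  qed (simp add: q_def)
  have "mat k k (\<lambda>(i,j). Gamma (a + real (i + j))) = mat k k (\<lambda>(i,j). Gamma (a + real i) * 1 * poly (q j) (real i))"
    by (rule eq_matI) (simp_all only: index_mat dim_row_mat dim_col_mat prod.case G mult_1_right)
  hence "Determinant.det (mat k k (\<lambda>(i,j). Gamma (a + real (i + j)))) = (\<Prod>j<k. Gamma (a + real j)) * Determinant.det (mat k k (\<lambda>(i,j). poly (q j) (real i)))"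
    by (simp add: det_mat_def sum_distrib_left prod.distrib mult_ac)
  also have "Determinant.det (mat k k (\<lambda>(i,j). poly (q j) (real i))) = (\<Prod>j<k. \<Prod>i<j. real j - real i)"
    by (rule det_vandermonde_monic) (use q in auto)
  also have "\<dots> = (\<Prod>j<k. fact j)"
  proof (rule prod.cong[OF refl])
    fix j :: nat
    have "(\<Prod>i<j. real j - real i) = (\<Prod>i<j. real (Suc i))"
      by (rule prod.reindex_bij_witness[of _ "\<lambda>i. j - Suc i" "\<lambda>i. j - Suc i"]) auto
    thus "(\<Prod>i<j. real j - real i) = fact j" by (simp add: fact_prod_Suc atLeast0LessThan)
  qed
  finally show ?thesis .
qed

text \<open>The moments over the whole half-line are Gamma values; reversing the product index turns
  p - k + 1 + j into p - j.\<close>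

lemma lue_norm_const:
  assumes k: "p \<ge> real k"
  shows "(\<integral>t. indicator {t. \<forall>j<k. 0 < t j} t * lue_weight k p t \<partial>(PiM {..<k} (\<lambda>_. lborel)))
    = fact k * ((\<Prod>j<k. Gamma (p - real j)) * (\<Prod>j<k. fact j))"
proof -
  have "(\<integral>t. indicator {0<..} t * (t ^ m * (t powr (p - real k) * exp (- t))) \<partial>lborel) = Gamma (p - real k + 1 + real m)" for m
  proof -
    have "(\<integral>t. indicator {0<..} t * (t ^ m * (t powr (p - real k) * exp (- t))) \<partial>lborel) = (\<integral>t. indicator {0<..} t * (t powr (p - real k + real m) * exp (- t)) \<partial>lborel)"
      by (intro Bochner_Integration.integral_cong) (auto simp: indicator_def powr_add powr_realpow)
    also have "\<dots> = Gamma (p - real k + real m + 1)" using k by (intro integral_powr_exp) simp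
    finally show ?thesis by (simp add: add_ac)
  qed
  hence "Determinant.det (mat k k (\<lambda>(i,j). \<integral>t. indicator {0<..} t * (t ^ (i + j) * (t powr (p - real k) * exp (- t))) \<partial>lborel))
     = (\<Prod>j<k. Gamma (p - real k + 1 + real j)) * (\<Prod>j<k. fact j)"
    using det_gamma_hankel[of "p - real k + 1" k] k by simp
  also have "(\<Prod>j<k. Gamma (p - real k + 1 + real j)) = (\<Prod>j<k. Gamma (p - real j))"
    by (rule prod.reindex_bij_witness[of _ "\<lambda>i. k - Suc i" "\<lambda>i. k - Suc i"]) (auto simp: of_nat_diff algebra_simps)
  finally show ?thesis using lue_integral(2)[OF k, of "{0<..}"] by simp
qed

lemma lue_max_prob_eq:
  assumes k: "p \<ge> real k"
  shows "lue_max_prob k p r = Determinant.det (mat k k (\<lambda>(i,j). lower_moment (p - real k) r (monom 1 (i + j))))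
     / ((\<Prod>j<k. Gamma (p - real j)) * (\<Prod>j<k. fact j))"
proof -
  have s: "{0<..<r} \<subseteq> {0<..}" by auto
  have num: "(\<integral>t. indicator {t. \<forall>j<k. 0 < t j \<and> t j < r} t * lue_weight k p t \<partial>(PiM {..<k} (\<lambda>_. lborel)))
    = fact k * Determinant.det (mat k k (\<lambda>(i,j). lower_moment (p - real k) r (monom 1 (i + j))))"
    using lue_integral(2)[OF k, of "{0<..<r}"] s by (simp add: lower_moment_def poly_monom)
  show ?thesis unfolding lue_max_prob_def num lue_norm_const[OF k] by simp
qed

text \<open>An asymptotic equivalence obtained from a quotient needs a nonzero limit, and the
  probability is the factor of that limit whose positivity is not visible.\<close>

lemma lue_max_prob_pos:
  assumes k: "p \<ge> real k" and r: "r > 0"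
  shows "lue_max_prob k p r > 0"
proof -
  \<comment> \<open>Consecutive disjoint subintervals of (0, r), one for each coordinate: on their
    product the points are distinct and the density is positive.\<close>
  define S where "S j = {r * real j / real k <..< r * real (Suc j) / real k}" for j
  define f where "f t = indicator {t. \<forall>j<k. 0 < t j \<and> t j < r} t * lue_weight k p t" for t :: "nat \<Rightarrow> real"
  interpret P: product_sigma_finite "\<lambda>_::nat. lborel :: real measure" by standard
  have fnn: "f t \<ge> 0" for t unfolding f_def lue_weight_def by (intro mult_nonneg_nonneg prod_nonneg) auto
  have fpos: "f t > 0" if t: "t \<in> Pi\<^sub>E {..<k} S" for t
  proof -
    have b: "0 < t j \<and> t j < r" and b': "r * real j / real k < t j \<and> t j < r * real (Suc j) / real k" if "j < k" for j
    proof -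
      show 1: "r * real j / real k < t j \<and> t j < r * real (Suc j) / real k" using t that by (auto simp: S_def PiE_iff)
      have "0 \<le> r * real j / real k" using r by simp
      moreover have "r * real (Suc j) / real k \<le> r"
        using r that mult_left_mono[of "real (Suc j)" "real k" r] by (simp add: pos_divide_le_eq)
      ultimately show "0 < t j \<and> t j < r" using 1 by linarith
    qed
    have ne: "t j \<noteq> t i" if "i < j" "j < k" for i j
    proof -
      have "r * real (Suc i) / real k \<le> r * real j / real k"
        using that r by (intro divide_right_mono mult_left_mono) auto
      thus ?thesis using b'[of i] b'[of j] that by linarith
    qed
    show ?thesis unfolding f_def lue_weight_def
      using b ne by (auto intro!: mult_pos_pos prod_pos simp: zero_less_power2) (metis b less_irrefl less_trans)+
  qed
  have int: "(\<integral>t. f t \<partial>(PiM {..<k} (\<lambda>_. lborel))) > 0" if I: "integrable (PiM {..<k} (\<lambda>_. lborel)) f"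
  proof (rule ccontr)
    assume "\<not> ?thesis"
    hence "(\<integral>t. f t \<partial>(PiM {..<k} (\<lambda>_. lborel))) = 0"
      using Bochner_Integration.integral_nonneg[where M = "PiM {..<k} (\<lambda>_. lborel)" and f = f, OF fnn] by linarith
    hence "AE t in PiM {..<k} (\<lambda>_. lborel). f t = 0"
      using integral_nonneg_eq_0_iff_AE[OF I] fnn by auto
    hence "AE t in PiM {..<k} (\<lambda>_. lborel). t \<notin> Pi\<^sub>E {..<k} S"
      by eventually_elim (use fpos in force)
    moreover have "Pi\<^sub>E {..<k} S \<in> sets (PiM {..<k} (\<lambda>_. lborel))" by (intro sets_PiM_I_finite) (auto simp: S_def)
    ultimately have "emeasure (PiM {..<k} (\<lambda>_. lborel)) (Pi\<^sub>E {..<k} S) = 0"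
      using AE_iff_null_sets[of "Pi\<^sub>E {..<k} S" "PiM {..<k} (\<lambda>_. lborel)"] by auto
    moreover have "emeasure (PiM {..<k} (\<lambda>_. lborel)) (Pi\<^sub>E {..<k} S) = (\<Prod>j<k. emeasure lborel (S j))"
      by (intro P.emeasure_PiM) (auto simp: S_def)
    ultimately have "\<exists>j<k. emeasure lborel (S j) = 0" by (auto simp: prod_zero_iff)
    thus False using r by (auto simp: S_def divide_right_mono mult_left_mono diff_divide_distrib[symmetric] algebra_simps)
  qed
  have s: "{0<..<r} \<subseteq> {0<..}" by auto
  have "(\<integral>t. f t \<partial>(PiM {..<k} (\<lambda>_. lborel))) > 0"
    using lue_integral(1)[OF k, of "{0<..<r}"] s unfolding f_def[symmetric] by (intro int) (simp add: f_def[abs_def])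
  moreover have "fact k * ((\<Prod>j<k. Gamma (p - real j)) * (\<Prod>j<k. fact j)) > (0::real)"
    using k by (intro mult_pos_pos prod_pos) (auto intro!: Gamma_real_pos)
  ultimately show ?thesis unfolding lue_max_prob_def lue_norm_const[OF k] f_def by (rule divide_pos_pos)
qed

section \<open>Incomplete Gamma integrals as power series\<close>

lemma nn_integral_beta_scaled:
  assumes \<beta>: "\<beta> > 0" and r: "r > 0"
  shows "(\<integral>\<^sup>+t. ennreal (indicator {0<..<r} t * (t powr (\<beta> - 1) * (r - t) ^ n)) \<partial>lborel) = ennreal (r powr (\<beta> + real n) * Beta \<beta> (real n + 1))"
proof -
  have "((\<lambda>t. t powr (\<beta> - 1) * (1 - t) powr ((real n + 1) - 1)) has_integral Beta \<beta> (real n + 1)) {0..1}"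
    by (rule has_integral_Beta_real) (use \<beta> in auto)
  from nn_integral_has_integral_lebesgue[OF _ this]
  have b: "(\<integral>\<^sup>+t. ennreal (indicator {0..1} t * (t powr (\<beta> - 1) * (1 - t) powr real n)) \<partial>lborel) = ennreal (Beta \<beta> (real n + 1))"
    by simp
  have "(\<integral>\<^sup>+t. ennreal (indicator {0<..<r} t * (t powr (\<beta> - 1) * (r - t) ^ n)) \<partial>lborel)
     = ennreal r * (\<integral>\<^sup>+s. ennreal (indicator {0<..<r} (0 + r * s) * ((0 + r * s) powr (\<beta> - 1) * (r - (0 + r * s)) ^ n)) \<partial>lborel)"
    using r by (subst nn_integral_real_affine[of _ r 0]) auto
  also have "(\<integral>\<^sup>+s. ennreal (indicator {0<..<r} (0 + r * s) * ((0 + r * s) powr (\<beta> - 1) * (r - (0 + r * s)) ^ n)) \<partial>lborel)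
     = (\<integral>\<^sup>+s. ennreal (r powr (\<beta> - 1 + real n)) * ennreal (indicator {0..1} s * (s powr (\<beta> - 1) * (1 - s) powr real n)) \<partial>lborel)"
  proof (rule nn_integral_cong_AE)
    have "AE s in lborel. s \<noteq> (0::real)" "AE s in lborel. s \<noteq> (1::real)" by (rule AE_lborel_singleton)+
    thus "AE s in lborel. ennreal (indicator {0<..<r} (0 + r * s) * ((0 + r * s) powr (\<beta> - 1) * (r - (0 + r * s)) ^ n))
       = ennreal (r powr (\<beta> - 1 + real n)) * ennreal (indicator {0..1} s * (s powr (\<beta> - 1) * (1 - s) powr real n))"
    proof eventually_elim
      case (elim s)
      show ?case
      proof (cases "0 < s \<and> s < 1")
        case True
        have "r - (0 + r * s) = r * (1 - s)" by (simp add: algebra_simps)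
        hence "(0 + r * s) powr (\<beta> - 1) * (r - (0 + r * s)) ^ n = r powr (\<beta> - 1 + real n) * (s powr (\<beta> - 1) * (1 - s) powr real n)"
          using True r by (simp add: powr_mult powr_add powr_realpow power_mult_distrib mult_ac)
        moreover have "0 + r * s \<in> {0<..<r}" using True r by (auto simp: mult_less_cancel_left2)
        ultimately show ?thesis using True by (simp add: ennreal_mult[symmetric])
      next
        case False
        hence "s < 0 \<or> s > 1" using elim by auto
        hence "0 + r * s \<notin> {0<..<r}" using r by (auto simp: zero_less_mult_iff mult_less_cancel_left2)
        thus ?thesis using \<open>s < 0 \<or> s > 1\<close> by (auto simp: indicator_def)
      qed
    qed
  qed
  also have "\<dots> = ennreal (r powr (\<beta> - 1 + real n)) * ennreal (Beta \<beta> (real n + 1))"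
    by (subst nn_integral_cmult) (auto simp: b)
  also have "ennreal r * \<dots> = ennreal (r powr (\<beta> + real n) * Beta \<beta> (real n + 1))"
  proof -
    have "r * r powr (\<beta> - 1 + real n) = r powr (\<beta> + real n)"
      using r powr_add[of r 1 "\<beta> - 1 + real n"] by (simp add: add_ac)
    moreover have "Beta \<beta> (real n + 1) \<ge> 0" using \<beta> by (simp add: Beta_def Gamma_real_pos less_imp_le)
    ultimately show ?thesis using r by (simp add: ennreal_mult[symmetric] mult.assoc[symmetric])
  qed
  finally show ?thesis .
qed

text \<open>Expand exp(r - t) in powers of r - t; together with t^(\<beta>-1) each term is a Beta
  integral. All terms are nonnegative on the interval, which justifies integrating termwise.\<close>

lemma incomplete_gamma_series:
  assumes \<beta>: "\<beta> > 0" and r: "r > 0"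
  shows "(\<lambda>m. r powr (\<beta> + real m) * (fact (m + a) * Gamma \<beta> / (fact m * Gamma (\<beta> + real (m + a) + 1)))) sums
     (exp r * (\<integral>t. indicator {0<..<r} t * ((1 - t / r) ^ a * t powr (\<beta> - 1) * exp (- t)) \<partial>lborel))"
proof -
  define c where "c m = r powr (\<beta> + real m) * (fact (m + a) * Gamma \<beta> / (fact m * Gamma (\<beta> + real (m + a) + 1)))" for m
  have G: "Gamma (\<beta> + real m + 1) > 0" for m using \<beta> by (intro Gamma_real_pos) simp
  have c0: "c m \<ge> 0" for m unfolding c_def using G[of "m + a"] \<beta> by (intro mult_nonneg_nonneg divide_nonneg_nonneg) (auto intro: less_imp_le Gamma_real_pos)
  let ?g = "\<lambda>t. exp r * (indicator {0<..<r} t * ((1 - t / r) ^ a * t powr (\<beta> - 1) * exp (- t)))"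
  let ?h = "\<lambda>m t. (1 / (r ^ a * fact m)) * (indicator {0<..<r} t * (t powr (\<beta> - 1) * (r - t) ^ (m + a)))"
  have h0: "?h m t \<ge> 0" for m t using r by (auto simp: indicator_def)
  have ser: "(\<lambda>m. ?h m t) sums ?g t" for t
  proof (cases "t \<in> {0<..<r}")
    case True
    have "(\<lambda>m. (r - t) ^ m /\<^sub>R fact m) sums exp (r - t)" by (rule exp_converges)
    hence "(\<lambda>m. (1 - t / r) ^ a * t powr (\<beta> - 1) * ((r - t) ^ m /\<^sub>R fact m)) sums ((1 - t / r) ^ a * t powr (\<beta> - 1) * exp (r - t))"
      by (rule sums_mult)
    moreover have "(1 - t / r) ^ a = (r - t) ^ a / r ^ a" using r by (simp add: power_divide[symmetric] diff_divide_distrib)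
    ultimately show ?thesis using True
      by (simp add: power_add exp_diff exp_minus divide_inverse mult_ac)
  qed auto
  have hint: "(\<integral>\<^sup>+t. ennreal (?h m t) \<partial>lborel) = ennreal (c m)" for m
  proof -
    have "(\<integral>\<^sup>+t. ennreal (?h m t) \<partial>lborel) = ennreal (1 / (r ^ a * fact m)) * (\<integral>\<^sup>+t. ennreal (indicator {0<..<r} t * (t powr (\<beta> - 1) * (r - t) ^ (m + a))) \<partial>lborel)"
      using r by (subst nn_integral_cmult[symmetric]) (auto simp: ennreal_mult'[symmetric])
    also have "\<dots> = ennreal (1 / (r ^ a * fact m) * (r powr (\<beta> + real (m + a)) * Beta \<beta> (real (m + a) + 1)))"
      unfolding nn_integral_beta_scaled[OF \<beta> r] using r by (intro ennreal_mult'[symmetric]) auto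
    also have "1 / (r ^ a * fact m) * (r powr (\<beta> + real (m + a)) * Beta \<beta> (real (m + a) + 1)) = c m"
    proof -
      have "r powr (\<beta> + real (m + a)) = r powr (\<beta> + real m) * r ^ a"
        using r by (simp add: powr_realpow[symmetric] powr_add[symmetric] add_ac)
      moreover have "Gamma (real (m + a) + 1) = fact (m + a)" by (metis Gamma_fact add.commute)
      ultimately show ?thesis using r by (simp add: c_def Beta_def add_ac)
    qed
    finally show ?thesis .
  qed
  have meas: "(\<lambda>t. ?g t) \<in> borel_measurable lborel" by measurable
  have "(\<integral>\<^sup>+t. ennreal (?g t) \<partial>lborel) = (\<integral>\<^sup>+t. (\<Sum>m. ennreal (?h m t)) \<partial>lborel)"
    by (intro nn_integral_cong suminf_ennreal_eq[OF h0 ser, symmetric])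
  also have "\<dots> = (\<Sum>m. \<integral>\<^sup>+t. ennreal (?h m t) \<partial>lborel)" by (rule nn_integral_suminf) measurable
  also have "\<dots> = (\<Sum>m. ennreal (c m))" unfolding hint ..
  finally have E: "(\<integral>\<^sup>+t. ennreal (?g t) \<partial>lborel) = (\<Sum>m. ennreal (c m))" .
  have g0: "?g t \<ge> 0" for t using r by (auto simp: indicator_def)
  have gint: "integrable lborel ?g"
  proof (rule Bochner_Integration.integrable_bound[where f = "\<lambda>t. exp r * (indicator {0<..<r} t * (t powr (\<beta> - 1)))"])
    have "integrable lborel (\<lambda>t. indicator {0<..<r} t * (t powr (\<beta> - 1)))"
    proof (rule integrableI_bounded)
      have "(\<integral>\<^sup>+t. ennreal (norm (indicator {0<..<r} t * (t powr (\<beta> - 1)))) \<partial>lborel) = (\<integral>\<^sup>+t. ennreal (indicator {0<..<r} t * (t powr (\<beta> - 1) * (r - t) ^ 0)) \<partial>lborel)"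
        by (intro nn_integral_cong) (auto simp: indicator_def)
      also have "\<dots> < \<infinity>" unfolding nn_integral_beta_scaled[OF \<beta> r] by simp
      finally show "(\<integral>\<^sup>+t. ennreal (norm (indicator {0<..<r} t * (t powr (\<beta> - 1)))) \<partial>lborel) < \<infinity>" .
    qed measurable
    thus "integrable lborel (\<lambda>t. exp r * (indicator {0<..<r} t * (t powr (\<beta> - 1))))" by simp
    show "AE t in lborel. norm (?g t) \<le> norm (exp r * (indicator {0<..<r} t * (t powr (\<beta> - 1))))"
    proof (rule AE_I2)
      fix t
      show "norm (?g t) \<le> norm (exp r * (indicator {0<..<r} t * (t powr (\<beta> - 1))))"
      proof (cases "t \<in> {0<..<r}")
        case True
        hence "0 \<le> (1 - t / r) ^ a" "(1 - t / r) ^ a \<le> 1" "exp (- t) \<le> 1" using r by (auto intro!: power_le_one)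
        hence "(1 - t / r) ^ a * exp (- t) * t powr (\<beta> - 1) \<le> 1 * t powr (\<beta> - 1)"
          by (intro mult_right_mono mult_le_one) auto
        thus ?thesis using True \<open>0 \<le> (1 - t / r) ^ a\<close> by (simp add: abs_mult mult_ac)
      qed auto
    qed
  qed measurable
  have int: "(\<integral>\<^sup>+t. ennreal (?g t) \<partial>lborel) = ennreal (\<integral>t. ?g t \<partial>lborel)"
    by (rule nn_integral_eq_integral[OF gint]) (use g0 in auto)
  have "(\<lambda>m. ennreal (c m)) sums ennreal (\<integral>t. ?g t \<partial>lborel)"
    using E int by (metis summable_sums summableI)
  hence "c sums (\<integral>t. ?g t \<partial>lborel)"
    using sums_ennreal[of c "\<integral>t. ?g t \<partial>lborel"] c0 Bochner_Integration.integral_nonneg[where f = ?g and M = lborel, OF g0] by blast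
  thus ?thesis unfolding c_def by simp
qed

section \<open>Limit of the Wronskian determinant\<close>

lemma tendsto_det:
  fixes f :: "'b \<Rightarrow> nat \<Rightarrow> nat \<Rightarrow> real"
  assumes "\<And>i j. i < n \<Longrightarrow> j < n \<Longrightarrow> ((\<lambda>m. f m i j) \<longlongrightarrow> g i j) F"
  shows "((\<lambda>m. Determinant.det (mat n n (\<lambda>(i,j). f m i j))) \<longlongrightarrow> Determinant.det (mat n n (\<lambda>(i,j). g i j))) F"
  unfolding det_mat_def prod.case
  by (intro tendsto_intros assms) (auto simp: permutes_in_image[of _ "{..<n}", unfolded lessThan_iff])

text \<open>The sign of the reversal need not be followed, because the determinant in the moment
  formula is shown to be nonnegative by other means.\<close>

lemma abs_det_column_reversal:
  fixes g :: "nat \<Rightarrow> nat \<Rightarrow> real"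
  shows "\<bar>Determinant.det (mat n n (\<lambda>(i,j). g i (n - 1 - j)))\<bar> = \<bar>Determinant.det (mat n n (\<lambda>(i,j). g i j))\<bar>"
proof -
  define \<rho> where "\<rho> j = (if j < n then n - 1 - j else j)" for j
  have \<rho>: "\<rho> permutes {0..<n}"
    by (rule bij_imp_permutes, rule bij_betw_byWitness[where f' = \<rho>]) (auto simp: \<rho>_def)
  let ?A = "transpose_mat (mat n n (\<lambda>(i,j). g i j))"
  have "mat n n (\<lambda>(i,j). ?A $$ (\<rho> i, j)) = transpose_mat (mat n n (\<lambda>(i,j). g i (n - 1 - j)))"
    by (rule eq_matI) (auto simp: \<rho>_def)
  with det_permute_rows[OF _ \<rho>, of ?A]
  have "Determinant.det (transpose_mat (mat n n (\<lambda>(i,j). g i (n - 1 - j)))) = signof \<rho> * Determinant.det ?A"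
    by simp
  moreover have "Determinant.det ?A = Determinant.det (mat n n (\<lambda>(i,j). g i j))"
    "Determinant.det (transpose_mat (mat n n (\<lambda>(i,j). g i (n - 1 - j)))) = Determinant.det (mat n n (\<lambda>(i,j). g i (n - 1 - j)))"
    by (rule det_transpose[where n = n], simp)+
  moreover have "\<bar>signof \<rho> :: real\<bar> = 1" by (simp add: sign_def)
  ultimately show ?thesis by (simp only: abs_mult mult_1_left)
qed

text \<open>For \<gamma> = 0 the weight is that of the Charlier polynomials, a Poisson weight
  without its normalization. The limiting matrix entries are values of this functional on products
  of falling factorials.\<close>

definition charlier_sum :: "real \<Rightarrow> real \<Rightarrow> real poly \<Rightarrow> real" where
  "charlier_sum \<gamma> r p = (\<Sum>l. poly p (real l) * (r ^ l / Gamma (\<gamma> + real l + 1)))"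

text \<open>A crude exponential bound, which is absorbed by the factorial decay of the
  weight.\<close>

lemma poly_le_geometric:
  fixes p :: "real poly"
  shows "\<exists>C B. B \<ge> 0 \<and> C \<ge> 0 \<and> (\<forall>l. \<bar>poly p (real l)\<bar> \<le> C * B ^ l)"
proof (induction p)
  case 0
  show ?case by (intro exI[of _ 0]) auto
next
  case (pCons a p)
  then obtain C B where B: "B \<ge> 0" "C \<ge> 0" "\<And>l. \<bar>poly p (real l)\<bar> \<le> C * B ^ l" by auto
  have "\<bar>poly (pCons a p) (real l)\<bar> \<le> (\<bar>a\<bar> + C) * (2 * B + 1) ^ l" for l
  proof -
    have l2: "real l \<le> 2 ^ l" using of_nat_less_two_power[of l, where 'a = real] by simp
    have "\<bar>poly (pCons a p) (real l)\<bar> \<le> \<bar>a\<bar> + real l * \<bar>poly p (real l)\<bar>"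
      using abs_triangle_ineq[of a "real l * poly p (real l)"] by (simp add: abs_mult)
    also have "real l * \<bar>poly p (real l)\<bar> \<le> 2 ^ l * (C * B ^ l)"
      using B l2 by (intro mult_mono) auto
    also have "2 ^ l * (C * B ^ l) = C * (2 * B) ^ l" by (simp add: power_mult_distrib)
    also have "\<dots> \<le> C * (2 * B + 1) ^ l" using B by (intro mult_left_mono power_mono) auto
    also have "\<bar>a\<bar> + C * (2 * B + 1) ^ l \<le> \<bar>a\<bar> * (2 * B + 1) ^ l + C * (2 * B + 1) ^ l"
      using B mult_left_mono[of 1 "(2 * B + 1) ^ l" "\<bar>a\<bar>"] by (simp add: one_le_power)
    finally show ?thesis by (simp add: algebra_simps)
  qed
  thus ?case using B by (intro exI[of _ "\<bar>a\<bar> + C"] exI[of _ "2 * B + 1"]) auto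
qed

lemma Gamma_ge_fact:
  assumes "\<gamma> \<ge> 0"
  shows "Gamma (\<gamma> + real l + 1) \<ge> fact l * Gamma (\<gamma> + 1)"
proof (induction l)
  case (Suc l)
  have "Gamma (\<gamma> + 1) > 0" using assms by (intro Gamma_real_pos) simp
  hence "fact (Suc l) * Gamma (\<gamma> + 1) \<le> (\<gamma> + real l + 1) * (fact l * Gamma (\<gamma> + 1))"
    using assms by (simp add: mult_right_mono mult.assoc)
  also have "\<dots> \<le> (\<gamma> + real l + 1) * Gamma (\<gamma> + real l + 1)" using Suc assms by (intro mult_left_mono) auto
  also have "\<dots> = Gamma (\<gamma> + real l + 1 + 1)" using assms by (subst Gamma_plus1) (auto simp: nonpos_Ints_def)
  finally show ?case by (simp add: add_ac)
qed simp

lemma summable_charlier_sum: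
  assumes \<gamma>: "\<gamma> \<ge> 0" and r: "r > 0"
  shows "summable (\<lambda>l. poly p (real l) * (r ^ l / Gamma (\<gamma> + real l + 1)))"
proof -
  obtain C B where B: "B \<ge> 0" "C \<ge> 0" "\<And>l. \<bar>poly p (real l)\<bar> \<le> C * B ^ l" using poly_le_geometric by blast
  have G1: "Gamma (\<gamma> + 1) > 0" using \<gamma> by (intro Gamma_real_pos) simp
  show ?thesis
  proof (rule summable_comparison_test')
    show "summable (\<lambda>l. C / Gamma (\<gamma> + 1) * ((B * r) ^ l /\<^sub>R fact l))"
      by (intro summable_mult summable_exp_generic)
    fix l :: nat
    have G: "Gamma (\<gamma> + real l + 1) > 0" using \<gamma> by (intro Gamma_real_pos) simp
    have "norm (poly p (real l) * (r ^ l / Gamma (\<gamma> + real l + 1))) = \<bar>poly p (real l)\<bar> * (r ^ l / Gamma (\<gamma> + real l + 1))"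
      using r G by (simp add: abs_mult)
    also have "\<dots> \<le> C * B ^ l * (r ^ l / (fact l * Gamma (\<gamma> + 1)))"
      using B r G G1 Gamma_ge_fact[OF \<gamma>, of l] by (intro mult_mono divide_left_mono mult_pos_pos) auto
    also have "\<dots> = C / Gamma (\<gamma> + 1) * ((B * r) ^ l /\<^sub>R fact l)"
      by (simp add: power_mult_distrib field_simps)
    finally show "norm (poly p (real l) * (r ^ l / Gamma (\<gamma> + real l + 1))) \<le> C / Gamma (\<gamma> + 1) * ((B * r) ^ l /\<^sub>R fact l)" .
  qed
qed

lemma charlier_sum_linear:
  assumes "\<gamma> \<ge> 0" "r > 0"
  shows "charlier_sum \<gamma> r (p + q) = charlier_sum \<gamma> r p + charlier_sum \<gamma> r q"
    and "charlier_sum \<gamma> r (Polynomial.smult c p) = c * charlier_sum \<gamma> r p"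
  unfolding charlier_sum_def
  using suminf_add[OF summable_charlier_sum[OF assms, of p] summable_charlier_sum[OF assms, of q]]
    suminf_mult[OF summable_charlier_sum[OF assms, of p], of c]
  by (simp_all add: distrib_right add_divide_distrib mult.assoc)

text \<open>At x this is the falling factorial of x + c with n factors. With c = 0 it produces
  binomial coefficients, with c = \<gamma> it lowers the argument of Gamma in the weight.\<close>

definition falling_poly :: "real \<Rightarrow> nat \<Rightarrow> real poly" where
  "falling_poly c n = (\<Prod>m<n. [:c - real m, 1:])"

lemma falling_poly_monic: "degree (falling_poly c n) = n" "lead_coeff (falling_poly c n) = 1"
proof -
  show "degree (falling_poly c n) = n" unfolding falling_poly_def by (subst degree_prod_eq_sum_degree) auto
  show "lead_coeff (falling_poly c n) = 1" unfolding falling_poly_def by (subst lead_coeff_prod) auto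
qed

lemma poly_falling_poly_0: "poly (falling_poly 0 a) (real l) = fact a * real (l choose a)"
proof -
  have "real (l choose a) = (\<Prod>i<a. real l - real i) / fact a"
    unfolding binomial_gbinomial gbinomial_prod_rev by (simp add: atLeast0LessThan)
  moreover have "poly (falling_poly 0 a) (real l) = (\<Prod>i<a. real l - real i)"
    unfolding falling_poly_def poly_prod by (intro prod.cong) auto
  ultimately show ?thesis by simp
qed

lemma poly_falling_poly_Gamma:
  assumes "real b \<le> \<gamma>"
  shows "poly (falling_poly \<gamma> b) (real l) / Gamma (\<gamma> + real l + 1) = 1 / Gamma (\<gamma> - real b + real l + 1)"
  using assms
proof (induction b)
  case (Suc b)
  have "\<gamma> - real b + real l > 0" using Suc.prems by simp
  hence "Gamma (\<gamma> - real b + real l + 1) = (\<gamma> - real b + real l) * Gamma (\<gamma> - real b + real l)"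
    by (intro Gamma_plus1) (auto simp: nonpos_Ints_def)
  moreover have "poly (falling_poly \<gamma> (Suc b)) (real l) / Gamma (\<gamma> + real l + 1) = (\<gamma> - real b + real l) * (1 / Gamma (\<gamma> - real b + real l + 1))"
  proof -
    have "poly (falling_poly \<gamma> (Suc b)) (real l) = (\<gamma> - real b + real l) * poly (falling_poly \<gamma> b) (real l)"
      by (simp add: falling_poly_def algebra_simps)
    moreover have "poly (falling_poly \<gamma> b) (real l) / Gamma (\<gamma> + real l + 1) = 1 / Gamma (\<gamma> - real b + real l + 1)"
      using Suc by simp
    ultimately show ?thesis by (metis times_divide_eq_right)
  qed
  moreover have "Gamma (\<gamma> - real (Suc b) + real l + 1) = Gamma (\<gamma> - real b + real l)" by (rule arg_cong) simp
  ultimately show ?case using \<open>\<gamma> - real b + real l > 0\<close> by (simp only:) simp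
qed (simp add: falling_poly_def)

lemma wronskian_sum_tendsto:
  assumes \<gamma>: "\<gamma> \<ge> 0" and r: "r > 0"
  shows "(\<lambda>n. wronskian_sum \<gamma> r n a b) \<longlonglongrightarrow> charlier_sum \<gamma> r (falling_poly 0 a * falling_poly 0 b) / (fact a * fact b)"
proof -
  have "(\<lambda>n. (\<Sum>l<n. poly (falling_poly 0 a * falling_poly 0 b) (real l) * (r ^ l / Gamma (\<gamma> + real l + 1))) / (fact a * fact b))
     \<longlonglongrightarrow> charlier_sum \<gamma> r (falling_poly 0 a * falling_poly 0 b) / (fact a * fact b)"
    unfolding charlier_sum_def by (intro tendsto_divide summable_LIMSEQ summable_charlier_sum assms tendsto_const) auto
  moreover have "(\<Sum>l<n. poly (falling_poly 0 a * falling_poly 0 b) (real l) * (r ^ l / Gamma (\<gamma> + real l + 1))) / (fact a * fact b) = wronskian_sum \<gamma> r n a b" for n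
    unfolding wronskian_sum_def sum_divide_distrib
    by (intro sum.cong refl) (simp add: poly_falling_poly_0)
  ultimately show ?thesis by simp
qed

lemma lower_moment_linear:
  assumes a: "a \<ge> 0"
  shows "lower_moment a r (p + q) = lower_moment a r p + lower_moment a r q"
    and "lower_moment a r (Polynomial.smult c p) = c * lower_moment a r p"
proof -
  have int: "integrable lborel (\<lambda>t. indicator {0<..<r} t * (poly p t * (t powr a * exp (- t))))" for p
  proof -
    have "integrable lborel (\<lambda>t. \<Sum>i\<le>degree p. coeff p i * (indicator {0<..<r} t * (t ^ i * (t powr a * exp (- t)))))"
      by (intro Bochner_Integration.integrable_sum integrable_mult_right integrable_monom_weight[OF a]) auto
    thus ?thesis by (simp add: poly_altdef sum_distrib_left sum_distrib_right mult_ac)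
  qed
  show "lower_moment a r (p + q) = lower_moment a r p + lower_moment a r q"
    unfolding lower_moment_def using Bochner_Integration.integral_add[OF int[of p] int[of q]]
    by (simp add: distrib_left distrib_right)
  show "lower_moment a r (Polynomial.smult c p) = c * lower_moment a r p"
    unfolding lower_moment_def by (subst integral_mult_right_zero[symmetric]) (simp add: mult_ac)
qed

text \<open>The factor with c = \<gamma> turns 1/Gamma(\<gamma>+l+1) into 1/Gamma(\<gamma>-b+l+1).
  The factor with c = 0 vanishes for l < a, so the sum starts at l = a and is the series of an
  incomplete Gamma integral. Splitting the exponent \<gamma> - b - 1 as (k-1-b) + (\<gamma>-k) makes
  the weight the same for all b.\<close>

lemma charlier_sum_falling:
  assumes k: "real k \<le> \<gamma>" and b: "b < k" and r: "r > 0"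
  shows "charlier_sum \<gamma> r (falling_poly 0 a * falling_poly \<gamma> b)
    = (-1) ^ a * (exp r * r powr (real b - \<gamma>) / Gamma (\<gamma> - real b)) * lower_moment (\<gamma> - real k) r ([:- r, 1:] ^ a * monom 1 (k - 1 - b))"
proof -
  define \<beta> where "\<beta> = \<gamma> - real b"
  have \<beta>: "\<beta> > 0" and \<gamma>: "\<gamma> \<ge> 0" and b\<gamma>: "real b \<le> \<gamma>" using k b by (auto simp: \<beta>_def)
  have G: "Gamma \<beta> > 0" using \<beta> by (rule Gamma_real_pos)
  let ?f = "\<lambda>l. poly (falling_poly 0 a * falling_poly \<gamma> b) (real l) * (r ^ l / Gamma (\<gamma> + real l + 1))"
  let ?c = "\<lambda>m. r powr (\<beta> + real m) * (fact (m + a) * Gamma \<beta> / (fact m * Gamma (\<beta> + real (m + a) + 1)))"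
  let ?I = "\<integral>t. indicator {0<..<r} t * ((1 - t / r) ^ a * t powr (\<beta> - 1) * exp (- t)) \<partial>lborel"
  have f: "?f l = fact a * real (l choose a) * r ^ l / Gamma (\<beta> + real l + 1)" for l
    using poly_falling_poly_Gamma[OF b\<gamma>, of l]
    by (simp add: poly_falling_poly_0 \<beta>_def divide_inverse mult_ac)
  have shift: "?f (m + a) = r ^ a / (r powr \<beta> * Gamma \<beta>) * ?c m" for m
  proof -
    have "fact a * real ((m + a) choose a) = fact (m + a) / fact m"
      using binomial_fact[of a "m + a", where 'a = real] by simp
    thus ?thesis unfolding f using r G by (simp add: powr_add powr_realpow power_add)
  qed
  have sm: "summable ?f" by (rule summable_charlier_sum[OF \<gamma> r])
  have "charlier_sum \<gamma> r (falling_poly 0 a * falling_poly \<gamma> b) = (\<Sum>m. ?f (m + a)) + (\<Sum>l<a. ?f l)"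
    unfolding charlier_sum_def by (rule suminf_split_initial_segment[OF sm])
  also have "(\<Sum>l<a. ?f l) = 0" unfolding f by (intro sum.neutral) (auto simp: binomial_eq_0)
  also have "(\<Sum>m. ?f (m + a)) = r ^ a / (r powr \<beta> * Gamma \<beta>) * (exp r * ?I)"
    unfolding shift by (rule sums_unique[symmetric], rule sums_mult, rule incomplete_gamma_series[OF \<beta> r])
  also have "?I = (- 1 / r) ^ a * lower_moment (\<gamma> - real k) r ([:- r, 1:] ^ a * monom 1 (k - 1 - b))"
    unfolding lower_moment_def integral_mult_right_zero[symmetric]
  proof (rule Bochner_Integration.integral_cong[OF refl])
    fix t :: real
    show "indicator {0<..<r} t * ((1 - t / r) ^ a * t powr (\<beta> - 1) * exp (- t))
      = (- 1 / r) ^ a * (indicator {0<..<r} t * (poly ([:- r, 1:] ^ a * monom 1 (k - 1 - b)) t * (t powr (\<gamma> - real k) * exp (- t))))"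
    proof (cases "t \<in> {0<..<r}")
      case True
      have "1 - t / r = (- 1 / r) * (t - r)" using r by (simp add: field_simps)
      hence 1: "(1 - t / r) ^ a = (- 1 / r) ^ a * (t - r) ^ a" by (simp only: power_mult_distrib)
      have "\<beta> - 1 = real (k - 1 - b) + (\<gamma> - real k)" using b by (simp add: \<beta>_def of_nat_diff)
      hence 2: "t powr (\<beta> - 1) = t ^ (k - 1 - b) * t powr (\<gamma> - real k)"
        using True by (simp add: powr_add powr_realpow)
      show ?thesis unfolding 1 2 by (simp add: poly_monom mult_ac)
    qed simp
  qed
  finally have "charlier_sum \<gamma> r (falling_poly 0 a * falling_poly \<gamma> b) = r ^ a / (r powr \<beta> * Gamma \<beta>)
      * (exp r * ((- 1 / r) ^ a * lower_moment (\<gamma> - real k) r ([:- r, 1:] ^ a * monom 1 (k - 1 - b))))" by simp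
  moreover have "r powr (real b - \<gamma>) = 1 / r powr \<beta>" using powr_minus_divide[of r \<beta>] by (simp add: \<beta>_def)
  moreover have "r ^ a * (- 1 / r) ^ a = (-1) ^ a" using r by (simp add: power_mult_distrib[symmetric])
  ultimately show ?thesis using r by (simp add: \<beta>_def[symmetric] mult_ac)
qed

text \<open>In the limiting Gram determinant the columns are changed from falling factorials with c
  = 0 to those with c = \<gamma>. Each entry is then, up to a row sign and a positive column factor,
  the moment of (t - r)^i t^(k-1-j) over (0, r). Reversing the columns and changing the monic family
  once more gives the Hankel determinant of the probability.\<close>

lemma wronskian_det_limit:
  assumes k: "real k \<le> \<gamma>" and r: "r > 0"
  shows "(\<lambda>n. (\<Prod>a<k. 1 / r ^ a) * \<bar>Determinant.det (mat k k (\<lambda>(a,b). wronskian_sum \<gamma> r n a b))\<bar>)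
     \<longlonglongrightarrow> exp (real k * r) * r powr (- (real k * \<gamma>)) * lue_max_prob k \<gamma> r / (\<Prod>i<k. fact i)"
proof -
  have \<gamma>: "\<gamma> \<ge> 0" and a: "\<gamma> - real k \<ge> 0" using k by auto
  define P where "P = lue_max_prob k \<gamma> r"
  define F where "F = (\<Prod>i<k. fact i :: real)"
  define \<Gamma> where "\<Gamma> = (\<Prod>j<k. Gamma (\<gamma> - real j))"
  have F: "F > 0" unfolding F_def by (intro prod_pos) simp
  have \<Gamma>: "\<Gamma> > 0" unfolding \<Gamma>_def using k by (intro prod_pos ballI Gamma_real_pos) auto
  have P: "P > 0" unfolding P_def by (rule lue_max_prob_pos[OF k r])
  let ?ff = "falling_poly 0" and ?L = "charlier_sum \<gamma> r" and ?M = "lower_moment (\<gamma> - real k) r"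
  have pm: "degree ([:- r, 1:] ^ m) = m" "lead_coeff ([:- r, 1:] ^ m) = 1" for m
  proof -
    show "degree ([:- r, 1:] ^ m) = m" by (simp add: degree_power_eq)
    show "lead_coeff ([:- r, 1:] ^ m) = 1" by (subst lead_coeff_power) simp
  qed
  have hankel: "Determinant.det (mat k k (\<lambda>(i,j). ?M (monom 1 (i + j)))) = P * (\<Gamma> * F)"
    using lue_max_prob_eq[OF k, of r, folded P_def \<Gamma>_def F_def] \<Gamma> F by simp
  have "Determinant.det (mat k k (\<lambda>(i,j). ?L (?ff i * ?ff j))) = Determinant.det (mat k k (\<lambda>(i,j). ?L (monom 1 (i + j))))"
    by (rule det_gram_monic) (rule charlier_sum_linear[OF \<gamma> r] falling_poly_monic)+
  also have "\<dots> = Determinant.det (mat k k (\<lambda>(i,j). ?L (?ff i * falling_poly \<gamma> j)))"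
    by (rule det_gram_monic[symmetric]) (rule charlier_sum_linear[OF \<gamma> r] falling_poly_monic)+
  also have "\<dots> = Determinant.det (mat k k (\<lambda>(i,j). (-1) ^ i * (exp r * r powr (real j - \<gamma>) / Gamma (\<gamma> - real j)) * ?M ([:- r, 1:] ^ i * monom 1 (k - 1 - j))))"
    by (rule arg_cong[where f = Determinant.det], rule eq_matI) (simp_all add: charlier_sum_falling[OF k _ r] del: mult_monom)
  also have "\<dots> = (\<Prod>i<k. (-1) ^ i) * (\<Prod>j<k. exp r * r powr (real j - \<gamma>) / Gamma (\<gamma> - real j))
      * Determinant.det (mat k k (\<lambda>(i,j). ?M ([:- r, 1:] ^ i * monom 1 (k - 1 - j))))"
    by (rule det_scale_rows_cols)
  finally have D0: "Determinant.det (mat k k (\<lambda>(i,j). ?L (?ff i * ?ff j))) = (\<Prod>i<k. (-1) ^ i) * (\<Prod>j<k. exp r * r powr (real j - \<gamma>) / Gamma (\<gamma> - real j))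
      * Determinant.det (mat k k (\<lambda>(i,j). ?M ([:- r, 1:] ^ i * monom 1 (k - 1 - j))))" .
  have D: "\<bar>Determinant.det (mat k k (\<lambda>(i,j). ?L (?ff i * ?ff j)))\<bar>
     = (\<Prod>j<k. exp r * r powr (real j - \<gamma>) / Gamma (\<gamma> - real j)) * \<bar>Determinant.det (mat k k (\<lambda>(i,j). ?M ([:- r, 1:] ^ i * monom 1 (k - 1 - j))))\<bar>"
  proof -
    have "\<bar>\<Prod>i<k. (-1::real) ^ i\<bar> = 1" by (simp add: abs_prod power_abs)
    moreover have "(\<Prod>j<k. exp r * r powr (real j - \<gamma>) / Gamma (\<gamma> - real j)) \<ge> 0"
      using k by (intro prod_nonneg ballI divide_nonneg_nonneg mult_nonneg_nonneg less_imp_le[OF Gamma_real_pos]) auto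
    ultimately show ?thesis unfolding D0 abs_mult by simp
  qed
  have "\<bar>Determinant.det (mat k k (\<lambda>(i,j). ?M ([:- r, 1:] ^ i * monom 1 (k - 1 - j))))\<bar> = \<bar>Determinant.det (mat k k (\<lambda>(i,j). ?M ([:- r, 1:] ^ i * monom 1 j)))\<bar>"
    by (rule abs_det_column_reversal)
  also have "Determinant.det (mat k k (\<lambda>(i,j). ?M ([:- r, 1:] ^ i * monom 1 j))) = Determinant.det (mat k k (\<lambda>(i,j). ?M (monom 1 (i + j))))"
    by (rule det_gram_monic) (rule lower_moment_linear[OF a] pm | simp add: degree_monom_eq)+
  finally have D: "\<bar>Determinant.det (mat k k (\<lambda>(i,j). ?L (?ff i * ?ff j)))\<bar>
     = (\<Prod>j<k. exp r * r powr (real j - \<gamma>) / Gamma (\<gamma> - real j)) * (P * (\<Gamma> * F))"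
    using D hankel P \<Gamma> F by simp
  have E: "(\<Prod>j<k. exp r * r powr (real j - \<gamma>) / Gamma (\<gamma> - real j)) = exp (real k * r) * r powr (- (real k * \<gamma>)) * (\<Prod>j<k. r ^ j) / \<Gamma>"
  proof -
    have "r powr (real j - \<gamma>) = r powr (- \<gamma>) * r ^ j" for j
      using r powr_add[of r "- \<gamma>" "real j"] by (simp add: powr_realpow add.commute)
    hence "(\<Prod>j<k. exp r * r powr (real j - \<gamma>) / Gamma (\<gamma> - real j)) = exp r ^ k * (r powr (- \<gamma>)) ^ k * (\<Prod>j<k. r ^ j) / \<Gamma>"
      by (simp add: prod_dividef prod.distrib \<Gamma>_def)
    moreover have "(r powr (- \<gamma>)) ^ k = r powr (- (real k * \<gamma>))" using r by (simp add: powr_power mult.commute)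
    ultimately show ?thesis by (simp add: exp_of_nat_mult)
  qed
  have "(\<lambda>n. (\<Prod>a<k. 1 / r ^ a) * \<bar>Determinant.det (mat k k (\<lambda>(a,b). wronskian_sum \<gamma> r n a b))\<bar>)
     \<longlonglongrightarrow> (\<Prod>a<k. 1 / r ^ a) * \<bar>Determinant.det (mat k k (\<lambda>(a,b). ?L (?ff a * ?ff b) / (fact a * fact b)))\<bar>"
    by (intro tendsto_intros tendsto_det wronskian_sum_tendsto \<gamma> r)
  also have "Determinant.det (mat k k (\<lambda>(a,b). ?L (?ff a * ?ff b) / (fact a * fact b)))
     = Determinant.det (mat k k (\<lambda>(a,b). (1 / fact a) * (1 / fact b) * ?L (?ff a * ?ff b)))" by simp
  also have "\<dots> = (\<Prod>a<k. 1 / fact a) * (\<Prod>a<k. 1 / fact a) * Determinant.det (mat k k (\<lambda>(a,b). ?L (?ff a * ?ff b)))"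
    by (rule det_scale_rows_cols)
  \<comment> \<open>The binomial coefficients leave the product of 1/a! twice; one copy cancels
    against the factorials in the Laguerre normalization, and the Gamma factors cancel
    completely.\<close>
  also have "(\<Prod>a<k. 1 / fact a) = 1 / F" by (simp add: F_def prod_dividef)
  also have "\<bar>1 / F * (1 / F) * Determinant.det (mat k k (\<lambda>(a,b). ?L (?ff a * ?ff b)))\<bar>
     = 1 / F * (1 / F) * (exp (real k * r) * r powr (- (real k * \<gamma>)) * (\<Prod>j<k. r ^ j) / \<Gamma> * (P * (\<Gamma> * F)))"
    unfolding abs_mult D E using F by simp
  also have "(\<Prod>a<k. 1 / r ^ a) * \<dots> = exp (real k * r) * r powr (- (real k * \<gamma>)) * P / F"
  proof -
    have "(\<Prod>j<k. r ^ j) \<noteq> 0" using r by simp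
    moreover have "(\<Prod>a<k. 1 / r ^ a) = 1 / (\<Prod>j<k. r ^ j)" by (simp add: prod_dividef)
    ultimately show ?thesis using F \<Gamma> by simp
  qed
  finally show ?thesis unfolding P_def F_def .
qed

section \<open>The Ginibre ensemble\<close>

lemma sets_cgauss [measurable_cong]: "sets cgauss = sets borel"
  by (simp add: cgauss_def)

text \<open>Rewrites the law of the entries as a density with respect to product Lebesgue measure,
  where the linear changes of variables are available.\<close>

lemma PiM_cgauss:
  assumes I: "finite I"
  shows "PiM I (\<lambda>_. cgauss) = density (cvec I) (\<lambda>G. \<Prod>i\<in>I. ennreal (exp (- (cmod (G i))\<^sup>2) / pi))"
proof -
  have "sigma_finite_measure cgauss"
    unfolding cgauss_def by (subst sigma_finite_measure.sigma_finite_iff_density_finite[OF lborel.sigma_finite_measure_axioms]) auto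
  then interpret product_sigma_finite "\<lambda>_. cgauss" by (rule product_sigma_finite.intro)
  let ?D = "density (cvec I) (\<lambda>G. \<Prod>i\<in>I. ennreal (exp (- (cmod (G i))\<^sup>2) / pi))"
  show ?thesis
  proof (rule PiM_eqI[symmetric, OF I])
    show "sets ?D = sets (PiM I (\<lambda>_. cgauss))" by (simp add: sets_cgauss cong: sets_PiM_cong)
  next
    fix A assume A: "\<And>i. i \<in> I \<Longrightarrow> A i \<in> sets cgauss"
    hence A': "A i \<in> sets borel" if "i \<in> I" for i using that by (simp add: sets_cgauss)
    have "emeasure ?D (Pi\<^sub>E I A) = (\<integral>\<^sup>+G. (\<Prod>i\<in>I. ennreal (exp (- (cmod (G i))\<^sup>2) / pi)) * indicator (Pi\<^sub>E I A) G \<partial>cvec I)"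
      by (rule emeasure_density) (use A' I in \<open>auto intro!: sets_PiM_I_finite\<close>)
    also have "\<dots> = (\<integral>\<^sup>+G. (\<Prod>i\<in>I. ennreal (exp (- (cmod (G i))\<^sup>2) / pi) * indicator (A i) (G i)) \<partial>cvec I)"
    proof (rule nn_integral_cong)
      fix G assume "G \<in> space (cvec I)"
      hence "indicator (Pi\<^sub>E I A) G = (\<Prod>i\<in>I. indicator (A i) (G i) :: ennreal)"
        using I by (auto simp: indicator_def space_PiM PiE_iff prod_zero_iff)
      thus "(\<Prod>i\<in>I. ennreal (exp (- (cmod (G i))\<^sup>2) / pi)) * indicator (Pi\<^sub>E I A) G = (\<Prod>i\<in>I. ennreal (exp (- (cmod (G i))\<^sup>2) / pi) * indicator (A i) (G i))"
        by (simp add: prod.distrib)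
    qed
    also have "\<dots> = (\<Prod>i\<in>I. \<integral>\<^sup>+w. ennreal (exp (- (cmod w)\<^sup>2) / pi) * indicator (A i) w \<partial>lborel)"
      by (rule clborel.product_nn_integral_prod[OF I, where f = "\<lambda>i w. ennreal (exp (- (cmod w)\<^sup>2) / pi) * indicator (A i) w"]) (use A' in auto)
    also have "\<dots> = (\<Prod>i\<in>I. emeasure cgauss (A i))"
      by (intro prod.cong refl) (use A' in \<open>auto simp: cgauss_def emeasure_density\<close>)
    finally show "emeasure ?D (Pi\<^sub>E I A) = (\<Prod>i\<in>I. emeasure cgauss (A i))" .
  qed
qed

lemma sets_ginibre [measurable_cong]: "sets (ginibre N) = sets (cmat N)"
  unfolding ginibre_def by (intro sets_PiM_cong) (auto simp: sets_cgauss)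

lemma nn_integral_ginibre:
  assumes f: "f \<in> borel_measurable (cmat N)"
  shows "(\<integral>\<^sup>+G. f G \<partial>ginibre N) = (\<integral>\<^sup>+G. ennreal (exp (- fro (fun_mat N G)) / pi ^ (N * N)) * f G \<partial>cmat N)"
proof -
  have "(\<Prod>p\<in>{..<N} \<times> {..<N}. ennreal (exp (- (cmod (G p))\<^sup>2) / pi)) = ennreal (exp (- fro (fun_mat N G)) / pi ^ (N * N))" for G
    by (simp add: prod_ennreal prod_dividef fro_fun_mat exp_sum sum_negf[symmetric])
  thus ?thesis unfolding ginibre_def 
    by (simp add: PiM_cgauss) (rule nn_integral_density[OF _ f], unfold fro_fun_mat, measurable)
qed

text \<open>In terms of the unscaled matrix the shift x/sqrt(N) is the fixed point \<open>x\<close>,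
  so \<open>N\<close> enters only through the size of the matrix and a scalar power.\<close>

lemma mdet_ginibre_shift:
  "mdet N (ginibre_shift N (x / complex_of_real (sqrt (real N))) G) = (- 1 / complex_of_real (sqrt (real N))) ^ N * poly (char_poly (fun_mat N G)) x"
proof -
  define s where "s = complex_of_real (sqrt (real N))"
  have "Determinant.det (mat N N (\<lambda>(i,j). (- 1 / s) * 1 * ((if i = j then x else 0) - G (i,j)))) = (- 1 / s) ^ N * poly (char_poly (fun_mat N G)) x"
    unfolding det_scale_rows_cols[where c = "\<lambda>_. - 1 / s" and d = "\<lambda>_. 1"]
    by (subst poly_char_poly[where n = N], force)
       (auto intro!: arg_cong[where f = Determinant.det] eq_matI)
  moreover have "mdet N (ginibre_shift N (x / s) G) = Determinant.det (mat N N (\<lambda>(i,j). (- 1 / s) * 1 * ((if i = j then x else 0) - G (i,j))))"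
    unfolding mdet_def det_mat_def ginibre_shift_def s_def[symmetric]
    by (intro sum.cong prod.cong arg_cong2[where f = "(*)"] refl) (auto simp: diff_divide_distrib)
  ultimately show ?thesis by (simp add: s_def)
qed

text \<open>The powers of pi from \<open>schur_const\<close>, from the Gram determinant and from the
  Gaussian density cancel, as does N!; the k + N Gamma values are split at \<open>N\<close>.\<close>

lemma ginibre_char_moment:
  fixes \<gamma> :: real and u :: complex and k N :: nat
  assumes \<gamma>: "\<gamma> \<ge> 0" and u: "u \<noteq> 0" and N: "N > 0"
  defines "r \<equiv> (cmod u)\<^sup>2"
  shows "(\<integral>G. cmod (mdet N (ginibre_shift N 0 G)) powr (2 * \<gamma>) * cmod (mdet N (ginibre_shift N (u / complex_of_real (sqrt (real N))) G)) ^ (2 * k) \<partial>ginibre N)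
    = (\<Prod>j<N. Gamma (\<gamma> + real j + 1) / fact j) * (\<Prod>l<k. Gamma (\<gamma> + real (N + l) + 1)) * real N powr (- (real N * (\<gamma> + real k)))
      * ((\<Prod>a<k. 1 / r ^ a) * \<bar>Determinant.det (mat k k (\<lambda>(a,b). wronskian_sum \<gamma> r (N + k) a b))\<bar>)"
proof -
  define D where "D = Determinant.det (mat k k (\<lambda>(a,b). wronskian_sum \<gamma> r (N + k) a b))"
  define R where "R = (\<Prod>a<k. 1 / r ^ a)"
  define d where "d = (\<Prod>l<k+N. Gamma (\<gamma> + real l + 1)) * pi ^ N * (R * D)"
  have r: "r > 0" using u by (simp add: r_def)
  have R: "R > 0" unfolding R_def using r by (intro prod_pos) auto
  have d: "gauss_mean (char_weight \<gamma> k u) N = ennreal (schur_const N * fact N * d)" "d \<ge> 0"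
    using gauss_mean_char_weight[OF \<gamma> u, of k N] by (simp_all add: d_def R_def D_def r_def add.commute)
  have GP: "(\<Prod>l<k+N. Gamma (\<gamma> + real l + 1)) > 0" using \<gamma> by (intro prod_pos ballI Gamma_real_pos) auto
  have "(\<Prod>l<k+N. Gamma (\<gamma> + real l + 1)) * pi ^ N * R > 0" using GP R by simp
  \<comment> \<open>Nonnegativity of \<open>d\<close>, inherited from the Coulomb integral, passes
    to \<open>D\<close> because all other factors are positive. This justifies the absolute value in
    the statement.\<close>
  hence D0: "D \<ge> 0" using d(2) unfolding d_def mult.assoc[symmetric] by (simp only: zero_le_mult_iff) auto
  define c where "c = real N powr (- (real N * (\<gamma> + real k)))"
  define f where "f G = cmod (mdet N (ginibre_shift N 0 G)) powr (2 * \<gamma>) * cmod (mdet N (ginibre_shift N (u / complex_of_real (sqrt (real N))) G)) ^ (2 * k)" for G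
  define h where "h G = cmod (poly (char_poly (fun_mat N G)) 0) powr (2 * \<gamma>) * cmod (poly (char_poly (fun_mat N G)) u) ^ (2 * k)" for G
  have norm: "cmod ((- 1 / complex_of_real (sqrt (real N))) ^ N) = real N powr (- real N / 2)"
  proof -
    have "cmod ((- 1 / complex_of_real (sqrt (real N))) ^ N) = (real N powr (- 1 / 2)) ^ N"
    proof -
      have "1 / sqrt (real N) = real N powr (- 1 / 2)"
        using powr_minus_divide[of "real N" "1 / 2"] powr_half_sqrt[of "real N"] by simp
      thus ?thesis by (simp add: norm_power norm_divide)
    qed
    also have "\<dots> = real N powr (- real N / 2)"
      using N by (subst powr_power) auto
    finally show ?thesis .
  qed
  have f: "f G = c * h G" for G
  proof -
    have "cmod (mdet N (ginibre_shift N 0 G)) = real N powr (- real N / 2) * cmod (poly (char_poly (fun_mat N G)) 0)"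
      using mdet_ginibre_shift[of N 0 G] norm by (simp add: norm_mult)
    moreover have "cmod (mdet N (ginibre_shift N (u / complex_of_real (sqrt (real N))) G)) = real N powr (- real N / 2) * cmod (poly (char_poly (fun_mat N G)) u)"
      unfolding mdet_ginibre_shift norm_mult norm ..
    moreover have "(real N powr (- real N / 2)) powr (2 * \<gamma>) * (real N powr (- real N / 2)) ^ (2 * k) = c"
      unfolding c_def using N by (simp add: powr_power powr_powr powr_add[symmetric] algebra_simps)
    ultimately show ?thesis by (simp add: f_def h_def powr_mult power_mult_distrib mult_ac)
  qed
  have [measurable]: "(\<lambda>G. poly (char_poly (fun_mat N G)) x) \<in> borel_measurable (cmat N)" for x
    by (rule measurable_char_poly) auto
  have hm [measurable]: "h \<in> borel_measurable (cmat N)" unfolding h_def[abs_def] by measurable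
  have c0: "c \<ge> 0" by (simp add: c_def)
  have h0: "h G \<ge> 0" for G by (simp add: h_def)
  have fro [measurable]: "(\<lambda>G. fro (fun_mat N G)) \<in> borel_measurable (cmat N)" unfolding fro_fun_mat by measurable
  have "(\<integral>\<^sup>+G. ennreal (f G) \<partial>ginibre N) = (\<integral>\<^sup>+G. ennreal (exp (- fro (fun_mat N G)) / pi ^ (N * N)) * ennreal (f G) \<partial>cmat N)"
    by (rule nn_integral_ginibre) (simp add: f)
  also have "\<dots> = (\<integral>\<^sup>+G. ennreal (c / pi ^ (N * N)) * gauss_weight (char_weight \<gamma> k u) (fun_mat N G) \<partial>cmat N)"
    by (intro nn_integral_cong)
       (use c0 h0 in \<open>simp add: f gauss_weight_def char_weight_def h_def ennreal_mult[symmetric] mult_ac\<close>)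
  also have "\<dots> = ennreal (c / pi ^ (N * N)) * gauss_mean (char_weight \<gamma> k u) N"
    unfolding gauss_mean_def
    by (rule nn_integral_cmult) (simp add: gauss_weight_def char_weight_def h_def[symmetric])
  also have "\<dots> = ennreal (c / pi ^ (N * N) * (schur_const N * fact N * d))"
    unfolding d(1) using c0 by (subst ennreal_mult') auto
  finally have nn: "(\<integral>\<^sup>+G. ennreal (f G) \<partial>ginibre N) = ennreal (c / pi ^ (N * N) * (schur_const N * fact N * d))" .
  have "(\<integral>G. f G \<partial>ginibre N) = enn2real (\<integral>\<^sup>+G. ennreal (f G) \<partial>ginibre N)"
    by (rule integral_eq_nn_integral) (use c0 h0 in \<open>auto simp: f\<close>)
  also have "\<dots> = c / pi ^ (N * N) * (schur_const N * fact N * d)"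
    unfolding nn using c0 d(2) schur_const_pos[of N] by (intro enn2real_ennreal) (auto intro!: mult_nonneg_nonneg)
  also have "\<dots> = c * (schur_const N * fact N * d / pi ^ (N * N))" by simp
  also have "schur_const N * fact N * d / pi ^ (N * N) = (\<Prod>j<N. Gamma (\<gamma> + real j + 1) / fact j) * (\<Prod>l<k. Gamma (\<gamma> + real (N + l) + 1)) * (R * D)"
  proof -
    have 1: "(\<Prod>j\<le>N. fact j) = (\<Prod>j<N. fact j) * (fact N :: real)" by (simp add: lessThan_Suc_atMost[symmetric])
    have "N * N = N * N - N + N" using N by simp
    hence 2: "pi ^ (N * N) = pi ^ (N * N - N) * pi ^ N" by (metis power_add)
    have 3: "(\<Prod>l<k+N. Gamma (\<gamma> + real l + 1)) = (\<Prod>j<N. Gamma (\<gamma> + real j + 1)) * (\<Prod>l<k. Gamma (\<gamma> + real (N + l) + 1))"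
      by (induction k) (simp_all add: add_ac mult_ac)
    have "(\<Prod>j<N. fact j) \<noteq> (0::real)" by simp
    thus ?thesis unfolding d_def schur_const_def 1 2 3 by (simp add: prod_dividef field_simps)
  qed
  finally show ?thesis using D0 unfolding f_def c_def D_def R_def by (simp only: abs_of_nonneg mult_ac)
qed

theorem theorem1p5:
  fixes k2 :: nat and \<gamma> :: real and u2 :: complex
  assumes "k2 \<ge> 1" and "\<gamma> \<ge> real k2" and "u2 \<noteq> 0"
  shows "(\<lambda>N::nat. \<integral>G. cmod (mdet N (ginibre_shift N 0 G)) powr (2 * \<gamma>) *
                        cmod (mdet N (ginibre_shift N (u2 / complex_of_real (sqrt (real N))) G)) ^ (2 * k2)
                     \<partial>ginibre N)
     \<sim>[at_top]
     (\<lambda>N::nat. exp (real k2 * (cmod u2)\<^sup>2 - (\<gamma> + real k2) * real N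
                     + (\<gamma>\<^sup>2 + (real k2)\<^sup>2) / 2 * ln (real N))
        * exp (- 2 * real k2 * \<gamma> * ln (cmod (u2 / complex_of_real (sqrt (real N)))))
        * ((2 * pi) powr ((\<gamma> + real k2) / 2) / (barnes_G (1 + real k2) * barnes_G (1 + \<gamma>)))
        * lue_max_prob k2 \<gamma> ((cmod u2)\<^sup>2))"
  (is "?m \<sim>[at_top] ?g")
proof -
  define r where "r = (cmod u2)\<^sup>2"
  define P where "P = lue_max_prob k2 \<gamma> r"
  define Q where "Q = (2 * pi) powr ((\<gamma> + real k2) / 2) / (barnes_G (1 + real k2) * barnes_G (1 + \<gamma>))"
  define F where "F = (\<Prod>i<k2. fact i :: real)"
  define T where "T N = (\<Prod>j<N. Gamma (\<gamma> + real j + 1) / fact j) * (\<Prod>l<k2. Gamma (\<gamma> + real (N + l) + 1))" for N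
  define c where "c N = real N powr (- (real N * (\<gamma> + real k2)))" for N
  define h where "h N = exp (- (\<gamma> + real k2) * real N + (\<gamma>\<^sup>2 + (real k2)\<^sup>2) / 2 * ln (real N))" for N
  define W where "W N = (\<Prod>a<k2. 1 / r ^ a) * \<bar>Determinant.det (mat k2 k2 (\<lambda>(a,b). wronskian_sum \<gamma> r (N + k2) a b))\<bar>" for N
  define Wlim where "Wlim = exp (real k2 * r) * r powr (- (real k2 * \<gamma>)) * P / F"
  have \<gamma>: "\<gamma> \<ge> 0" using assms(2) by linarith
  have r: "r > 0" using assms(3) by (simp add: r_def)
  have P: "P > 0" unfolding P_def by (rule lue_max_prob_pos[OF assms(2) r])
  have F: "F > 0" unfolding F_def by (intro prod_pos) auto
  have Wlim: "Wlim > 0" unfolding Wlim_def using r P F by simp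
  have limW: "W \<longlonglongrightarrow> Wlim"
    unfolding W_def[abs_def] Wlim_def P_def F_def
    by (rule LIMSEQ_ignore_initial_segment[OF wronskian_det_limit[OF assms(2) r]])
  \<comment> \<open>The division by \<open>F\<close> is borrowed from \<open>Wlim\<close>: these
    factorials are what completes the second Barnes product.\<close>
  have "(\<lambda>N. T N / F * c N / (h N * real N powr (real k2 * \<gamma>) * Q)) \<longlonglongrightarrow> 1"
    unfolding T_def F_def c_def h_def Q_def using \<gamma> by (intro prod_Gamma_asymp) simp
  from tendsto_mult[OF this tendsto_divide[OF limW tendsto_const, of Wlim]]
  have "(\<lambda>N. T N / F * c N / (h N * real N powr (real k2 * \<gamma>) * Q) * (W N / Wlim)) \<longlonglongrightarrow> 1"
    using Wlim by simp
  moreover have "\<forall>\<^sub>F N in sequentially. T N / F * c N / (h N * real N powr (real k2 * \<gamma>) * Q) * (W N / Wlim) = ?m N / ?g N"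
    using eventually_gt_at_top[of 0]
  proof eventually_elim
    case (elim N)
    have m: "?m N = T N * c N * W N"
      unfolding ginibre_char_moment[OF \<gamma> assms(3) elim] T_def c_def W_def r_def by simp
    \<comment> \<open>The factor |u2/sqrt(N)|^(-2 k2 \<gamma>) is split into a power of
      \<open>r\<close>, which matches the limit of the determinant, and N^(k2 \<gamma>), which
      matches the Gamma products.\<close>
    have "ln (cmod (u2 / complex_of_real (sqrt (real N)))) = ln r / 2 - ln (real N) / 2"
      using assms(3) elim by (simp add: r_def norm_divide ln_div ln_sqrt ln_realpow)
    hence "exp (- 2 * real k2 * \<gamma> * ln (cmod (u2 / complex_of_real (sqrt (real N))))) = exp (- (real k2 * \<gamma>) * ln r + real k2 * \<gamma> * ln (real N))"
      by (simp only:) (simp add: algebra_simps)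
    also have "\<dots> = r powr (- (real k2 * \<gamma>)) * real N powr (real k2 * \<gamma>)"
      unfolding exp_add using r elim by (simp add: powr_def)
    finally have e: "exp (- 2 * real k2 * \<gamma> * ln (cmod (u2 / complex_of_real (sqrt (real N))))) = r powr (- (real k2 * \<gamma>)) * real N powr (real k2 * \<gamma>)" .
    have h: "exp (real k2 * (cmod u2)\<^sup>2 - (\<gamma> + real k2) * real N + (\<gamma>\<^sup>2 + (real k2)\<^sup>2) / 2 * ln (real N)) = exp (real k2 * r) * h N"
      unfolding h_def exp_add[symmetric] by (simp add: r_def algebra_simps)
    have "?g N = (exp (real k2 * r) * h N) * (r powr (- (real k2 * \<gamma>)) * real N powr (real k2 * \<gamma>)) * Q * P"
      unfolding e h Q_def P_def r_def ..
    also have "\<dots> = h N * real N powr (real k2 * \<gamma>) * Q * (Wlim * F)" using F by (simp add: Wlim_def)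
    finally show ?case unfolding m by simp
  qed
  ultimately have "(\<lambda>N. ?m N / ?g N) \<longlonglongrightarrow> 1" by (rule Lim_transform_eventually)
  thus ?thesis by (rule asymp_equivI')
qed

end
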